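(* Let $W=\{W_t:t\ge 0\}$ be a Brownian motion on a complete probability space, let $b,\sigma\in C^1(\mathbb{R})$, $\xi\in\mathbb{R}$, and let $X^\xi$ be the solution, up to its explosion time $\tau_\xi$, of $$X_t^\xi=\xi+\int_0^t b(X_s^\xi)\,ds+\int_0^t\sigma(X_s^\xi)\,dW_s,\quad t\ge 0.$$ Consider a bounded function $u:[0,\infty)\times\mathbb{R}\to\mathbb{R}$ that satisfies the following boundary value problem: $$\frac{\partial u}{\partial t}(t,x)=\frac12\sigma^2(x)\frac{\partial^2u}{\partial x^2}(t,x)+b(x)\frac{\partial u}{\partial x}(t,x),\quad t>0\text{ and }x\in\mathbb{R},$$ $$u(0,x)=0\quad\text{for all }x\in\mathbb{R}.$$ (a) Assume that $u(t,\infty)=u(t,-\infty)=1$. Then $P(\tau_\xi\le t)=u(t,\xi)$. (b) $u(t,\infty)=1$ and $u(t,-\infty)=0$ implies that $P(\tau_\xi^+\le t)=u(t,\xi)$. (c) If $u(t,\infty)=0$ and $u(t,-\infty)=1$, then $P(\tau_\xi^-\le t)=u(t,\xi)$.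
   Context: The explosion time $\tau_\xi$ of $X^\xi$ is the stopping time up to which the equation has a solution and such that $\limsup_{t\uparrow\tau_\xi}|X_t^\xi|=\infty$. It is known that $X^\xi_{(\tau_\xi)-}\in\{-\infty,\infty\}$ on $[\tau_\xi<\infty]$, and one writes $\tau_\xi^+=\inf\{t>0:X_t^\xi=\infty\}$ and $\tau_\xi^-=\inf\{t>0:X_t^\xi=-\infty\}$. Here $u(t,\infty)$ and $u(t,-\infty)$ denote the boundary values of $u(t,x)$ at $x=\infty$ and $x=-\infty$.
   Formalization: u is taken as a classical (C^{1,2} for t>0) solution with u(t,x)→0 as t→0+ for each x, and boundary values at x=±∞ are required for t>0 only; without the initial limit, u=1 for t>0 with u(0,x)=0 is a counterexample. *)

theory Defs
  imports "HOL-Probability.Probability"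
begin

text \<open>
  Time is indexed by \<open>real\<close>; only times \<open>t \<ge> 0\<close> are relevant, and a
  filtration given on \<open>[0, \<infinity>)\<close> is extended to negative times by \<open>F 0\<close>.
  The filtration is required to contain the null sets but not to be right-continuous; in
  particular the augmented filtration generated by \<open>W\<close> is an admissible choice.
\<close>

definition complete_filtration :: "'a measure \<Rightarrow> (real \<Rightarrow> 'a measure) \<Rightarrow> bool" where
  "complete_filtration M F \<longleftrightarrow>
     filtration (space M) F \<and> (\<forall>t. sets (F t) \<subseteq> sets M) \<and> null_sets M \<subseteq> sets (F 0)"

definition adapted_process :: "(real \<Rightarrow> 'a measure) \<Rightarrow> (real \<Rightarrow> 'a \<Rightarrow> real) \<Rightarrow> bool" where
  "adapted_process F Y \<longleftrightarrow> (\<forall>t\<ge>0. Y t \<in> borel_measurable (F t))"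

definition progressive_process :: "(real \<Rightarrow> 'a measure) \<Rightarrow> (real \<Rightarrow> 'a \<Rightarrow> real) \<Rightarrow> bool" where
  "progressive_process F Y \<longleftrightarrow>
     (\<forall>T\<ge>0. (\<lambda>(t, \<omega>). Y t \<omega>) \<in> borel_measurable (restrict_space borel {0..T} \<Otimes>\<^sub>M F T))"

definition brownian_motion ::
  "'a measure \<Rightarrow> (real \<Rightarrow> 'a measure) \<Rightarrow> (real \<Rightarrow> 'a \<Rightarrow> real) \<Rightarrow> bool" where
  "brownian_motion M F W \<longleftrightarrow>
     adapted_process F W \<and>
     (AE \<omega> in M. W 0 \<omega> = 0) \<and>
     (\<forall>\<omega>\<in>space M. continuous_on {0..} (\<lambda>t. W t \<omega>)) \<and>
     (\<forall>s\<ge>0. \<forall>t>s.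
        distributed M lborel (\<lambda>\<omega>. W t \<omega> - W s \<omega>) (normal_density 0 (sqrt (t - s))) \<and>
        prob_space.indep_set M (sets (F s))
          (sets (vimage_algebra (space M) (\<lambda>\<omega>. W t \<omega> - W s \<omega>) borel)))"

text \<open>
  A simple integrand \<open>(n, s, h)\<close> stands for the process
  \<open>\<Sum>i<n. h i * indicator {s i <.. s (Suc i)}\<close> with \<open>h i\<close> bounded and
  \<open>F (s i)\<close>-measurable.
\<close>

definition simple_integrand ::
  "(real \<Rightarrow> 'a measure) \<Rightarrow> nat \<Rightarrow> (nat \<Rightarrow> real) \<Rightarrow> (nat \<Rightarrow> 'a \<Rightarrow> real) \<Rightarrow> bool" where
  "simple_integrand F n s h \<longleftrightarrow>
     0 \<le> s 0 \<and>
     (\<forall>i<n. s i \<le> s (Suc i) \<and> h i \<in> borel_measurable (F (s i)) \<and>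
            (\<exists>C. \<forall>\<omega>\<in>space (F (s i)). \<bar>h i \<omega>\<bar> \<le> C))"

definition simple_process ::
  "nat \<Rightarrow> (nat \<Rightarrow> real) \<Rightarrow> (nat \<Rightarrow> 'a \<Rightarrow> real) \<Rightarrow> real \<Rightarrow> 'a \<Rightarrow> real" where
  "simple_process n s h t \<omega> = (\<Sum>i<n. h i \<omega> * indicator {s i<..s (Suc i)} t)"

definition simple_integral ::
  "(real \<Rightarrow> 'a \<Rightarrow> real) \<Rightarrow> nat \<Rightarrow> (nat \<Rightarrow> real) \<Rightarrow> (nat \<Rightarrow> 'a \<Rightarrow> real) \<Rightarrow> real \<Rightarrow> 'a \<Rightarrow> real" where
  "simple_integral W n s h t \<omega> =
     (\<Sum>i<n. h i \<omega> * (W (min t (s (Suc i))) \<omega> - W (min t (s i)) \<omega>))"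

text \<open>
  Measurability is part of this definition because \<open>measure M\<close> is \<open>0\<close> on
  non-measurable sets.
\<close>

definition null_in_probability :: "'a measure \<Rightarrow> (nat \<Rightarrow> 'a \<Rightarrow> ennreal) \<Rightarrow> bool" where
  "null_in_probability M Y \<longleftrightarrow>
     (\<forall>k. Y k \<in> borel_measurable M) \<and>
     (\<forall>\<epsilon>>0. (\<lambda>k. measure M {\<omega> \<in> space M. ennreal \<epsilon> < Y k \<omega>}) \<longlonglongrightarrow> 0)"

text \<open>
  \<open>is_ito_integral M F W H I\<close>: the process \<open>I\<close> is a continuous version of
  \<open>t \<mapsto> \<integral>\<^sub>0\<^sup>t H dW\<close>, for a progressive \<open>H\<close> with locally
  square integrable paths. The integral is the limit in probability, uniformly on compact time
  intervals, of the integrals of simple integrands approximating \<open>H\<close> in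
  \<open>L\<^sup>2([0, T])\<close> in probability; this determines \<open>I\<close> up to
  indistinguishability.
\<close>

definition is_ito_integral ::
  "'a measure \<Rightarrow> (real \<Rightarrow> 'a measure) \<Rightarrow> (real \<Rightarrow> 'a \<Rightarrow> real) \<Rightarrow>
   (real \<Rightarrow> 'a \<Rightarrow> real) \<Rightarrow> (real \<Rightarrow> 'a \<Rightarrow> real) \<Rightarrow> bool" where
  "is_ito_integral M F W H I \<longleftrightarrow>
     progressive_process F H \<and>
     (AE \<omega> in M. \<forall>T\<ge>0. (\<integral>\<^sup>+t\<in>{0..T}. ennreal ((H t \<omega>)\<^sup>2) \<partial>lborel) < \<infinity>) \<and>
     adapted_process F I \<and>
     (\<forall>\<omega>\<in>space M. continuous_on {0..} (\<lambda>t. I t \<omega>)) \<and>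
     (\<exists>n s h.
        (\<forall>k. simple_integrand F (n k) (s k) (h k)) \<and>
        (\<forall>T\<ge>0.
           null_in_probability M (\<lambda>k \<omega>.
             \<integral>\<^sup>+t\<in>{0..T}. ennreal ((simple_process (n k) (s k) (h k) t \<omega> - H t \<omega>)\<^sup>2) \<partial>lborel) \<and>
           null_in_probability M (\<lambda>k \<omega>.
             SUP t\<in>{0..T}. ennreal \<bar>simple_integral W (n k) (s k) (h k) t \<omega> - I t \<omega>\<bar>)))"

text \<open>
  \<open>X t \<omega>\<close> is only meaningful for \<open>t < \<tau> \<omega>\<close>, hence the guards. The
  equation on \<open>[0, \<tau>)\<close> is the family of equations stopped at stopping times
  \<open>\<rho> < \<tau>\<close>, where the stochastic integral up to \<open>t \<and> \<rho>\<close> is the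
  integral over \<open>[0, t]\<close> of the integrand cut off after \<open>\<rho>\<close>.
\<close>

definition sde_solution_up_to_explosion ::
  "'a measure \<Rightarrow> (real \<Rightarrow> 'a measure) \<Rightarrow> (real \<Rightarrow> 'a \<Rightarrow> real) \<Rightarrow> (real \<Rightarrow> real) \<Rightarrow> (real \<Rightarrow> real) \<Rightarrow>
   real \<Rightarrow> (real \<Rightarrow> 'a \<Rightarrow> real) \<Rightarrow> ('a \<Rightarrow> ereal) \<Rightarrow> bool" where
  "sde_solution_up_to_explosion M F W b \<sigma> \<xi> X \<tau> \<longleftrightarrow>
     (\<forall>t\<ge>0. Measurable.pred (F t) (\<lambda>\<omega>. \<tau> \<omega> \<le> ereal t)) \<and>
     (\<forall>\<omega>\<in>space M. 0 < \<tau> \<omega>) \<and>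
     adapted_process F (\<lambda>t \<omega>. if ereal t < \<tau> \<omega> then X t \<omega> else 0) \<and>
     (\<forall>\<omega>\<in>space M. continuous_on {t. 0 \<le> t \<and> ereal t < \<tau> \<omega>} (\<lambda>t. X t \<omega>)) \<and>
     (\<forall>\<rho>. stopping_time F \<rho> \<and> (\<forall>\<omega>\<in>space M. 0 \<le> \<rho> \<omega> \<and> ereal (\<rho> \<omega>) < \<tau> \<omega>) \<longrightarrow>
        (\<exists>I. is_ito_integral M F W (\<lambda>t \<omega>. if t \<le> \<rho> \<omega> then \<sigma> (X t \<omega>) else 0) I \<and>
          (AE \<omega> in M. \<forall>t\<ge>0.
             X (min t (\<rho> \<omega>)) \<omega> =
               \<xi> + (LINT r:{0..min t (\<rho> \<omega>)}|lborel. b (X r \<omega>)) + I t \<omega>))) \<and>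
     (AE \<omega> in M. \<tau> \<omega> < \<infinity> \<longrightarrow>
        Limsup (at_left (real_of_ereal (\<tau> \<omega>))) (\<lambda>t. ereal \<bar>X t \<omega>\<bar>) = \<infinity>)"

text \<open>
  From the explosion time on, the process rests at its left limit at that time, which is
  almost surely \<open>\<infinity>\<close> or \<open>-\<infinity>\<close>. On the exceptional null set without a
  left limit the value is unspecified.
\<close>

definition extended_process ::
  "(real \<Rightarrow> 'a \<Rightarrow> real) \<Rightarrow> ('a \<Rightarrow> ereal) \<Rightarrow> real \<Rightarrow> 'a \<Rightarrow> ereal" where
  "extended_process X \<tau> t \<omega> =
     (if ereal t < \<tau> \<omega> then ereal (X t \<omega>)
      else Lim (at_left (real_of_ereal (\<tau> \<omega>))) (\<lambda>s. ereal (X s \<omega>)))"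

definition explosion_time_pos :: "(real \<Rightarrow> 'a \<Rightarrow> real) \<Rightarrow> ('a \<Rightarrow> ereal) \<Rightarrow> 'a \<Rightarrow> ereal" where
  "explosion_time_pos X \<tau> \<omega> = Inf {ereal t |t. 0 < t \<and> extended_process X \<tau> t \<omega> = \<infinity>}"

definition explosion_time_neg :: "(real \<Rightarrow> 'a \<Rightarrow> real) \<Rightarrow> ('a \<Rightarrow> ereal) \<Rightarrow> 'a \<Rightarrow> ereal" where
  "explosion_time_neg X \<tau> \<omega> = Inf {ereal t |t. 0 < t \<and> extended_process X \<tau> t \<omega> = -\<infinity>}"

definition partial_t :: "(real \<Rightarrow> real \<Rightarrow> real) \<Rightarrow> real \<Rightarrow> real \<Rightarrow> real" where
  "partial_t u t x = deriv (\<lambda>s. u s x) t"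

definition partial_x :: "(real \<Rightarrow> real \<Rightarrow> real) \<Rightarrow> real \<Rightarrow> real \<Rightarrow> real" where
  "partial_x u t x = deriv (u t) x"

definition C12_on_positive_times :: "(real \<Rightarrow> real \<Rightarrow> real) \<Rightarrow> bool" where
  "C12_on_positive_times u \<longleftrightarrow>
     (\<forall>t>0. \<forall>x.
        (\<lambda>s. u s x) differentiable at t \<and>
        u t differentiable at x \<and>
        partial_x u t differentiable at x) \<and>
     continuous_on ({0<..} \<times> UNIV) (\<lambda>(t, x). partial_t u t x) \<and>
     continuous_on ({0<..} \<times> UNIV) (\<lambda>(t, x). partial_x u t x) \<and>
     continuous_on ({0<..} \<times> UNIV) (\<lambda>(t, x). partial_x (partial_x u) t x)"

text \<open>
  A classical solution. The initial value is attained continuously: without the limit at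
  \<open>t = 0\<close> the initial condition would not constrain \<open>u\<close> at positive times.
\<close>

definition kolmogorov_solution ::
  "(real \<Rightarrow> real) \<Rightarrow> (real \<Rightarrow> real) \<Rightarrow> (real \<Rightarrow> real \<Rightarrow> real) \<Rightarrow> bool" where
  "kolmogorov_solution b \<sigma> u \<longleftrightarrow>
     C12_on_positive_times u \<and>
     (\<forall>t>0. \<forall>x. partial_t u t x =
        1 / 2 * (\<sigma> x)\<^sup>2 * partial_x (partial_x u) t x + b x * partial_x u t x) \<and>
     (\<forall>x. u 0 x = 0 \<and> ((\<lambda>t. u t x) \<longlongrightarrow> 0) (at_right 0))"

text \<open>
  Boundary values are prescribed for \<open>t > 0\<close> only, since \<open>u 0 x = 0\<close> for all \<open>x\<close>.
\<close>

definition boundary_values :: "(real \<Rightarrow> real \<Rightarrow> real) \<Rightarrow> real \<Rightarrow> real \<Rightarrow> bool" where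
  "boundary_values u at_pos at_neg \<longleftrightarrow>
     (\<forall>t>0. (u t \<longlongrightarrow> at_pos) at_top \<and> (u t \<longlongrightarrow> at_neg) at_bot)"

end

theory Submission
  imports Defs
begin

text \<open>
  Fix \<open>t > 0\<close>, and let \<open>\<rho>\<^sub>m\<close> be the exit time of \<open>X\<close> from \<open>{-m<..<m}\<close>, capped at \<open>t\<close>. By the
  differential equation, \<open>u (t + \<epsilon> - s) (X s)\<close> has no drift until \<open>\<rho>\<^sub>m\<close>, so that \<open>u (t + \<epsilon>) \<xi>\<close> is
  the expectation of \<open>u (t + \<epsilon> - \<rho>\<^sub>m) (X \<rho>\<^sub>m)\<close> (\<open>u_along_exit\<close>). The shift by \<open>\<epsilon> > 0\<close> is there
  because \<open>u\<close> is smooth at positive times only. Now let \<open>m\<close> tend to infinity. If \<open>\<tau> > t\<close>, then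
  \<open>\<rho>\<^sub>m = t\<close> eventually, and the limit \<open>u \<epsilon> (X t)\<close> vanishes with \<open>\<epsilon>\<close>. If \<open>\<tau> \<le> t\<close>, then \<open>X \<rho>\<^sub>m\<close> is
  eventually \<open>m\<close> or \<open>-m\<close>, according to the direction of the explosion, and \<open>u\<close> approaches the
  corresponding boundary value. That value is attained for each time separately, while the time
  \<open>t + \<epsilon> - \<rho>\<^sub>m\<close> varies with \<open>m\<close>; averaging over \<open>\<epsilon>\<close> between \<open>\<delta>\<close> and \<open>2 * \<delta>\<close> before taking limits
  resolves this (\<open>avg_boundary\<close>). With boundary values \<open>p\<close> at \<open>\<infinity>\<close> and \<open>q\<close> at \<open>-\<infinity>\<close>, the result is
  that \<open>u t \<xi>\<close> is \<open>p\<close> times the probability of an upward explosion until \<open>t\<close> plus \<open>q\<close> times that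
  of a downward one (\<open>probabilistic_representation\<close>). The three claims are the cases \<open>(1, 1)\<close>,
  \<open>(1, 0)\<close> and \<open>(0, 1)\<close>.

  This uses that \<open>X\<close> has the limit \<open>\<infinity>\<close> or \<open>-\<infinity>\<close> at \<open>\<tau>\<close> almost surely (\<open>AE_explosion_limit\<close>), while
  the definition of the explosion time only says that \<open>\<bar>X\<bar>\<close> is unbounded near \<open>\<tau>\<close>. For a bump
  function \<open>f\<close> the drift of \<open>f (X)\<close> is bounded, hence after leaving \<open>{-n..n}\<close> the solution returns
  to \<open>{-a..a}\<close> within time \<open>h\<close> with probability at most \<open>C * h\<close>, uniformly in \<open>n\<close>
  (\<open>return_event_prob\<close>). A path that oscillates at \<open>\<tau>\<close> makes such returns for every \<open>h > 0\<close>, after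
  all exits shortly before \<open>\<tau>\<close>, and this has probability zero. Therefore \<open>\<bar>X\<bar>\<close> tends to infinity,
  and continuity fixes the sign.

  Both arguments rest on Dynkin's formula (\<open>dynkin_formula\<close>), that is, Ito's formula in
  expectation for the stopped solution. It is derived from the definition of the stochastic
  integral by approximation with simple integrands. If the diffusion coefficient is known at the
  beginning of a time interval, Taylor expansion and the moments of Brownian increments show that
  the two sides differ by a function of the end time with increments \<open>o(t - s)\<close>, which is
  therefore constant (\<open>ito_interval\<close>). Simple integrands are treated piece by piece. Bounded
  integrands are limits in probability of simple integrands, which may be truncated to the same
  bound: what is cut off has a small integral in probability by \<open>simple_integral_tail\<close>.
\<close>

section \<open>Brownian increments and integrals of simple processes\<close>

locale brownian_setting = prob_space M for M :: "'a measure" +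
  fixes F :: "real \<Rightarrow> 'a measure" and W :: "real \<Rightarrow> 'a \<Rightarrow> real"
  assumes complete: "complete_measure M"
    and filt: "complete_filtration M F"
    and bm: "brownian_motion M F W"
begin

lemma space_F [simp]: "space (F t) = space M"
  using filt by (simp add: complete_filtration_def filtration_def)

lemma sets_F_mono: "s \<le> t \<Longrightarrow> sets (F s) \<subseteq> sets (F t)"
  using filt by (auto simp: complete_filtration_def filtration_def)

lemma sets_F_M: "sets (F t) \<subseteq> sets M"
  using filt by (simp add: complete_filtration_def)

lemma measurable_F_mono: "f \<in> measurable (F s) N \<Longrightarrow> s \<le> t \<Longrightarrow> f \<in> measurable (F t) N"
  using sets_F_mono[of s t] by (auto simp: measurable_def)

lemma measurable_F_M: "f \<in> measurable (F s) N \<Longrightarrow> f \<in> measurable M N"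
  using sets_F_M[of s] by (auto simp: measurable_def)

lemma W_meas: "0 \<le> t \<Longrightarrow> W t \<in> borel_measurable (F t)"
  using bm by (simp add: brownian_motion_def adapted_process_def)

lemma W_meas_M: "0 \<le> t \<Longrightarrow> W t \<in> borel_measurable M"
  using W_meas measurable_F_M by blast

lemma increment_distributed:
  "0 \<le> s \<Longrightarrow> s < t \<Longrightarrow> distributed M lborel (\<lambda>\<omega>. W t \<omega> - W s \<omega>) (normal_density 0 (sqrt (t - s)))"
  using bm by (simp add: brownian_motion_def)

lemma increment_integrable:
  assumes "0 \<le> s" "s \<le> t" shows "integrable M (\<lambda>\<omega>. (W t \<omega> - W s \<omega>) ^ k)"
proof (cases "s = t")
  case False
  then have st: "s < t" using assms by simp
  then have "0 < sqrt (t - s)" by simp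
  then have "integrable lborel (\<lambda>x. normal_density 0 (sqrt (t - s)) x * x ^ k)"
    using integrable_normal_moment[of "sqrt (t - s)" 0 k] by simp
  then show ?thesis
    using distributed_integrable[OF increment_distributed[OF assms(1) st], of "\<lambda>x. x ^ k"] by simp
qed simp

lemma increment_moments:
  assumes "0 \<le> s" "s \<le> t"
  shows "expectation (\<lambda>\<omega>. W t \<omega> - W s \<omega>) = 0"
    and "expectation (\<lambda>\<omega>. (W t \<omega> - W s \<omega>)\<^sup>2) = t - s"
    and "expectation (\<lambda>\<omega>. (W t \<omega> - W s \<omega>) ^ 4) = 3 * (t - s)\<^sup>2"
proof -
  have "expectation (\<lambda>\<omega>. W t \<omega> - W s \<omega>) = 0 \<and> expectation (\<lambda>\<omega>. (W t \<omega> - W s \<omega>)\<^sup>2) = t - s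
    \<and> expectation (\<lambda>\<omega>. (W t \<omega> - W s \<omega>) ^ 4) = 3 * (t - s)\<^sup>2"
  proof (cases "s = t")
    case False
    then have st: "s < t" using assms by simp
    then have p: "0 < sqrt (t - s)" by simp
    note D = increment_distributed[OF assms(1) st]
    have I: "(\<integral>x. normal_density 0 (sqrt (t - s)) x * x ^ k \<partial>lborel) = expectation (\<lambda>\<omega>. (W t \<omega> - W s \<omega>) ^ k)" for k
      by (rule distributed_integral[OF D]) auto
    have "(\<integral>x. normal_density 0 (sqrt (t - s)) x * x ^ 2 \<partial>lborel) = t - s"
      using integral_normal_moment_even[OF p, of 0 1] st by simp
    moreover have "(\<integral>x. normal_density 0 (sqrt (t - s)) x * x ^ 4 \<partial>lborel) = 3 * (t - s)\<^sup>2"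
      using integral_normal_moment_even[OF p, of 0 2] st by (simp add: fact_numeral power2_eq_square field_simps)
    moreover have "(\<integral>x. normal_density 0 (sqrt (t - s)) x * x ^ 1 \<partial>lborel) = 0"
      using integral_normal_moment_odd[OF p, of 0 0] by simp
    ultimately show ?thesis using I[of 1] I[of 2] I[of 4] by simp
  qed simp
  then show "expectation (\<lambda>\<omega>. W t \<omega> - W s \<omega>) = 0"
    and "expectation (\<lambda>\<omega>. (W t \<omega> - W s \<omega>)\<^sup>2) = t - s"
    and "expectation (\<lambda>\<omega>. (W t \<omega> - W s \<omega>) ^ 4) = 3 * (t - s)\<^sup>2" by auto
qed

lemma increment_indep:
  assumes "0 \<le> s" and st: "s < t" and Z: "Z \<in> borel_measurable (F s)"
  shows "indep_var borel Z borel (\<lambda>\<omega>. W t \<omega> - W s \<omega>)"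
proof -
  have I: "indep_set (sets (F s)) (sets (vimage_algebra (space M) (\<lambda>\<omega>. W t \<omega> - W s \<omega>) borel))"
    using bm st assms(1) by (simp add: brownian_motion_def)
  have "sigma_sets (space M) {Z -` A \<inter> space M |A. A \<in> sets borel} \<subseteq> sets (F s)"
    using Z sets.sigma_sets_subset[of "{Z -` A \<inter> space M |A. A \<in> sets borel}" "F s"]
    by (auto simp: measurable_def)
  then have "indep_set (sigma_sets (space M) {Z -` A \<inter> space M |A. A \<in> sets borel})
      (sigma_sets (space M) {(\<lambda>\<omega>. W t \<omega> - W s \<omega>) -` A \<inter> space M |A. A \<in> sets borel})"
    using I unfolding sets_vimage_algebra indep_sets2_eq by auto
  moreover have "random_variable borel Z" using Z measurable_F_M by blast
  moreover have "random_variable borel (\<lambda>\<omega>. W t \<omega> - W s \<omega>)"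
    using W_meas_M assms by (intro borel_measurable_diff) auto
  ultimately show ?thesis unfolding indep_var_eq by auto
qed

lemma increment_orthogonal:
  assumes "0 \<le> s" "s \<le> t" and Z: "Z \<in> borel_measurable (F s)" "integrable M Z"
  shows "integrable M (\<lambda>\<omega>. Z \<omega> * (W t \<omega> - W s \<omega>))"
    and "expectation (\<lambda>\<omega>. Z \<omega> * (W t \<omega> - W s \<omega>)) = 0"
    and "integrable M (\<lambda>\<omega>. Z \<omega> * (W t \<omega> - W s \<omega>)\<^sup>2)"
    and "expectation (\<lambda>\<omega>. Z \<omega> * (W t \<omega> - W s \<omega>)\<^sup>2) = expectation Z * (t - s)"
proof -
  have "integrable M (\<lambda>\<omega>. Z \<omega> * (W t \<omega> - W s \<omega>)) \<and> expectation (\<lambda>\<omega>. Z \<omega> * (W t \<omega> - W s \<omega>)) = 0 \<and>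
    integrable M (\<lambda>\<omega>. Z \<omega> * (W t \<omega> - W s \<omega>)\<^sup>2) \<and>
    expectation (\<lambda>\<omega>. Z \<omega> * (W t \<omega> - W s \<omega>)\<^sup>2) = expectation Z * (t - s)"
  proof (cases "s = t")
    case False
    then have st: "s < t" using assms by simp
    note i1 = increment_indep[OF assms(1) st Z(1)]
    have i2: "indep_var borel Z borel (\<lambda>\<omega>. (W t \<omega> - W s \<omega>)\<^sup>2)"
      using indep_var_compose[OF i1, of "\<lambda>x. x" borel "\<lambda>x. x\<^sup>2" borel] by (simp add: comp_def)
    note I1 = increment_integrable[OF assms(1,2), of 1, simplified]
      and I2 = increment_integrable[OF assms(1,2), of 2]
    show ?thesis
      using indep_var_integrable[OF i1 Z(2) I1] indep_var_integrable[OF i2 Z(2) I2]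
        indep_var_lebesgue_integral[OF i1 Z(2) I1] indep_var_lebesgue_integral[OF i2 Z(2) I2]
        increment_moments[OF assms(1,2)] by simp
  qed simp
  then show "integrable M (\<lambda>\<omega>. Z \<omega> * (W t \<omega> - W s \<omega>))"
    and "expectation (\<lambda>\<omega>. Z \<omega> * (W t \<omega> - W s \<omega>)) = 0"
    and "integrable M (\<lambda>\<omega>. Z \<omega> * (W t \<omega> - W s \<omega>)\<^sup>2)"
    and "expectation (\<lambda>\<omega>. Z \<omega> * (W t \<omega> - W s \<omega>)\<^sup>2) = expectation Z * (t - s)" by auto
qed

context
  fixes n :: nat and s :: "nat \<Rightarrow> real" and h :: "nat \<Rightarrow> 'a \<Rightarrow> real"
  assumes simple: "simple_integrand F n s h"
begin

lemma partition_step: "i < n \<Longrightarrow> s i \<le> s (Suc i)"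
  and coeff_measurable: "i < n \<Longrightarrow> h i \<in> borel_measurable (F (s i))"
  using simple by (auto simp: simple_integrand_def)

lemma partition_mono: "i \<le> k \<Longrightarrow> k \<le> n \<Longrightarrow> s i \<le> s k"
  by (induction k) (use partition_step in \<open>auto simp: le_Suc_eq intro: order_trans\<close>)

lemma partition_nonneg: "i \<le> n \<Longrightarrow> 0 \<le> s i"
  using partition_mono[of 0 i] simple by (auto simp: simple_integrand_def)

end

text \<open>
  Ito's isometry. In the square of the sum, the product of the partial sum before time \<open>s i\<close> with
  the next term has mean zero, because the next increment of \<open>W\<close> is centred and independent of
  \<open>F (s i)\<close>; only the squares survive.
\<close>

lemma simple_integral_square:
  assumes S: "simple_integrand F n s h" and t: "0 \<le> t"
  shows "(simple_integral W n s h t) \<in> borel_measurable M \<and>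
    integrable M (\<lambda>\<omega>. (simple_integral W n s h t \<omega>)\<^sup>2) \<and>
    integrable M (\<lambda>\<omega>. \<Sum>i<n. (h i \<omega>)\<^sup>2 * (min t (s (Suc i)) - min t (s i))) \<and>
    expectation (\<lambda>\<omega>. (simple_integral W n s h t \<omega>)\<^sup>2) =
     expectation (\<lambda>\<omega>. \<Sum>i<n. (h i \<omega>)\<^sup>2 * (min t (s (Suc i)) - min t (s i)))"
proof -
  note s0 = partition_nonneg[OF S] and inc = partition_step[OF S] and mono = partition_mono[OF S]
    and hm = coeff_measurable[OF S]
  have hb: "\<exists>C. \<forall>\<omega>\<in>space M. \<bar>h i \<omega>\<bar> \<le> C" if "i < n" for i
    using S that by (auto simp: simple_integrand_def)
  define S where "S m \<omega> = (\<Sum>i<m. h i \<omega> * (W (min t (s (Suc i))) \<omega> - W (min t (s i)) \<omega>))" for m \<omega>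
  define Q where "Q m \<omega> = (\<Sum>i<m. (h i \<omega>)\<^sup>2 * (min t (s (Suc i)) - min t (s i)))" for m \<omega>
  have hsq: "integrable M (\<lambda>\<omega>. (h i \<omega>)\<^sup>2)" if i: "i < n" for i
  proof -
    obtain C where C: "\<forall>\<omega>\<in>space M. \<bar>h i \<omega>\<bar> \<le> C" using hb[OF i] by auto
    have "AE \<omega> in M. norm ((h i \<omega>)\<^sup>2) \<le> C\<^sup>2"
      using C by (intro AE_I2) (fastforce simp: abs_le_square_iff[symmetric])
    then show ?thesis
      using measurable_F_M[OF hm[OF i]] by (intro integrable_const_bound) auto
  qed
  have Sm: "S m \<in> borel_measurable (F (s m))" if m: "m \<le> n" for m
    unfolding S_def
  proof (intro borel_measurable_sum borel_measurable_times borel_measurable_diff)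
    fix i assume i: "i \<in> {..<m}"
    then have *: "s i \<le> s m" "s (Suc i) \<le> s m" using m by (auto intro!: mono)
    show "h i \<in> borel_measurable (F (s m))" using hm[of i] i m * measurable_F_mono by auto
    show "W (min t (s (Suc i))) \<in> borel_measurable (F (s m))" "W (min t (s i)) \<in> borel_measurable (F (s m))"
      using i m * t s0[of i] s0[of "Suc i"] by (auto intro!: measurable_F_mono[OF W_meas])
  qed
  have "integrable M (\<lambda>\<omega>. (S m \<omega>)\<^sup>2) \<and> integrable M (Q m) \<and> expectation (\<lambda>\<omega>. (S m \<omega>)\<^sup>2) = expectation (Q m)"
    if "m \<le> n" for m using that
  proof (induction m)
    case 0 then show ?case by (simp add: S_def Q_def)
  next
    case (Suc m)
    then have m: "m < n" and IH: "integrable M (\<lambda>\<omega>. (S m \<omega>)\<^sup>2)" "integrable M (Q m)" "expectation (\<lambda>\<omega>. (S m \<omega>)\<^sup>2) = expectation (Q m)" by auto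
    show ?case
    proof (cases "t \<le> s m")
      case True
      then have "t \<le> s (Suc m)" using inc[OF m] by simp
      then have "S (Suc m) = S m" "Q (Suc m) = Q m" using True by (auto simp: S_def Q_def fun_eq_iff min_def)
      then show ?thesis using IH by simp
    next
      case False
      define c where "c = h m"
      define r where "r = min t (s (Suc m))"
      have r: "0 \<le> s m" "s m \<le> r" using False inc[OF m] s0[of m] m by (auto simp: r_def)
      have cm: "c \<in> borel_measurable (F (s m))" using hm[OF m] c_def by simp
      have eqS: "S (Suc m) = (\<lambda>\<omega>. S m \<omega> + c \<omega> * (W r \<omega> - W (s m) \<omega>))"
        using False by (auto simp: S_def r_def c_def fun_eq_iff min_def)
      have eqQ: "Q (Suc m) = (\<lambda>\<omega>. Q m \<omega> + (c \<omega>)\<^sup>2 * (r - s m))"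
        using False by (auto simp: Q_def r_def c_def fun_eq_iff min_def)
      have Smm: "S m \<in> borel_measurable (F (s m))" using Sm m by simp
      have Sint: "integrable M (S m)"
        using measurable_F_M[OF Smm] IH(1) square_integrable_imp_integrable by blast
      obtain C where C: "\<forall>\<omega>\<in>space M. \<bar>c \<omega>\<bar> \<le> C" using hb[OF m] c_def by auto
      have cS: "integrable M (\<lambda>\<omega>. S m \<omega> * c \<omega>)"
      proof (rule Bochner_Integration.integrable_bound)
        show "integrable M (\<lambda>\<omega>. C * S m \<omega>)" using Sint by simp
        show "(\<lambda>\<omega>. S m \<omega> * c \<omega>) \<in> borel_measurable M"
          using measurable_F_M[OF cm] measurable_F_M[OF Smm] by simp
        show "AE \<omega> in M. norm (S m \<omega> * c \<omega>) \<le> norm (C * S m \<omega>)"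
        proof (rule AE_I2)
          fix \<omega> assume "\<omega> \<in> space M"
          then have "\<bar>c \<omega>\<bar> \<le> \<bar>C\<bar>" using C by force
          then show "norm (S m \<omega> * c \<omega>) \<le> norm (C * S m \<omega>)"
            using mult_right_mono[of "\<bar>c \<omega>\<bar>" "\<bar>C\<bar>" "\<bar>S m \<omega>\<bar>"] by (simp add: abs_mult mult.commute)
        qed
      qed
      have cSm: "(\<lambda>\<omega>. S m \<omega> * c \<omega>) \<in> borel_measurable (F (s m))" using Smm cm by auto
      have c2: "integrable M (\<lambda>\<omega>. (c \<omega>)\<^sup>2)" using hsq[OF m] c_def by simp
      have c2m: "(\<lambda>\<omega>. (c \<omega>)\<^sup>2) \<in> borel_measurable (F (s m))" using cm by auto
      note o1 = increment_orthogonal[OF r cSm cS] and o2 = increment_orthogonal[OF r c2m c2]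
      have eq: "(\<lambda>\<omega>. (S (Suc m) \<omega>)\<^sup>2) = (\<lambda>\<omega>. (S m \<omega>)\<^sup>2 + (2 * ((S m \<omega> * c \<omega>) * (W r \<omega> - W (s m) \<omega>)) + (c \<omega>)\<^sup>2 * (W r \<omega> - W (s m) \<omega>)\<^sup>2))"
        unfolding eqS by (auto simp: fun_eq_iff power2_eq_square algebra_simps)
      show ?thesis unfolding eq unfolding eqQ using IH o1 o2 c2 by simp
    qed
  qed
  from this[of n] Sm[of n] show ?thesis
    by (auto simp: S_def[abs_def] Q_def[abs_def] simple_integral_def[abs_def] intro: measurable_F_M)
qed

text \<open>
  The integral is small in probability as soon as the accumulated square of the integrand is,
  whatever the second moment of the latter. Set the coefficients to zero from the first piece on
  which the accumulated square would exceed \<open>\<delta>\<close>. The accumulated square is already known at the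
  beginning of the piece, so the result is again a simple integrand; its integral has second
  moment at most \<open>\<delta>\<close>, and it differs from the original one only where the total square exceeds
  \<open>\<delta>\<close>.
\<close>

lemma simple_integral_tail:
  assumes S: "simple_integrand F n s h" and t: "0 \<le> t" and e: "0 < \<epsilon>" and d: "0 < \<delta>"
  shows "prob {\<omega>\<in>space M. \<epsilon> < \<bar>simple_integral W n s h t \<omega>\<bar>}
    \<le> \<delta> / \<epsilon>\<^sup>2 + prob {\<omega>\<in>space M. \<delta> < (\<Sum>i<n. (h i \<omega>)\<^sup>2 * (min t (s (Suc i)) - min t (s i)))}"
proof -
  define d where "d i = min t (s (Suc i)) - min t (s i)" for i
  note inc = partition_step[OF S] and mono = partition_mono[OF S] and hm = coeff_measurable[OF S]
  have hb: "\<exists>C. \<forall>\<omega>\<in>space M. \<bar>h i \<omega>\<bar> \<le> C" if "i < n" for i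
    using S that by (auto simp: simple_integrand_def)
  have d0: "0 \<le> d i" if "i < n" for i using inc[OF that] by (auto simp: d_def)
  define Q where "Q m \<omega> = (\<Sum>i<m. (h i \<omega>)\<^sup>2 * d i)" for m \<omega>
  define g where "g i \<omega> = (if Q (Suc i) \<omega> \<le> \<delta> then h i \<omega> else 0)" for i \<omega>
  have Qm: "Q (Suc i) \<in> borel_measurable (F (s i))" if "i < n" for i
    unfolding Q_def using that
    by (intro borel_measurable_sum borel_measurable_times borel_measurable_power)
      (auto intro!: measurable_F_mono[OF hm] mono)
  have G: "simple_integrand F n s g"
    unfolding simple_integrand_def
  proof (intro conjI allI impI)
    fix i assume i: "i < n"
    show "g i \<in> borel_measurable (F (s i))" unfolding g_def using Qm[OF i] hm[OF i] by measurable
    obtain C where "\<forall>\<omega>\<in>space M. \<bar>h i \<omega>\<bar> \<le> C" using hb[OF i] by auto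
    then have "\<forall>\<omega>\<in>space (F (s i)). \<bar>g i \<omega>\<bar> \<le> \<bar>C\<bar>" by (auto simp: g_def)
    then show "\<exists>C. \<forall>\<omega>\<in>space (F (s i)). \<bar>g i \<omega>\<bar> \<le> C" by blast
  qed (use S inc in \<open>auto simp: simple_integrand_def\<close>)
  have Qmono: "Q i \<omega> \<le> Q k \<omega>" if "i \<le> k" "k \<le> n" for i k \<omega>
    unfolding Q_def using that d0 by (intro sum_mono2) auto
  have gbound: "(\<Sum>i<m. (g i \<omega>)\<^sup>2 * d i) \<le> min \<delta> (Q m \<omega>)" if "m \<le> n" for m \<omega>
    using that
  proof (induction m)
    case 0 then show ?case using \<open>0 < \<delta>\<close> by (simp add: Q_def)
  next
    case (Suc m)
    then have "(\<Sum>i<m. (g i \<omega>)\<^sup>2 * d i) \<le> min \<delta> (Q m \<omega>)" by simp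
    moreover have "Q (Suc m) \<omega> = Q m \<omega> + (h m \<omega>)\<^sup>2 * d m" by (simp add: Q_def)
    ultimately show ?case using d0[of m] Suc.prems by (auto simp: g_def min_def split: if_splits)
  qed
  have eq: "simple_integral W n s h t \<omega> = simple_integral W n s g t \<omega>" if "Q n \<omega> \<le> \<delta>" for \<omega>
  proof -
    have "g i \<omega> = h i \<omega>" if "i < n" for i
      using Qmono[of "Suc i" n \<omega>] that \<open>Q n \<omega> \<le> \<delta>\<close> by (auto simp: g_def)
    then show ?thesis by (simp add: simple_integral_def)
  qed
  note SG = simple_integral_square[OF G t] and SH = simple_integral_square[OF S t]
  have "expectation (\<lambda>\<omega>. \<Sum>i<n. (g i \<omega>)\<^sup>2 * (min t (s (Suc i)) - min t (s i))) \<le> expectation (\<lambda>\<omega>. \<delta>)"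
    using SG gbound[of n] by (intro integral_mono) (auto simp: d_def)
  then have "expectation (\<lambda>\<omega>. (simple_integral W n s g t \<omega>)\<^sup>2) \<le> expectation (\<lambda>\<omega>. \<delta>)"
    using SG by simp
  then have E: "expectation (\<lambda>\<omega>. (simple_integral W n s g t \<omega>)\<^sup>2) \<le> \<delta>" by (simp add: prob_space)
  have [measurable]: "simple_integral W n s g t \<in> borel_measurable M" "simple_integral W n s h t \<in> borel_measurable M"
    using SG SH by auto
  have [measurable]: "Q n \<in> borel_measurable M"
    unfolding Q_def by (intro borel_measurable_sum borel_measurable_times borel_measurable_power)
     (auto intro: measurable_F_M hm)
  have "prob {\<omega>\<in>space M. \<epsilon> < \<bar>simple_integral W n s h t \<omega>\<bar>}
    \<le> prob ({\<omega>\<in>space M. \<epsilon>\<^sup>2 \<le> (simple_integral W n s g t \<omega>)\<^sup>2} \<union> {\<omega>\<in>space M. \<delta> < Q n \<omega>})"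
  proof (rule finite_measure_mono)
    show "{\<omega>\<in>space M. \<epsilon> < \<bar>simple_integral W n s h t \<omega>\<bar>} \<subseteq>
      {\<omega>\<in>space M. \<epsilon>\<^sup>2 \<le> (simple_integral W n s g t \<omega>)\<^sup>2} \<union> {\<omega>\<in>space M. \<delta> < Q n \<omega>}"
      using eq e by (auto simp: not_less abs_le_square_iff[symmetric])
  qed measurable
  also have "\<dots> \<le> prob {\<omega>\<in>space M. \<epsilon>\<^sup>2 \<le> (simple_integral W n s g t \<omega>)\<^sup>2} + prob {\<omega>\<in>space M. \<delta> < Q n \<omega>}"
    by (rule measure_Un_le) measurable
  also have "prob {\<omega>\<in>space M. \<epsilon>\<^sup>2 \<le> (simple_integral W n s g t \<omega>)\<^sup>2} \<le> expectation (\<lambda>\<omega>. (simple_integral W n s g t \<omega>)\<^sup>2) / \<epsilon>\<^sup>2"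
    using SG e by (intro integral_Markov_inequality_measure[where A="{}"]) auto
  also have "\<dots> \<le> \<delta> / \<epsilon>\<^sup>2" using E e by (simp add: divide_right_mono)
  finally show ?thesis by (simp add: Q_def d_def)
qed

end

section \<open>Test functions and elementary estimates\<close>

text \<open>
  Both expansions below evaluate the last derivative at an intermediate point whose distance from
  the base point is at most the increment. This is all that the error estimates need, and it makes
  sense for either order of the two points.
\<close>

lemma taylor_second_order:
  fixes f :: "real \<Rightarrow> real"
  assumes "\<And>x. (f has_real_derivative f1 x) (at x)" "\<And>x. (f1 has_real_derivative f2 x) (at x)"
  obtains z where "\<bar>z - x\<bar> \<le> \<bar>y - x\<bar>" "f y = f x + f1 x * (y - x) + f2 z / 2 * (y - x)\<^sup>2"
proof (cases "x = y")
  case False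
  define D where "D m = (if m = 0 then f else if m = 1 then f1 else f2)" for m :: nat
  have "\<exists>t. (if y < x then y < t \<and> t < x else x < t \<and> t < y) \<and>
     f y = (\<Sum>m<2. D m x / fact m * (y - x) ^ m) + D 2 t / fact 2 * (y - x) ^ 2"
    using False assms by (intro Taylor[where a="min x y" and b="max x y"]) (auto simp: D_def less_2_cases_iff)
  then obtain t where "if y < x then y < t \<and> t < x else x < t \<and> t < y"
    "f y = (\<Sum>m<2. D m x / fact m * (y - x) ^ m) + D 2 t / fact 2 * (y - x) ^ 2" by auto
  then show ?thesis
    by (intro that[of t]) (auto simp: D_def numeral_2_eq_2 split: if_splits)
qed (use that[of x] in simp)

lemma mean_value_within:
  fixes f :: "real \<Rightarrow> real"
  assumes d: "\<And>x. x \<in> {0..T} \<Longrightarrow> (f has_real_derivative f1 x) (at x within {0..T})"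
    and xy: "x \<in> {0..T}" "y \<in> {0..T}"
  obtains z where "z \<in> {0..T}" "\<bar>z - x\<bar> \<le> \<bar>y - x\<bar>" "f y = f x + f1 z * (y - x)"
proof -
  have main: "\<exists>z. a \<le> z \<and> z \<le> b \<and> f b - f a = f1 z * (b - a)" if "a \<in> {0..T}" "b \<in> {0..T}" "a < b" for a b
  proof -
    have "(f has_derivative (*) (f1 z)) (at z within {a..b})" if "a \<le> z" "z \<le> b" for z
      using d[of z] that \<open>a \<in> {0..T}\<close> \<open>b \<in> {0..T}\<close>
      by (auto simp: has_field_derivative_def intro: has_derivative_subset)
    then obtain z where "z \<in> {a<..<b}" "f b - f a = f1 z * (b - a)"
      using mvt_simple[OF \<open>a < b\<close>, of f "\<lambda>z. (*) (f1 z)"] by blast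
    then show ?thesis by (intro exI[of _ z]) auto
  qed
  consider "x = y" | "x < y" | "y < x" by linarith
  then show ?thesis
  proof cases
    case 1 then show ?thesis using that[of x] xy by simp
  next
    case 2 
    then obtain z where "x \<le> z" "z \<le> y" "f y - f x = f1 z * (y - x)" using main[of x y] xy by auto
    then show ?thesis using that[of z] xy 2 by (force simp: algebra_simps)
  next
    case 3 
    then obtain z where "y \<le> z" "z \<le> x" "f x - f y = f1 z * (x - y)" using main[of y x] xy by auto
    then show ?thesis using that[of z] xy 3 by (force simp: algebra_simps)
  qed
qed

text \<open>
  Increments that are \<open>o(t - s)\<close> uniformly in the position have derivative zero. This turns a
  one-step estimate into an identity without summing errors over a partition.
\<close>

lemma constant_if_increments_little_o:
  fixes D :: "real \<Rightarrow> real"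
  assumes "p \<le> q"
    and o: "\<And>e. 0 < e \<Longrightarrow> \<exists>d>0. \<forall>s t. p \<le> s \<longrightarrow> s \<le> t \<longrightarrow> t \<le> q \<longrightarrow> t - s < d \<longrightarrow> \<bar>D t - D s\<bar> \<le> e * (t - s)"
  shows "D q = D p"
proof -
  have "(D has_real_derivative 0) (at x within {p..q})" if x: "x \<in> {p..q}" for x
    unfolding has_field_derivative_def has_derivative_within_alt
  proof (intro conjI allI impI)
    fix e :: real assume "0 < e"
    then obtain d where d: "d > 0" "\<And>s t. p \<le> s \<Longrightarrow> s \<le> t \<Longrightarrow> t \<le> q \<Longrightarrow> t - s < d \<Longrightarrow> \<bar>D t - D s\<bar> \<le> e * (t - s)"
      using o[of e] by blast
    have "norm (D y - D x - 0 * (y - x)) \<le> e * norm (y - x)" if "y \<in> {p..q}" "norm (y - x) < d" for y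
      using d(2)[of x y] d(2)[of y x] that x by (cases "x \<le> y") (auto simp: abs_minus_commute)
    then show "\<exists>d>0. \<forall>y\<in>{p..q}. norm (y - x) < d \<longrightarrow> norm (D y - D x - 0 * (y - x)) \<le> e * norm (y - x)"
      using d(1) by blast
  qed (rule bounded_linear_mult_right)
  then obtain c where "\<forall>x\<in>{p..q}. D x = c"
    using has_field_derivative_zero_constant[of "{p..q}" D] by auto
  then show ?thesis using assms(1) by simp
qed

text \<open>
  Functions of time and space, with their derivatives as explicit arguments, to which Ito's
  formula is going to be applied. The time derivative is one-sided at the ends of \<open>{0..T}\<close>, and
  the radius of the support in space does not depend on the time.
\<close>

definition test_function ::
  "real \<Rightarrow> (real \<Rightarrow> real \<Rightarrow> real) \<Rightarrow> (real \<Rightarrow> real \<Rightarrow> real) \<Rightarrow> (real \<Rightarrow> real \<Rightarrow> real) \<Rightarrow> (real \<Rightarrow> real \<Rightarrow> real) \<Rightarrow> bool"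
  where "test_function T g gt gx gxx \<longleftrightarrow>
    (\<forall>s\<in>{0..T}. \<forall>x. ((\<lambda>s. g s x) has_real_derivative gt s x) (at s within {0..T}) \<and>
       (g s has_real_derivative gx s x) (at x) \<and> (gx s has_real_derivative gxx s x) (at x)) \<and>
    (\<forall>G\<in>{g, gt, gx, gxx}. continuous_on ({0..T} \<times> UNIV) (\<lambda>(s, x). G s x) \<and>
       (\<exists>R. \<forall>s\<in>{0..T}. \<forall>x. R \<le> \<bar>x\<bar> \<longrightarrow> G s x = 0))"

text \<open>
  Uniform continuity, in a form adapted to expectations. Points that are close have values within
  \<open>e\<close>; for all other points the term with \<open>K\<close> exceeds twice the bound of \<open>G\<close>. Here \<open>x - y\<close> will be
  an increment of a process over a time interval, and since its square, and not its absolute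
  value, has mean of the order of the length of the interval, the modulus is quadratic in space
  and linear in time.
\<close>

lemma compact_support_modulus:
  fixes G :: "real \<Rightarrow> real \<Rightarrow> real"
  assumes cont: "continuous_on ({0..T} \<times> UNIV) (\<lambda>(s, x). G s x)"
    and supp: "\<exists>R. \<forall>s\<in>{0..T}. \<forall>x. R \<le> \<bar>x\<bar> \<longrightarrow> G s x = 0"
  shows "\<exists>L\<ge>0. \<forall>s\<in>{0..T}. \<forall>x. \<bar>G s x\<bar> \<le> L"
    and "0 < e \<Longrightarrow> \<exists>K\<ge>0. \<forall>s\<in>{0..T}. \<forall>s'\<in>{0..T}. \<forall>x y. \<bar>G s x - G s' y\<bar> \<le> e + K * (\<bar>s - s'\<bar> + (x - y)\<^sup>2)"
proof -
  obtain R0 where R0: "\<And>s x. s \<in> {0..T} \<Longrightarrow> R0 \<le> \<bar>x\<bar> \<Longrightarrow> G s x = 0" using supp by blast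
  define R where "R = \<bar>R0\<bar>"
  have R: "G s x = 0" if "s \<in> {0..T}" "R \<le> \<bar>x\<bar>" for s x using R0[of s x] that by (simp add: R_def)
  (* Clamping to an interval that contains the support does not change G, and reduces the claim
     to a compact rectangle. *)
  define cl where "cl x = max (- R) (min R x)" for x
  have R_nn: "0 \<le> R" by (simp add: R_def)
  have clG: "G s x = G s (cl x)" if "s \<in> {0..T}" for s x
  proof (cases "\<bar>x\<bar> \<le> R")
    case True then show ?thesis by (auto simp: cl_def)
  next
    case False then have "\<bar>cl x\<bar> = R" using R_nn by (auto simp: cl_def)
    then show ?thesis using R[OF that, of x] R[OF that, of "cl x"] False by simp
  qed
  have cl_in: "cl x \<in> {-R..R}" for x using R_nn by (auto simp: cl_def)
  have cl_lip: "\<bar>cl x - cl y\<bar> \<le> \<bar>x - y\<bar>" for x y by (auto simp: cl_def)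
  have comp: "compact ({0..T} \<times> {-R..R})" by (intro compact_Times) auto
  have cont': "continuous_on ({0..T} \<times> {-R..R}) (\<lambda>(s, x). G s x)"
    by (rule continuous_on_subset[OF cont]) auto
  have "bounded ((\<lambda>(s, x). G s x) ` ({0..T} \<times> {-R..R}))"
    using compact_continuous_image[OF cont' comp] compact_imp_bounded by blast
  then obtain L where "0 < L" and L: "\<And>s x. s \<in> {0..T} \<Longrightarrow> x \<in> {-R..R} \<Longrightarrow> \<bar>G s x\<bar> \<le> L"
    unfolding bounded_pos by fastforce
  have Lb: "\<bar>G s x\<bar> \<le> L" if "s \<in> {0..T}" for s x
    using L[OF that cl_in[of x]] clG[OF that, of x] by simp
  then show "\<exists>L\<ge>0. \<forall>s\<in>{0..T}. \<forall>x. \<bar>G s x\<bar> \<le> L" using \<open>0 < L\<close> by (intro exI[of _ L]) auto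
  assume e: "0 < e"
  obtain d where d: "0 < d" "\<And>p q. p \<in> {0..T} \<times> {-R..R} \<Longrightarrow> q \<in> {0..T} \<times> {-R..R} \<Longrightarrow> dist q p < d \<Longrightarrow>
     dist ((\<lambda>(s, x). G s x) q) ((\<lambda>(s, x). G s x) p) < e"
    using compact_uniformly_continuous[OF cont' comp] e unfolding uniformly_continuous_on_def by metis
  define K where "K = 2 * L * (2 / d + 4 / d\<^sup>2)"
  have K: "0 \<le> K" using \<open>0 < L\<close> d(1) by (simp add: K_def)
  have "\<bar>G s x - G s' y\<bar> \<le> e + K * (\<bar>s - s'\<bar> + (x - y)\<^sup>2)" if s: "s \<in> {0..T}" "s' \<in> {0..T}" for s s' x y
  proof (cases "\<bar>s - s'\<bar> < d / 2 \<and> \<bar>x - y\<bar> < d / 2")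
    case True
    have "dist (s, cl x) (s', cl y) \<le> \<bar>s - s'\<bar> + \<bar>cl x - cl y\<bar>"
      unfolding dist_Pair_Pair dist_real_def power2_abs by (rule sqrt_sum_squares_le_sum_abs)
    also have "\<dots> < d / 2 + d / 2" using True cl_lip[of x y] by (intro add_strict_mono) auto
    also have "\<dots> = d" by simp
    finally have close: "dist (s, cl x) (s', cl y) < d" .
    have "(s', cl y) \<in> {0..T} \<times> {-R..R}" "(s, cl x) \<in> {0..T} \<times> {-R..R}"
      using s cl_in by blast+
    from d(2)[OF this close] have "\<bar>G s x - G s' y\<bar> < e"
      unfolding clG[OF s(1), of x] clG[OF s(2), of y] by (simp only: dist_real_def prod.case)
    moreover have "0 \<le> K * (\<bar>s - s'\<bar> + (x - y)\<^sup>2)" using K by simp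
    ultimately show ?thesis by linarith
  next
    case False
    have A: "\<bar>G s x - G s' y\<bar> \<le> 2 * L" using Lb[OF s(1), of x] Lb[OF s(2), of y] by linarith
    have B: "1 \<le> (2 / d + 4 / d\<^sup>2) * (\<bar>s - s'\<bar> + (x - y)\<^sup>2)"
    proof -
      from False consider "d / 2 \<le> \<bar>s - s'\<bar>" | "d / 2 \<le> \<bar>x - y\<bar>" by linarith
      then have "1 \<le> 2 / d * \<bar>s - s'\<bar> + 4 / d\<^sup>2 * (x - y)\<^sup>2"
      proof cases
        case 1
        then have "1 \<le> 2 / d * \<bar>s - s'\<bar>" using d(1) by (simp add: field_simps)
        moreover have "0 \<le> 4 / d\<^sup>2 * (x - y)\<^sup>2" by simp
        ultimately show ?thesis by linarith
      next
        case 2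
        then have "(d / 2)\<^sup>2 \<le> \<bar>x - y\<bar>\<^sup>2" using d(1) by (intro power_mono) auto
        then have "1 \<le> 4 / d\<^sup>2 * (x - y)\<^sup>2" using d(1) by (simp add: field_simps)
        moreover have "0 \<le> 2 / d * \<bar>s - s'\<bar>" using d(1) by simp
        ultimately show ?thesis by linarith
      qed
      moreover have "0 \<le> 2 / d * (x - y)\<^sup>2" "0 \<le> 4 / d\<^sup>2 * \<bar>s - s'\<bar>" using d(1) by simp_all
      ultimately show ?thesis unfolding distrib_right distrib_left by linarith
    qed
    have "2 * L * 1 \<le> 2 * L * ((2 / d + 4 / d\<^sup>2) * (\<bar>s - s'\<bar> + (x - y)\<^sup>2))"
      using B \<open>0 < L\<close> by (intro mult_left_mono) auto
    then show ?thesis using A e unfolding K_def by (simp add: mult.assoc)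
  qed
  then show "\<exists>K\<ge>0. \<forall>s\<in>{0..T}. \<forall>s'\<in>{0..T}. \<forall>x y. \<bar>G s x - G s' y\<bar> \<le> e + K * (\<bar>s - s'\<bar> + (x - y)\<^sup>2)"
    using K by blast
qed

lemma test_function_continuous:
    "test_function T g gt gx gxx \<Longrightarrow> G \<in> {g, gt, gx, gxx} \<Longrightarrow> continuous_on ({0..T} \<times> UNIV) (\<lambda>(s, x). G s x)"
  and test_function_support:
    "test_function T g gt gx gxx \<Longrightarrow> G \<in> {g, gt, gx, gxx} \<Longrightarrow> \<exists>R. \<forall>s\<in>{0..T}. \<forall>x. R \<le> \<bar>x\<bar> \<longrightarrow> G s x = 0"
  unfolding test_function_def by blast+

lemma test_function_bound:
  assumes test: "test_function T g gt gx gxx"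
  shows "\<exists>L\<ge>0. \<forall>r\<in>{0..T}. \<forall>x. \<bar>g r x\<bar> \<le> L \<and> \<bar>gt r x\<bar> \<le> L \<and> \<bar>gx r x\<bar> \<le> L \<and> \<bar>gxx r x\<bar> \<le> L"
proof -
  have in_set: "g \<in> {g, gt, gx, gxx}" "gt \<in> {g, gt, gx, gxx}" "gx \<in> {g, gt, gx, gxx}" "gxx \<in> {g, gt, gx, gxx}" by simp_all
  note bnd = compact_support_modulus(1)[OF test_function_continuous[OF test] test_function_support[OF test]]
  from bnd[OF in_set(1) in_set(1)] obtain L0 where 0: "0 \<le> L0" "\<forall>s\<in>{0..T}. \<forall>x. \<bar>g s x\<bar> \<le> L0" by (elim exE conjE)
  from bnd[OF in_set(2) in_set(2)] obtain L1 where 1: "0 \<le> L1" "\<forall>s\<in>{0..T}. \<forall>x. \<bar>gt s x\<bar> \<le> L1" by (elim exE conjE)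
  from bnd[OF in_set(3) in_set(3)] obtain L2 where 2: "0 \<le> L2" "\<forall>s\<in>{0..T}. \<forall>x. \<bar>gx s x\<bar> \<le> L2" by (elim exE conjE)
  from bnd[OF in_set(4) in_set(4)] obtain L3 where 3: "0 \<le> L3" "\<forall>s\<in>{0..T}. \<forall>x. \<bar>gxx s x\<bar> \<le> L3" by (elim exE conjE)
  show ?thesis
  proof (intro exI[of _ "L0 + L1 + L2 + L3"] conjI ballI allI)
    show "0 \<le> L0 + L1 + L2 + L3" using 0(1) 1(1) 2(1) 3(1) by simp
    fix r x assume r: "r \<in> {0..T}"
    have "\<bar>g r x\<bar> \<le> L0" "\<bar>gt r x\<bar> \<le> L1" "\<bar>gx r x\<bar> \<le> L2" "\<bar>gxx r x\<bar> \<le> L3"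
      by (rule 0(2)[rule_format, OF r] 1(2)[rule_format, OF r] 2(2)[rule_format, OF r] 3(2)[rule_format, OF r])+
    then show "\<bar>g r x\<bar> \<le> L0 + L1 + L2 + L3" "\<bar>gt r x\<bar> \<le> L0 + L1 + L2 + L3" "\<bar>gx r x\<bar> \<le> L0 + L1 + L2 + L3" "\<bar>gxx r x\<bar> \<le> L0 + L1 + L2 + L3"
      using 0(1) 1(1) 2(1) 3(1) by linarith+
  qed
qed

text \<open>
  Clamping the time argument to \<open>{0..T}\<close> extends \<open>G\<close> continuously to the plane.
\<close>

lemma measurable_clamped_compose:
  fixes G :: "real \<Rightarrow> real \<Rightarrow> real"
  assumes cont: "continuous_on ({0..T} \<times> UNIV) (\<lambda>(s, x). G s x)"
    and "f \<in> borel_measurable N" "y \<in> borel_measurable N" "\<And>x. x \<in> space N \<Longrightarrow> f x \<in> {0..T}"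
  shows "(\<lambda>x. G (f x) (y x)) \<in> borel_measurable N"
proof (cases "0 \<le> T")
  case True
  have "continuous_on UNIV ((\<lambda>(s, x). G s x) \<circ> (\<lambda>p :: real \<times> real. (max 0 (min T (fst p)), snd p)))"
    using True by (intro continuous_on_compose continuous_intros continuous_on_subset[OF cont]) auto
  then have "(\<lambda>p. G (max 0 (min T (fst p))) (snd p)) \<in> borel_measurable borel"
    by (intro borel_measurable_continuous_onI) (simp add: comp_def case_prod_unfold)
  then have "(\<lambda>x. G (max 0 (min T (fst (f x, y x)))) (snd (f x, y x))) \<in> borel_measurable N"
    by (rule measurable_compose[rotated]) (use assms in simp)
  then show ?thesis
    using assms(4) by (subst measurable_cong[of _ _ "\<lambda>x. G (max 0 (min T (f x))) (y x)"]) auto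
next
  case False
  then have "space N = {}" using assms(4) by fastforce
  then show ?thesis by (simp add: measurable_def)
qed

text \<open>
  A continuous process is the pointwise limit of its values at the times rounded up to multiples
  of \<open>1 / Suc k\<close>, of which there are countably many for each \<open>k\<close>.
\<close>

lemma continuous_process_measurable:
  fixes Z :: "real \<Rightarrow> 'a \<Rightarrow> real"
  assumes m: "\<And>t. 0 \<le> t \<Longrightarrow> Z t \<in> borel_measurable M"
    and c: "\<And>\<omega>. \<omega> \<in> space M \<Longrightarrow> continuous_on {0..} (\<lambda>t. Z t \<omega>)"
  shows "(\<lambda>(r, \<omega>). Z (max 0 r) \<omega>) \<in> borel_measurable (borel \<Otimes>\<^sub>M M)"
proof -
  define g where "g k r = real_of_int \<lceil>max 0 r * real (Suc k)\<rceil> / real (Suc k)" for k :: nat and r :: real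
  have lim: "(\<lambda>k. g k r) \<longlonglongrightarrow> max 0 r" for r
  proof (rule tendsto_sandwich)
    have a: "y * real (Suc k) \<le> real_of_int \<lceil>y * real (Suc k)\<rceil>" 
      "real_of_int \<lceil>y * real (Suc k)\<rceil> \<le> y * real (Suc k) + 1" for k y by linarith+
    have k: "0 < real (Suc k)" for k by simp
    show "\<forall>\<^sub>F k in sequentially. max 0 r \<le> g k r"
      unfolding g_def pos_le_divide_eq[OF k] using a(1) by simp
    show "\<forall>\<^sub>F k in sequentially. g k r \<le> max 0 r + 1 / real (Suc k)"
      unfolding g_def pos_divide_le_eq[OF k] distrib_right using a(2) by (simp del: of_nat_Suc)
    show "(\<lambda>k. max 0 r + 1 / real (Suc k)) \<longlonglongrightarrow> max 0 r"
      using tendsto_add[OF tendsto_const LIMSEQ_Suc[OF lim_1_over_n], of "max 0 r"] by simp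
  qed simp
  have g0: "0 \<le> g k r" for k r
  proof -
    have "0 \<le> real_of_int \<lceil>y\<rceil>" if "0 \<le> y" for y :: real using that by linarith
    from this[of "max 0 r * real (Suc k)"] show ?thesis unfolding g_def by (intro divide_nonneg_nonneg) auto
  qed
  show ?thesis
  proof (rule borel_measurable_LIMSEQ_real[where u="\<lambda>k (r, \<omega>). Z (g k r) \<omega>"])
    fix p :: "real \<times> 'a" assume "p \<in> space (borel \<Otimes>\<^sub>M M)"
    then have "snd p \<in> space M" by (auto simp: space_pair_measure)
    then have "(\<lambda>k. Z (g k (fst p)) (snd p)) \<longlonglongrightarrow> Z (max 0 (fst p)) (snd p)"
      using continuous_on_tendsto_compose[OF c[of "snd p"] lim] g0 by simp
    then show "(\<lambda>k. (\<lambda>(r, \<omega>). Z (g k r) \<omega>) p) \<longlonglongrightarrow> (\<lambda>(r, \<omega>). Z (max 0 r) \<omega>) p" by (simp add: case_prod_unfold)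
  next
    fix k
    have "(\<lambda>p. Z (real (nat \<lceil>max 0 (fst p) * real (Suc k)\<rceil>) / real (Suc k)) (snd p)) \<in> borel_measurable (borel \<Otimes>\<^sub>M M)"
    proof (rule measurable_compose_countable[where f="\<lambda>i p. Z (real i / real (Suc k)) (snd p)"
        and g="\<lambda>p. nat \<lceil>max 0 (fst p) * real (Suc k)\<rceil>"])
      fix i :: nat
      show "(\<lambda>p. Z (real i / real (Suc k)) (snd p)) \<in> borel_measurable (borel \<Otimes>\<^sub>M M)"
        by (rule measurable_compose[OF measurable_snd m]) simp
    qed measurable
    moreover have "real (nat \<lceil>max 0 r * real (Suc k)\<rceil>) / real (Suc k) = g k r" for r
    proof -
      have "0 \<le> max 0 r * real (Suc k)" by simp
      then have "0 \<le> \<lceil>max 0 r * real (Suc k)\<rceil>" by linarith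
      then show ?thesis unfolding g_def by simp
    qed
    ultimately show "(\<lambda>(r, \<omega>). Z (g k r) \<omega>) \<in> borel_measurable (borel \<Otimes>\<^sub>M M)" by (simp add: case_prod_unfold)
  qed
qed

context prob_space begin

lemma fubini_bounded:
  fixes f :: "real \<Rightarrow> 'a \<Rightarrow> real"
  assumes f: "(\<lambda>(r, \<omega>). f r \<omega>) \<in> borel_measurable (borel \<Otimes>\<^sub>M M)"
    and C: "\<And>r \<omega>. r \<in> {s..t} \<Longrightarrow> \<omega> \<in> space M \<Longrightarrow> \<bar>f r \<omega>\<bar> \<le> C"
  shows "set_integrable lborel {s..t} (\<lambda>r. expectation (f r))"
    and "integrable M (\<lambda>\<omega>. LINT r:{s..t}|lborel. f r \<omega>)"
    and "(LINT r:{s..t}|lborel. expectation (f r)) = expectation (\<lambda>\<omega>. LINT r:{s..t}|lborel. f r \<omega>)"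
proof -
  interpret P: pair_sigma_finite lborel M ..
  have f': "(\<lambda>(r, \<omega>). f r \<omega>) \<in> borel_measurable (lborel \<Otimes>\<^sub>M M)"
    using f by (simp add: measurable_cong_sets[OF sets_pair_measure_cong[OF sets_lborel refl] refl])
  have fin: "emeasure (lborel \<Otimes>\<^sub>M M) ({s..t} \<times> space M) < \<infinity>"
    by (subst emeasure_pair_measure_Times) (auto simp: emeasure_space_1 ennreal_mult_less_top emeasure_lborel_Icc_eq)
  have ms: "{s..t} \<times> space M \<in> sets (lborel \<Otimes>\<^sub>M M)" by simp
  have int: "integrable (lborel \<Otimes>\<^sub>M M) (\<lambda>(r, \<omega>). indicator {s..t} r * f r \<omega>)"
  proof (rule Bochner_Integration.integrable_bound)
    show "integrable (lborel \<Otimes>\<^sub>M M) (\<lambda>p. \<bar>C\<bar> * indicator ({s..t} \<times> space M) p)"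
      using fin ms by (intro integrable_mult_right integrable_real_indicator) auto
    show "(\<lambda>(r, \<omega>). indicator {s..t} r * f r \<omega>) \<in> borel_measurable (lborel \<Otimes>\<^sub>M M)"
      using f' by (simp add: case_prod_unfold)
    show "AE p in lborel \<Otimes>\<^sub>M M. norm ((\<lambda>(r, \<omega>). indicator {s..t} r * f r \<omega>) p) \<le> norm (\<bar>C\<bar> * indicator ({s..t} \<times> space M) p)"
      using C by (intro AE_I2) (force simp: space_pair_measure indicator_def abs_mult split: if_splits)
  qed
  note i1 = P.integrable_fst'[OF int] and i2 = P.integrable_snd[OF int] and eq = P.Fubini_integral[OF int]
  show "set_integrable lborel {s..t} (\<lambda>r. expectation (f r))"
    using i1 by (simp add: set_integrable_def)
  show "integrable M (\<lambda>\<omega>. LINT r:{s..t}|lborel. f r \<omega>)"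
    using i2 by (simp add: set_lebesgue_integral_def)
  show "(LINT r:{s..t}|lborel. expectation (f r)) = expectation (\<lambda>\<omega>. LINT r:{s..t}|lborel. f r \<omega>)"
    using eq by (simp add: set_lebesgue_integral_def)
qed

end

section \<open>Ito's formula in expectation for a frozen integrand\<close>

lemma set_integral_split:
  fixes f :: "real \<Rightarrow> real"
  assumes "set_integrable lborel {p..t} f" "p \<le> s" "s \<le> t"
  shows "(LINT r:{p..t}|lborel. f r) = (LINT r:{p..s}|lborel. f r) + (LINT r:{s..t}|lborel. f r)"
proof -
  have "{p..t} = {p..s} \<union> {s..t}" using assms by auto
  moreover have "(LINT r:{p..s} \<union> {s..t}|lborel. f r) = (LINT r:{p..s}|lborel. f r) + (LINT r:{s..t}|lborel. f r)"
  proof (rule set_integral_Un_AE)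
    show "AE x in lborel. \<not> (x \<in> {p..s} \<and> x \<in> {s..t})"
      using AE_lborel_singleton[of s] by eventually_elim auto
    show "set_integrable lborel {p..s} f" "set_integrable lborel {s..t} f"
      using assms by (auto intro: set_integrable_subset)
  qed auto
  ultimately show ?thesis by simp
qed

lemma abs_set_integral_le:
  fixes f :: "real \<Rightarrow> real"
  assumes "s \<le> t" "\<And>r. r \<in> {s..t} \<Longrightarrow> \<bar>f r\<bar> \<le> c"
  shows "\<bar>LINT r:{s..t}|lborel. f r\<bar> \<le> c * (t - s)"
proof -
  have c: "0 \<le> c" using assms(2)[of s] assms(1) by force
  show ?thesis
  proof (cases "set_integrable lborel {s..t} f")
    case True
    have "\<bar>LINT r:{s..t}|lborel. f r\<bar> \<le> (LINT r:{s..t}|lborel. \<bar>f r\<bar>)"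
      using set_integral_norm_bound[OF True] by simp
    also have "\<dots> \<le> (LINT r:{s..t}|lborel. c)"
      using True assms by (intro set_integral_mono set_integrable_abs) (auto simp: set_integrable_def)
    also have "\<dots> = c * (t - s)" using assms(1) by (simp add: set_lebesgue_integral_def)
    finally show ?thesis .
  next
    case False
    then have "(LINT r:{s..t}|lborel. f r) = 0"
      by (simp add: set_integrable_def set_lebesgue_integral_def not_integrable_integral_eq)
    then show ?thesis using c assms(1) by simp
  qed
qed

lemma (in prob_space) expectation_dominated:
  fixes f h :: "'a \<Rightarrow> real"
  assumes f: "f \<in> borel_measurable M" and h: "integrable M h" and ae: "AE \<omega> in M. \<bar>f \<omega>\<bar> \<le> h \<omega>"
  shows "integrable M f" "\<bar>expectation f\<bar> \<le> expectation h"
proof -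
  show i: "integrable M f"
    using ae by (intro Bochner_Integration.integrable_bound[OF h f]) auto
  have "\<bar>expectation f\<bar> \<le> expectation (\<lambda>\<omega>. \<bar>f \<omega>\<bar>)" by (rule integral_abs_bound)
  also have "\<dots> \<le> expectation h" using i ae by (intro integral_mono_AE[OF _ h]) auto
  finally show "\<bar>expectation f\<bar> \<le> expectation h" .
qed

context brownian_setting begin

text \<open>
  The moments of an increment that moves at most at speed \<open>B\<close> apart from a Brownian part. On
  intervals of length at most one the Brownian part dominates, so that the second moment is of
  first order in the length and the fourth moment of second order.
\<close>

lemma increment_square_bounds:
  assumes s: "0 \<le> s" "s \<le> t" "t \<le> s + 1" and B: "0 \<le> B"
    and D: "D \<in> borel_measurable M"
    and ae: "AE \<omega> in M. \<bar>D \<omega>\<bar> \<le> B * (t - s) + B * \<bar>W t \<omega> - W s \<omega>\<bar>"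
  shows "integrable M (\<lambda>\<omega>. (D \<omega>)\<^sup>2)" "expectation (\<lambda>\<omega>. (D \<omega>)\<^sup>2) \<le> 4 * B\<^sup>2 * (t - s)"
    and "integrable M (\<lambda>\<omega>. (D \<omega>) ^ 4)" "expectation (\<lambda>\<omega>. (D \<omega>) ^ 4) \<le> 32 * B ^ 4 * (t - s)\<^sup>2"
proof -
  define dl where "dl = t - s"
  define w where "w \<omega> = W t \<omega> - W s \<omega>" for \<omega>
  have dl: "0 \<le> dl" "dl \<le> 1" using s by (auto simp: dl_def)
  have sq: "(x + y)\<^sup>2 \<le> 2 * (x\<^sup>2 + y\<^sup>2)" for x y :: real
    using sum_squares_bound[of x y] by (simp add: power2_sum algebra_simps)
  have p2: "d\<^sup>2 \<le> 2 * B\<^sup>2 * (dl\<^sup>2 + v\<^sup>2)" if "\<bar>d\<bar> \<le> B * dl + B * \<bar>v\<bar>" for d v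
  proof -
    have "\<bar>d\<bar>\<^sup>2 \<le> (B * dl + B * \<bar>v\<bar>)\<^sup>2" using that by (intro power_mono) auto
    also have "\<dots> \<le> 2 * ((B * dl)\<^sup>2 + (B * \<bar>v\<bar>)\<^sup>2)" by (rule sq)
    finally show ?thesis by (simp add: power_mult_distrib algebra_simps)
  qed
  have p4: "d ^ 4 \<le> 8 * B ^ 4 * (dl ^ 4 + v ^ 4)" if "\<bar>d\<bar> \<le> B * dl + B * \<bar>v\<bar>" for d v
  proof -
    have "(d\<^sup>2)\<^sup>2 \<le> (2 * B\<^sup>2 * (dl\<^sup>2 + v\<^sup>2))\<^sup>2" using p2[OF that] by (intro power_mono) auto
    also have "\<dots> = 4 * B ^ 4 * (dl\<^sup>2 + v\<^sup>2)\<^sup>2" by (simp add: power_mult_distrib)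
    also have "\<dots> \<le> 4 * B ^ 4 * (2 * ((dl\<^sup>2)\<^sup>2 + (v\<^sup>2)\<^sup>2))" by (intro mult_left_mono sq) auto
    finally show ?thesis by (simp add: algebra_simps)
  qed
  have iw: "integrable M (\<lambda>\<omega>. (w \<omega>)\<^sup>2)" "integrable M (\<lambda>\<omega>. w \<omega> ^ 4)"
    using increment_integrable[OF s(1,2)] by (auto simp: w_def)
  have ew: "expectation (\<lambda>\<omega>. (w \<omega>)\<^sup>2) = dl" "expectation (\<lambda>\<omega>. w \<omega> ^ 4) = 3 * dl\<^sup>2"
    using increment_moments[OF s(1,2)] by (auto simp: w_def dl_def)
  have a2: "AE \<omega> in M. (D \<omega>)\<^sup>2 \<le> 2 * B\<^sup>2 * (dl\<^sup>2 + (w \<omega>)\<^sup>2)"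
    and a4: "AE \<omega> in M. (D \<omega>) ^ 4 \<le> 8 * B ^ 4 * (dl ^ 4 + (w \<omega>) ^ 4)"
    using ae by (eventually_elim, use p2 p4 in \<open>auto simp: dl_def w_def\<close>)+
  have i2: "integrable M (\<lambda>\<omega>. 2 * B\<^sup>2 * (dl\<^sup>2 + (w \<omega>)\<^sup>2))" and i4: "integrable M (\<lambda>\<omega>. 8 * B ^ 4 * (dl ^ 4 + (w \<omega>) ^ 4))"
    using iw by auto
  show I2: "integrable M (\<lambda>\<omega>. (D \<omega>)\<^sup>2)"
    using a2 D by (intro Bochner_Integration.integrable_bound[OF i2]) auto
  show I4: "integrable M (\<lambda>\<omega>. (D \<omega>) ^ 4)"
    using a4 D by (intro Bochner_Integration.integrable_bound[OF i4]) auto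
  have "expectation (\<lambda>\<omega>. (D \<omega>)\<^sup>2) \<le> 2 * B\<^sup>2 * (dl\<^sup>2 + dl)"
    using integral_mono_AE[OF I2 i2 a2] iw ew by (simp add: prob_space)
  also have "\<dots> \<le> 2 * B\<^sup>2 * (dl + dl)"
    using dl by (intro mult_left_mono add_right_mono) (auto simp: power2_eq_square mult_left_le)
  finally show "expectation (\<lambda>\<omega>. (D \<omega>)\<^sup>2) \<le> 4 * B\<^sup>2 * (t - s)" by (simp add: dl_def algebra_simps)
  have "expectation (\<lambda>\<omega>. (D \<omega>) ^ 4) \<le> 8 * B ^ 4 * (dl ^ 4 + 3 * dl\<^sup>2)"
    using integral_mono_AE[OF I4 i4 a4] iw ew by (simp add: prob_space)
  also have "\<dots> \<le> 8 * B ^ 4 * (dl\<^sup>2 + 3 * dl\<^sup>2)"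
    using dl power_decreasing[of 2 4 dl] by (intro mult_left_mono add_right_mono) auto
  finally show "expectation (\<lambda>\<omega>. (D \<omega>) ^ 4) \<le> 32 * B ^ 4 * (t - s)\<^sup>2" by (simp add: dl_def algebra_simps)
qed

end

text \<open>
  One piece of a stochastic differential: between \<open>p\<close> and \<open>q\<close> the process \<open>Y\<close> has drift \<open>\<beta>\<close> and
  the diffusion coefficient \<open>\<eta>\<close>, which is known at time \<open>p\<close>. The time argument of the test
  function is itself a process \<open>\<Theta>\<close> with speed \<open>\<theta>\<close>; a clock that stops at a stopping time is the
  case that matters later.
\<close>

locale ito_piece = brownian_setting M F W
  for M :: "'a measure" and F :: "real \<Rightarrow> 'a measure" and W :: "real \<Rightarrow> 'a \<Rightarrow> real" +
  fixes T p q B :: real and \<Theta> Y \<theta> \<beta> :: "real \<Rightarrow> 'a \<Rightarrow> real" and \<eta> :: "'a \<Rightarrow> real"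
    and g gt gx gxx :: "real \<Rightarrow> real \<Rightarrow> real"
  assumes test: "test_function T g gt gx gxx"
    and pq: "0 \<le> p" "p \<le> q" "q \<le> T" and B: "0 \<le> B"
    and \<Theta>_in: "\<And>r \<omega>. \<omega> \<in> space M \<Longrightarrow> \<Theta> r \<omega> \<in> {0..T}"
    and adapted: "\<And>r. r \<in> {p..q} \<Longrightarrow> \<Theta> r \<in> borel_measurable (F r)" "\<And>r. r \<in> {p..q} \<Longrightarrow> Y r \<in> borel_measurable (F r)"
    and joint: "(\<lambda>(r, \<omega>). \<Theta> r \<omega>) \<in> borel_measurable (borel \<Otimes>\<^sub>M M)" "(\<lambda>(r, \<omega>). Y r \<omega>) \<in> borel_measurable (borel \<Otimes>\<^sub>M M)"
      "(\<lambda>(r, \<omega>). \<theta> r \<omega>) \<in> borel_measurable (borel \<Otimes>\<^sub>M M)" "(\<lambda>(r, \<omega>). \<beta> r \<omega>) \<in> borel_measurable (borel \<Otimes>\<^sub>M M)"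
    and bounds: "\<And>r \<omega>. \<omega> \<in> space M \<Longrightarrow> \<bar>\<theta> r \<omega>\<bar> \<le> B" "\<And>r \<omega>. \<omega> \<in> space M \<Longrightarrow> \<bar>\<beta> r \<omega>\<bar> \<le> B"
      "\<And>\<omega>. \<omega> \<in> space M \<Longrightarrow> \<bar>\<eta> \<omega>\<bar> \<le> B"
    and \<eta>_meas: "\<eta> \<in> borel_measurable (F p)"
    and dynamics: "\<And>s t. p \<le> s \<Longrightarrow> s \<le> t \<Longrightarrow> t \<le> q \<Longrightarrow> AE \<omega> in M. \<Theta> t \<omega> - \<Theta> s \<omega> = (LINT r:{s..t}|lborel. \<theta> r \<omega>)"
      "\<And>s t. p \<le> s \<Longrightarrow> s \<le> t \<Longrightarrow> t \<le> q \<Longrightarrow>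
         AE \<omega> in M. Y t \<omega> - Y s \<omega> = (LINT r:{s..t}|lborel. \<beta> r \<omega>) + \<eta> \<omega> * (W t \<omega> - W s \<omega>)"
begin

lemma test_bound:
  "\<exists>L\<ge>0. \<forall>G\<in>{gt, gx, gxx}. \<forall>r\<in>{0..T}. \<forall>x. \<bar>G r x\<bar> \<le> L"
proof -
  obtain L where "0 \<le> L" and "\<forall>r\<in>{0..T}. \<forall>x. \<bar>g r x\<bar> \<le> L \<and> \<bar>gt r x\<bar> \<le> L \<and> \<bar>gx r x\<bar> \<le> L \<and> \<bar>gxx r x\<bar> \<le> L"
    using test_function_bound[OF test] by blast
  then show ?thesis by (intro exI[of _ L] conjI ballI allI) (simp_all only: insert_iff empty_iff, elim disjE, simp_all)
qed

lemma test_modulus: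
  assumes "0 < e"
  obtains K where "0 \<le> K" "\<And>G s s' x y. G \<in> {gt, gx, gxx} \<Longrightarrow> s \<in> {0..T} \<Longrightarrow> s' \<in> {0..T} \<Longrightarrow>
    \<bar>G s x - G s' y\<bar> \<le> e + K * (\<bar>s - s'\<bar> + (x - y)\<^sup>2)"
proof -
  have in_set: "gt \<in> {g, gt, gx, gxx}" "gx \<in> {g, gt, gx, gxx}" "gxx \<in> {g, gt, gx, gxx}" by simp_all
  note modul = compact_support_modulus(2)[OF test_function_continuous[OF test] test_function_support[OF test] assms]
  from modul[OF in_set(1) in_set(1)] obtain K1 where 1: "0 \<le> K1"
    "\<forall>s\<in>{0..T}. \<forall>s'\<in>{0..T}. \<forall>x y. \<bar>gt s x - gt s' y\<bar> \<le> e + K1 * (\<bar>s - s'\<bar> + (x - y)\<^sup>2)" by (elim exE conjE)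
  from modul[OF in_set(2) in_set(2)] obtain K2 where 2: "0 \<le> K2"
    "\<forall>s\<in>{0..T}. \<forall>s'\<in>{0..T}. \<forall>x y. \<bar>gx s x - gx s' y\<bar> \<le> e + K2 * (\<bar>s - s'\<bar> + (x - y)\<^sup>2)" by (elim exE conjE)
  from modul[OF in_set(3) in_set(3)] obtain K3 where 3: "0 \<le> K3"
    "\<forall>s\<in>{0..T}. \<forall>s'\<in>{0..T}. \<forall>x y. \<bar>gxx s x - gxx s' y\<bar> \<le> e + K3 * (\<bar>s - s'\<bar> + (x - y)\<^sup>2)" by (elim exE conjE)
  have "\<bar>G s x - G s' y\<bar> \<le> e + (K1 + K2 + K3) * (\<bar>s - s'\<bar> + (x - y)\<^sup>2)"
    if G: "G \<in> {gt, gx, gxx}" and s: "s \<in> {0..T}" "s' \<in> {0..T}" for G s s' x y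
  proof -
    have bds: "\<bar>gt s x - gt s' y\<bar> \<le> e + K1 * (\<bar>s - s'\<bar> + (x - y)\<^sup>2)"
      "\<bar>gx s x - gx s' y\<bar> \<le> e + K2 * (\<bar>s - s'\<bar> + (x - y)\<^sup>2)"
      "\<bar>gxx s x - gxx s' y\<bar> \<le> e + K3 * (\<bar>s - s'\<bar> + (x - y)\<^sup>2)"
      by (rule 1(2)[rule_format, OF s] 2(2)[rule_format, OF s] 3(2)[rule_format, OF s])+
    have nn: "0 \<le> K1 * (\<bar>s - s'\<bar> + (x - y)\<^sup>2)" "0 \<le> K2 * (\<bar>s - s'\<bar> + (x - y)\<^sup>2)" "0 \<le> K3 * (\<bar>s - s'\<bar> + (x - y)\<^sup>2)"
      using 1(1) 2(1) 3(1) by simp_all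
    from G consider "G = gt" | "G = gx" | "G = gxx" by (elim insertE emptyE)
    then show ?thesis using bds nn unfolding distrib_right[of _ _ "\<bar>s - s'\<bar> + (x - y)\<^sup>2"] by cases (hypsubst, linarith)+
  qed
  then show ?thesis using 1(1) 2(1) 3(1) by (intro that[of "K1 + K2 + K3"]) auto
qed

lemma along_F: "G \<in> {g, gt, gx, gxx} \<Longrightarrow> r \<in> {p..q} \<Longrightarrow> (\<lambda>\<omega>. G (\<Theta> r \<omega>) (Y r \<omega>)) \<in> borel_measurable (F r)"
  by (rule measurable_clamped_compose[OF test_function_continuous[OF test] adapted]) (assumption | simp only: space_F \<Theta>_in)+

lemma along_M: "G \<in> {g, gt, gx, gxx} \<Longrightarrow> r \<in> {p..q} \<Longrightarrow> (\<lambda>\<omega>. G (\<Theta> r \<omega>) (Y r \<omega>)) \<in> borel_measurable M"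
  using along_F measurable_F_M by blast

lemma along_joint: "G \<in> {g, gt, gx, gxx} \<Longrightarrow> (\<lambda>(r, \<omega>). G (\<Theta> r \<omega>) (Y r \<omega>)) \<in> borel_measurable (borel \<Otimes>\<^sub>M M)"
  unfolding case_prod_unfold
  by (rule measurable_clamped_compose[OF test_function_continuous[OF test] joint(1,2)[unfolded case_prod_unfold]])
    (assumption | auto intro!: \<Theta>_in simp: space_pair_measure simp del: atLeastAtMost_iff)+

text \<open>
  The expected drift of \<open>g (\<Theta> r) (Y r)\<close> that Ito's formula predicts.
\<close>

definition "mean_drift r = expectation (\<lambda>\<omega>. \<theta> r \<omega> * gt (\<Theta> r \<omega>) (Y r \<omega>) + \<beta> r \<omega> * gx (\<Theta> r \<omega>) (Y r \<omega>) + 1/2 * (\<eta> \<omega>)\<^sup>2 * gxx (\<Theta> r \<omega>) (Y r \<omega>))"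

lemma \<eta>_M [measurable]: "\<eta> \<in> borel_measurable M"
  using \<eta>_meas measurable_F_M by blast

lemma \<theta>\<beta>_M: "\<theta> r \<in> borel_measurable M" "\<beta> r \<in> borel_measurable M"
  using joint(3,4) by (auto dest: measurable_Pair2[where x=r])

lemma displacement:
  assumes "p \<le> s" "s \<le> r" "r \<le> q"
  shows "AE \<omega> in M. \<bar>Y r \<omega> - Y s \<omega>\<bar> \<le> B * (r - s) + B * \<bar>W r \<omega> - W s \<omega>\<bar>"
    and "AE \<omega> in M. \<bar>\<Theta> r \<omega> - \<Theta> s \<omega>\<bar> \<le> B * (r - s)"
proof -
  show "AE \<omega> in M. \<bar>\<Theta> r \<omega> - \<Theta> s \<omega>\<bar> \<le> B * (r - s)"
    using dynamics(1)[OF assms] AE_space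
  proof eventually_elim
    case (elim \<omega>)
    then show ?case using abs_set_integral_le[OF assms(2), of "\<lambda>r. \<theta> r \<omega>" B] bounds by simp
  qed
  show "AE \<omega> in M. \<bar>Y r \<omega> - Y s \<omega>\<bar> \<le> B * (r - s) + B * \<bar>W r \<omega> - W s \<omega>\<bar>"
    using dynamics(2)[OF assms] AE_space
  proof eventually_elim
    case (elim \<omega>)
    have "\<bar>LINT r:{s..r}|lborel. \<beta> r \<omega>\<bar> \<le> B * (r - s)"
      using abs_set_integral_le[OF assms(2), of "\<lambda>r. \<beta> r \<omega>" B] bounds elim by simp
    moreover have "\<bar>\<eta> \<omega> * (W r \<omega> - W s \<omega>)\<bar> \<le> B * \<bar>W r \<omega> - W s \<omega>\<bar>"
      using bounds(3)[of \<omega>] elim by (simp add: abs_mult mult_right_mono)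
    ultimately show ?case using elim by linarith
  qed
qed

lemma modulus_expectation:
  assumes "p \<le> s" "s \<le> r" "r \<le> q" "r \<le> s + 1" and G: "G \<in> {g, gt, gx, gxx}"
    and K: "0 \<le> K" "0 \<le> e" "\<And>s s' x y. s \<in> {0..T} \<Longrightarrow> s' \<in> {0..T} \<Longrightarrow> \<bar>G s x - G s' y\<bar> \<le> e + K * (\<bar>s - s'\<bar> + (x - y)\<^sup>2)"
    and Z: "\<And>\<omega>. \<omega> \<in> space M \<Longrightarrow> \<bar>Z \<omega>\<bar> \<le> c" "Z \<in> borel_measurable M" "0 \<le> c"
  shows "\<bar>expectation (\<lambda>\<omega>. Z \<omega> * G (\<Theta> r \<omega>) (Y r \<omega>) - Z \<omega> * G (\<Theta> s \<omega>) (Y s \<omega>))\<bar> \<le> c * (e + K * (B + 4 * B\<^sup>2) * (r - s))"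
proof -
  have m: "Y r \<in> borel_measurable M" "Y s \<in> borel_measurable M"
    using adapted(2) assms measurable_F_M by (metis atLeastAtMost_iff order_trans)+
  then have D: "(\<lambda>\<omega>. Y r \<omega> - Y s \<omega>) \<in> borel_measurable M" by simp
  note d = displacement[OF assms(1-3)]
  have s0: "0 \<le> s" using assms pq by simp
  note I = increment_square_bounds[OF s0 assms(2,4) B D d(1)]
  define h where "h \<omega> = c * (e + K * (B * (r - s) + (Y r \<omega> - Y s \<omega>)\<^sup>2))" for \<omega>
  have h: "integrable M h" unfolding h_def using I(1) by auto
  have "\<bar>expectation (\<lambda>\<omega>. Z \<omega> * G (\<Theta> r \<omega>) (Y r \<omega>) - Z \<omega> * G (\<Theta> s \<omega>) (Y s \<omega>))\<bar> \<le> expectation h"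
  proof (rule expectation_dominated(2)[OF _ h])
    show "(\<lambda>\<omega>. Z \<omega> * G (\<Theta> r \<omega>) (Y r \<omega>) - Z \<omega> * G (\<Theta> s \<omega>) (Y s \<omega>)) \<in> borel_measurable M"
      using along_M[OF G, of r] along_M[OF G, of s] Z(2) assms(1-3) by auto
    show "AE \<omega> in M. \<bar>Z \<omega> * G (\<Theta> r \<omega>) (Y r \<omega>) - Z \<omega> * G (\<Theta> s \<omega>) (Y s \<omega>)\<bar> \<le> h \<omega>"
      using d(2) AE_space
    proof eventually_elim
      case (elim \<omega>)
      have "\<bar>G (\<Theta> r \<omega>) (Y r \<omega>) - G (\<Theta> s \<omega>) (Y s \<omega>)\<bar> \<le> e + K * (\<bar>\<Theta> r \<omega> - \<Theta> s \<omega>\<bar> + (Y r \<omega> - Y s \<omega>)\<^sup>2)"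
        using K(3) \<Theta>_in[OF elim(2)] by blast
      also have "\<dots> \<le> e + K * (B * (r - s) + (Y r \<omega> - Y s \<omega>)\<^sup>2)"
        using elim K by (intro add_left_mono mult_left_mono add_right_mono) auto
      finally have "\<bar>G (\<Theta> r \<omega>) (Y r \<omega>) - G (\<Theta> s \<omega>) (Y s \<omega>)\<bar> \<le> e + K * (B * (r - s) + (Y r \<omega> - Y s \<omega>)\<^sup>2)" .
      then show ?case unfolding h_def right_diff_distrib[symmetric] abs_mult
        using Z(1)[OF elim(2)] Z(3) by (intro mult_mono) auto
    qed
  qed
  also have "expectation h = c * (e + K * (B * (r - s) + expectation (\<lambda>\<omega>. (Y r \<omega> - Y s \<omega>)\<^sup>2)))"
    unfolding h_def using I(1) by (simp add: prob_space)
  also have "\<dots> \<le> c * (e + K * (B * (r - s) + 4 * B\<^sup>2 * (r - s)))"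
    using I(2) K Z(3) by (intro mult_left_mono add_left_mono) auto
  finally show ?thesis by (simp add: algebra_simps)
qed

lemma mean_drift_integrable: "set_integrable lborel {s..t} mean_drift"
proof -
  from test_bound obtain L where L0: "0 \<le> L" "\<forall>G\<in>{gt, gx, gxx}. \<forall>r\<in>{0..T}. \<forall>x. \<bar>G r x\<bar> \<le> L" by (elim exE conjE)
  note L = L0(1) L0(2)[rule_format]
  show ?thesis
    unfolding mean_drift_def
  proof (rule fubini_bounded(1))
    show "(\<lambda>(r, \<omega>). \<theta> r \<omega> * gt (\<Theta> r \<omega>) (Y r \<omega>) + \<beta> r \<omega> * gx (\<Theta> r \<omega>) (Y r \<omega>) + 1/2 * (\<eta> \<omega>)\<^sup>2 * gxx (\<Theta> r \<omega>) (Y r \<omega>))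
      \<in> borel_measurable (borel \<Otimes>\<^sub>M M)"
      using joint(3,4) along_joint[of gt] along_joint[of gx] along_joint[of gxx] by (simp add: case_prod_unfold)
    fix r \<omega> assume \<omega>: "\<omega> \<in> space M"
    have "(\<eta> \<omega>)\<^sup>2 \<le> B\<^sup>2" using power_mono[OF bounds(3)[OF \<omega>], of 2] by simp
    then have "\<bar>\<theta> r \<omega> * gt (\<Theta> r \<omega>) (Y r \<omega>)\<bar> \<le> B * L" "\<bar>\<beta> r \<omega> * gx (\<Theta> r \<omega>) (Y r \<omega>)\<bar> \<le> B * L"
      "\<bar>1/2 * (\<eta> \<omega>)\<^sup>2 * gxx (\<Theta> r \<omega>) (Y r \<omega>)\<bar> \<le> 1/2 * B\<^sup>2 * L"
      unfolding abs_mult using bounds \<omega> L \<Theta>_in[OF \<omega>] B by (auto intro!: mult_mono simp del: atLeastAtMost_iff)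
    then show "\<bar>\<theta> r \<omega> * gt (\<Theta> r \<omega>) (Y r \<omega>) + \<beta> r \<omega> * gx (\<Theta> r \<omega>) (Y r \<omega>) + 1/2 * (\<eta> \<omega>)\<^sup>2 * gxx (\<Theta> r \<omega>) (Y r \<omega>)\<bar>
      \<le> B * L + B * L + 1/2 * B\<^sup>2 * L" by linarith
  qed
qed

text \<open>
  Ito's formula in expectation over one short step, with an error of the form \<open>e * (t - s)\<close> plus a
  term of second order. By Taylor expansion the increment of \<open>g\<close> is a quadratic polynomial in the
  increments of \<open>\<Theta>\<close> and \<open>Y\<close>, with coefficients known at time \<open>s\<close>, up to errors governed by the
  modulus of continuity of the derivatives. The Brownian increment \<open>w\<close> and \<open>w\<^sup>2 - (t - s)\<close> have
  mean zero even after multiplication by these coefficients. What remains is the drift with its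
  derivatives frozen at time \<open>s\<close>, which is close to \<open>mean_drift\<close>.
\<close>

lemma step_estimate:
  assumes st: "p \<le> s" "s \<le> t" "t \<le> q" "t \<le> s + 1"
    and L: "0 \<le> L" "\<And>r x. r \<in> {0..T} \<Longrightarrow> \<bar>gt r x\<bar> \<le> L" "\<And>r x. r \<in> {0..T} \<Longrightarrow> \<bar>gx r x\<bar> \<le> L" "\<And>r x. r \<in> {0..T} \<Longrightarrow> \<bar>gxx r x\<bar> \<le> L"
    and K: "0 \<le> K" "0 < e" "\<And>G s s' x y. G \<in> {gt, gx, gxx} \<Longrightarrow> s \<in> {0..T} \<Longrightarrow> s' \<in> {0..T} \<Longrightarrow> \<bar>G s x - G s' y\<bar> \<le> e + K * (\<bar>s - s'\<bar> + (x - y)\<^sup>2)"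
  shows "\<bar>expectation (\<lambda>\<omega>. g (\<Theta> t \<omega>) (Y t \<omega>)) - expectation (\<lambda>\<omega>. g (\<Theta> s \<omega>) (Y s \<omega>)) - (LINT r:{s..t}|lborel. mean_drift r)\<bar>
    \<le> e * (3 * B + 5 * B\<^sup>2 + L * B\<^sup>2) * (t - s) +
       (K * (3 * B\<^sup>2 + 13 * B ^ 3 + 20 * B ^ 4) + L * (B\<^sup>2 + B\<^sup>2 / e)) * (t - s)\<^sup>2"
proof -
  define dl where "dl = t - s"
  define w where "w \<omega> = W t \<omega> - W s \<omega>" for \<omega>
  define ga where "ga \<omega> = gt (\<Theta> s \<omega>) (Y s \<omega>)" for \<omega>
  define gb where "gb \<omega> = gx (\<Theta> s \<omega>) (Y s \<omega>)" for \<omega>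
  define gc where "gc \<omega> = gxx (\<Theta> s \<omega>) (Y s \<omega>)" for \<omega>
  (* The drift with the derivatives of g frozen at time s. *)
  define \<mu> where "\<mu> r \<omega> = \<theta> r \<omega> * ga \<omega> + \<beta> r \<omega> * gb \<omega> + 1/2 * (\<eta> \<omega>)\<^sup>2 * gc \<omega>" for r \<omega>
  have dl: "0 \<le> dl" "dl \<le> 1" using st by (auto simp: dl_def)
  have s: "0 \<le> s" "s \<in> {p..q}" "t \<in> {p..q}" using pq st by auto
  have gF: "ga \<in> borel_measurable (F s)" "gb \<in> borel_measurable (F s)" "gc \<in> borel_measurable (F s)"
    unfolding ga_def gb_def gc_def using s by (auto intro!: along_F)
  then have gM [measurable]: "ga \<in> borel_measurable M" "gb \<in> borel_measurable M" "gc \<in> borel_measurable M"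
    using measurable_F_M by blast+
  have gL: "\<bar>ga \<omega>\<bar> \<le> L" "\<bar>gb \<omega>\<bar> \<le> L" "\<bar>gc \<omega>\<bar> \<le> L" if "\<omega> \<in> space M" for \<omega>
    unfolding ga_def gb_def gc_def using L \<Theta>_in[OF that] by auto
  have Ym [measurable]: "Y s \<in> borel_measurable M" "Y t \<in> borel_measurable M"
    using adapted(2)[OF s(2)] adapted(2)[OF s(3)] measurable_F_M by blast+
  have gm [measurable]: "(\<lambda>\<omega>. g (\<Theta> t \<omega>) (Y t \<omega>)) \<in> borel_measurable M" "(\<lambda>\<omega>. g (\<Theta> s \<omega>) (Y s \<omega>)) \<in> borel_measurable M"
    using along_M[of g] s by auto
  have wm [measurable]: "w \<in> borel_measurable M"
    unfolding w_def using W_meas_M[of s] W_meas_M[of t] s st by auto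
  have \<eta>F: "\<eta> \<in> borel_measurable (F s)" using measurable_F_mono[OF \<eta>_meas st(1)] .

  have \<mu>_joint: "(\<lambda>(r, \<omega>). \<mu> r \<omega>) \<in> borel_measurable (borel \<Otimes>\<^sub>M M)"
    unfolding \<mu>_def using joint(3,4) by (simp add: case_prod_unfold)
  have \<eta>2: "(\<eta> \<omega>)\<^sup>2 \<le> B\<^sup>2" if "\<omega> \<in> space M" for \<omega>
    using power_mono[OF bounds(3)[OF that], of 2] by simp
  have \<mu>_bound: "\<bar>\<mu> r \<omega>\<bar> \<le> B * L + B * L + 1/2 * B\<^sup>2 * L" if "\<omega> \<in> space M" for r \<omega>
  proof -
    have "\<bar>\<theta> r \<omega> * ga \<omega>\<bar> \<le> B * L" "\<bar>\<beta> r \<omega> * gb \<omega>\<bar> \<le> B * L" "\<bar>1/2 * (\<eta> \<omega>)\<^sup>2 * gc \<omega>\<bar> \<le> 1/2 * B\<^sup>2 * L"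
      unfolding abs_mult using bounds that gL[OF that] B \<eta>2[OF that] by (auto intro!: mult_mono)
    then show ?thesis unfolding \<mu>_def by linarith
  qed
  have fub: "set_integrable lborel {s..t} (\<lambda>r. expectation (\<mu> r))"
    "integrable M (\<lambda>\<omega>. LINT r:{s..t}|lborel. \<mu> r \<omega>)"
    "(LINT r:{s..t}|lborel. expectation (\<mu> r)) = expectation (\<lambda>\<omega>. LINT r:{s..t}|lborel. \<mu> r \<omega>)"
    by (rule fubini_bounded[OF \<mu>_joint], rule \<mu>_bound, assumption)+

  (* the generator is almost constant on the short interval *)
  define cK where "cK = e + K * (B + 4 * B\<^sup>2) * dl"
  have cK: "0 \<le> cK" unfolding cK_def using K(1,2) B dl by auto
  have close: "\<bar>mean_drift r - expectation (\<mu> r)\<bar> \<le> (2 * B + 1/2 * B\<^sup>2) * cK" if r: "r \<in> {s..t}" for r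
  proof -
    have r': "s \<le> r" "r \<le> q" "r \<le> s + 1" "r \<in> {p..q}" "r - s \<le> dl" using r st by (auto simp: dl_def)
    have 1: "\<bar>expectation (\<lambda>\<omega>. Z \<omega> * G (\<Theta> r \<omega>) (Y r \<omega>) - Z \<omega> * G (\<Theta> s \<omega>) (Y s \<omega>))\<bar> \<le> c * cK"
      and 2: "integrable M (\<lambda>\<omega>. Z \<omega> * G (\<Theta> r \<omega>) (Y r \<omega>) - Z \<omega> * G (\<Theta> s \<omega>) (Y s \<omega>))"
      if G: "G \<in> {gt, gx, gxx}" and Z: "\<And>\<omega>. \<omega> \<in> space M \<Longrightarrow> \<bar>Z \<omega>\<bar> \<le> c" "Z \<in> borel_measurable M" "0 \<le> c" for G Z c
    proof -
      have G': "G \<in> {g, gt, gx, gxx}" using G by blast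
      have "\<bar>expectation (\<lambda>\<omega>. Z \<omega> * G (\<Theta> r \<omega>) (Y r \<omega>) - Z \<omega> * G (\<Theta> s \<omega>) (Y s \<omega>))\<bar> \<le> c * (e + K * (B + 4 * B\<^sup>2) * (r - s))"
        using K(2) by (intro modulus_expectation[OF st(1) r'(1,2,3) G' K(1) _ K(3)[OF G] Z]) auto
      also have "\<dots> \<le> c * cK" unfolding cK_def
        using Z(3) r'(5) K(1) B by (intro mult_left_mono add_left_mono) auto
      finally show "\<bar>expectation (\<lambda>\<omega>. Z \<omega> * G (\<Theta> r \<omega>) (Y r \<omega>) - Z \<omega> * G (\<Theta> s \<omega>) (Y s \<omega>))\<bar> \<le> c * cK" .
      have GL: "\<bar>G r' x\<bar> \<le> L" if "r' \<in> {0..T}" for r' x using G L that by auto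
      have "\<bar>Z \<omega> * G (\<Theta> r \<omega>) (Y r \<omega>) - Z \<omega> * G (\<Theta> s \<omega>) (Y s \<omega>)\<bar> \<le> c * L + c * L" if "\<omega> \<in> space M" for \<omega>
      proof -
        have "\<bar>Z \<omega> * G (\<Theta> r' \<omega>) (Y r' \<omega>)\<bar> \<le> c * L" for r'
          unfolding abs_mult using Z(1,3) GL \<Theta>_in[OF that] that by (intro mult_mono) auto
        from this[of r] this[of s] show ?thesis by linarith
      qed
      then show "integrable M (\<lambda>\<omega>. Z \<omega> * G (\<Theta> r \<omega>) (Y r \<omega>) - Z \<omega> * G (\<Theta> s \<omega>) (Y s \<omega>))"
        using along_M[OF G' r'(4)] along_M[OF G' s(2)] Z(2)
        by (intro integrable_const_bound[where B="c * L + c * L"]) auto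
    qed
    have \<eta>c: "\<bar>1/2 * (\<eta> \<omega>)\<^sup>2\<bar> \<le> 1/2 * B\<^sup>2" if "\<omega> \<in> space M" for \<omega> using \<eta>2[OF that] by simp
    have \<eta>m: "(\<lambda>\<omega>. 1/2 * (\<eta> \<omega>)\<^sup>2) \<in> borel_measurable M" by measurable
    define d1 where "d1 \<omega> = \<theta> r \<omega> * gt (\<Theta> r \<omega>) (Y r \<omega>) - \<theta> r \<omega> * gt (\<Theta> s \<omega>) (Y s \<omega>)" for \<omega>
    define d2 where "d2 \<omega> = \<beta> r \<omega> * gx (\<Theta> r \<omega>) (Y r \<omega>) - \<beta> r \<omega> * gx (\<Theta> s \<omega>) (Y s \<omega>)" for \<omega>
    define d3 where "d3 \<omega> = 1/2 * (\<eta> \<omega>)\<^sup>2 * gxx (\<Theta> r \<omega>) (Y r \<omega>) - 1/2 * (\<eta> \<omega>)\<^sup>2 * gxx (\<Theta> s \<omega>) (Y s \<omega>)" for \<omega>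
    have b1: "\<bar>expectation d1\<bar> \<le> B * cK" "integrable M d1"
      unfolding d1_def using 1[of gt "\<theta> r" B] 2[of gt "\<theta> r" B] bounds(1) \<theta>\<beta>_M B by auto
    have b2: "\<bar>expectation d2\<bar> \<le> B * cK" "integrable M d2"
      unfolding d2_def using 1[of gx "\<beta> r" B] 2[of gx "\<beta> r" B] bounds(2) \<theta>\<beta>_M B by auto
    have b3: "\<bar>expectation d3\<bar> \<le> 1/2 * B\<^sup>2 * cK" "integrable M d3"
      unfolding d3_def
      by (rule 1[OF _ \<eta>c \<eta>m]; simp) (rule 2[OF _ \<eta>c \<eta>m]; simp)
    have \<mu>i: "integrable M (\<mu> r)"
    proof (rule integrable_const_bound)
      show "\<mu> r \<in> borel_measurable M" unfolding \<mu>_def using \<theta>\<beta>_M by auto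
      show "AE \<omega> in M. norm (\<mu> r \<omega>) \<le> B * L + B * L + 1/2 * B\<^sup>2 * L" using \<mu>_bound by auto
    qed
    have "mean_drift r = expectation (\<lambda>\<omega>. \<mu> r \<omega> + (d1 \<omega> + d2 \<omega> + d3 \<omega>))"
      unfolding mean_drift_def \<mu>_def d1_def d2_def d3_def ga_def gb_def gc_def
      by (intro Bochner_Integration.integral_cong refl) simp
    also have "\<dots> = expectation (\<mu> r) + (expectation d1 + expectation d2 + expectation d3)"
      using b1(2) b2(2) b3(2) \<mu>i by simp
    finally have "mean_drift r - expectation (\<mu> r) = expectation d1 + expectation d2 + expectation d3" by simp
    then show ?thesis using b1(1) b2(1) b3(1) unfolding distrib_right by linarith
  qed
  have part2: "\<bar>(LINT r:{s..t}|lborel. mean_drift r) - (LINT r:{s..t}|lborel. expectation (\<mu> r))\<bar> \<le> (2 * B + 1/2 * B\<^sup>2) * cK * dl"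
  proof -
    have "(LINT r:{s..t}|lborel. mean_drift r) - (LINT r:{s..t}|lborel. expectation (\<mu> r)) = (LINT r:{s..t}|lborel. mean_drift r - expectation (\<mu> r))"
      using set_integral_diff(2)[OF mean_drift_integrable fub(1)] by simp
    then show ?thesis using abs_set_integral_le[OF st(2) close] by (simp add: dl_def)
  qed

  (* Taylor expansion along the path. The correction of lin by w has mean zero; err collects the
     remainders, and its last line comes from replacing the square of the increment of Y by that
     of its Brownian part. *)
  define lin where "lin \<omega> = (LINT r:{s..t}|lborel. \<mu> r \<omega>) + (gb \<omega> * \<eta> \<omega> * w \<omega> + 1/2 * ((\<eta> \<omega>)\<^sup>2 * gc \<omega> * (w \<omega>)\<^sup>2) - 1/2 * ((\<eta> \<omega>)\<^sup>2 * gc \<omega> * dl))" for \<omega>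
  define err where "err \<omega> = B * dl * (e + K * (B * dl + (Y t \<omega> - Y s \<omega>)\<^sup>2)) + 1/2 * (e * (Y t \<omega> - Y s \<omega>)\<^sup>2 + K * (Y t \<omega> - Y s \<omega>) ^ 4)
    + 1/2 * (L * (B\<^sup>2 * dl\<^sup>2 + e * (B\<^sup>2 * (w \<omega>)\<^sup>2) + B\<^sup>2 * dl\<^sup>2 / e))" for \<omega>
  have \<mu>_path: "(LINT r:{s..t}|lborel. \<mu> r \<omega>) = (LINT r:{s..t}|lborel. \<theta> r \<omega>) * ga \<omega> + (LINT r:{s..t}|lborel. \<beta> r \<omega>) * gb \<omega> + 1/2 * ((\<eta> \<omega>)\<^sup>2 * gc \<omega> * dl)"
    if \<omega>: "\<omega> \<in> space M" for \<omega>
  proof -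
    have i: "set_integrable lborel {s..t} (\<lambda>r. f r \<omega>)"
      if f: "(\<lambda>(r, \<omega>). f r \<omega>) \<in> borel_measurable (borel \<Otimes>\<^sub>M M)" "\<And>r. \<bar>f r \<omega>\<bar> \<le> B" for f :: "real \<Rightarrow> 'a \<Rightarrow> real"
    proof -
      have "(\<lambda>r. f r \<omega>) \<in> borel_measurable borel"
        using measurable_Pair1[OF f(1) \<omega>] by simp
      then show ?thesis
        using f(2) unfolding set_integrable_def
        by (intro integrableI_bounded_set_indicator[where B=B]) (auto simp: emeasure_lborel_Icc_eq)
    qed
    note i1 = i[OF joint(3) bounds(1)[OF \<omega>]] and i2 = i[OF joint(4) bounds(2)[OF \<omega>]]
    have i3: "set_integrable lborel {s..t} (\<lambda>r. 1/2 * (\<eta> \<omega>)\<^sup>2 * gc \<omega>)" by (rule borel_integrable_atLeastAtMost') simp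
    have "(LINT r:{s..t}|lborel. 1/2 * (\<eta> \<omega>)\<^sup>2 * gc \<omega>) = 1/2 * ((\<eta> \<omega>)\<^sup>2 * gc \<omega> * dl)"
      using st(2) by (simp add: set_lebesgue_integral_def dl_def)
    then show ?thesis unfolding \<mu>_def using i1 i2 i3 by (simp add: set_integral_add)
  qed
  have pointwise: "AE \<omega> in M. \<bar>g (\<Theta> t \<omega>) (Y t \<omega>) - g (\<Theta> s \<omega>) (Y s \<omega>) - lin \<omega>\<bar> \<le> err \<omega>"
    using dynamics(1)[OF st(1-3)] dynamics(2)[OF st(1-3)] displacement(2)[OF st(1-3)] AE_space
  proof eventually_elim
    case (elim \<omega>)
    define d where "d = Y t \<omega> - Y s \<omega>"
    define vt where "vt = \<Theta> t \<omega> - \<Theta> s \<omega>"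
    define a where "a = (LINT r:{s..t}|lborel. \<beta> r \<omega>)"
    define v where "v = \<eta> \<omega> * w \<omega>"
    have dav: "d = a + v" using elim by (simp add: d_def a_def v_def w_def)
    have avt: "\<bar>vt\<bar> \<le> B * dl" using elim by (simp add: vt_def dl_def)
    have aa: "\<bar>a\<bar> \<le> B * dl"
      using abs_set_integral_le[OF st(2), of "\<lambda>r. \<beta> r \<omega>" B] bounds elim by (simp add: a_def dl_def)
    have \<Theta>: "\<Theta> t \<omega> \<in> {0..T}" "\<Theta> s \<omega> \<in> {0..T}" using \<Theta>_in elim by blast+
    have der_t: "((\<lambda>r. g r y) has_real_derivative gt r y) (at r within {0..T})"
      and der_x: "(g r has_real_derivative gx r y) (at y)" "(gx r has_real_derivative gxx r y) (at y)"
      if "r \<in> {0..T}" for r y using test that unfolding test_function_def by blast+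
    obtain z where z: "z \<in> {0..T}" "\<bar>z - \<Theta> s \<omega>\<bar> \<le> \<bar>\<Theta> t \<omega> - \<Theta> s \<omega>\<bar>"
      "g (\<Theta> t \<omega>) (Y t \<omega>) = g (\<Theta> s \<omega>) (Y t \<omega>) + gt z (Y t \<omega>) * (\<Theta> t \<omega> - \<Theta> s \<omega>)"
      by (rule mean_value_within[OF der_t \<Theta>(2,1)])
    obtain x where x: "\<bar>x - Y s \<omega>\<bar> \<le> \<bar>Y t \<omega> - Y s \<omega>\<bar>"
      "g (\<Theta> s \<omega>) (Y t \<omega>) = g (\<Theta> s \<omega>) (Y s \<omega>) + gx (\<Theta> s \<omega>) (Y s \<omega>) * (Y t \<omega> - Y s \<omega>) + gxx (\<Theta> s \<omega>) x / 2 * (Y t \<omega> - Y s \<omega>)\<^sup>2"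
      by (rule taylor_second_order[OF der_x[OF \<Theta>(2)]])
    have e1: "\<bar>(gt z (Y t \<omega>) - ga \<omega>) * vt\<bar> \<le> (e + K * (B * dl + d\<^sup>2)) * (B * dl)"
    proof -
      have "\<bar>gt z (Y t \<omega>) - ga \<omega>\<bar> \<le> e + K * (\<bar>z - \<Theta> s \<omega>\<bar> + d\<^sup>2)"
        unfolding ga_def d_def using K(3)[of gt z "\<Theta> s \<omega>"] z(1) \<Theta>(2) by blast
      also have "\<dots> \<le> e + K * (B * dl + d\<^sup>2)"
        using z(2) avt K(1) by (intro add_left_mono mult_left_mono add_right_mono) (auto simp: vt_def)
      finally show ?thesis unfolding abs_mult using avt by (intro mult_mono) auto
    qed
    have e2: "\<bar>(gxx (\<Theta> s \<omega>) x - gc \<omega>) * d\<^sup>2\<bar> \<le> (e + K * d\<^sup>2) * d\<^sup>2"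
    proof -
      have "\<bar>gxx (\<Theta> s \<omega>) x - gc \<omega>\<bar> \<le> e + K * (\<bar>\<Theta> s \<omega> - \<Theta> s \<omega>\<bar> + (x - Y s \<omega>)\<^sup>2)"
        unfolding gc_def using K(3)[of gxx "\<Theta> s \<omega>" "\<Theta> s \<omega>"] \<Theta>(2) by blast
      also have "\<dots> \<le> e + K * d\<^sup>2"
        using K(1) x(1) unfolding d_def by (intro add_left_mono mult_left_mono) (auto simp: abs_le_square_iff)
      finally show ?thesis unfolding abs_mult by (intro mult_mono) auto
    qed
    have a2: "a\<^sup>2 \<le> B\<^sup>2 * dl\<^sup>2" using power_mono[OF aa, of 2] by (simp add: power_mult_distrib)
    have v2: "v\<^sup>2 \<le> B\<^sup>2 * (w \<omega>)\<^sup>2" unfolding v_def power_mult_distrib using \<eta>2 elim by (intro mult_right_mono) auto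
    (* The mixed term of drift and Brownian part would only be of order 3/2 in dl by the Cauchy
       inequality; Young's inequality with weight e avoids fractional powers. *)
    have young: "\<bar>2 * a * v\<bar> \<le> e * v\<^sup>2 + a\<^sup>2 / e"
    proof -
      have "2 * (e * \<bar>v\<bar>) * \<bar>a\<bar> \<le> (e * \<bar>v\<bar>)\<^sup>2 + \<bar>a\<bar>\<^sup>2" by (rule sum_squares_bound)
      then have "(2 * (e * \<bar>v\<bar>) * \<bar>a\<bar>) / e \<le> ((e * \<bar>v\<bar>)\<^sup>2 + \<bar>a\<bar>\<^sup>2) / e" using K(2) by (intro divide_right_mono) auto
      moreover have "(2 * (e * \<bar>v\<bar>) * \<bar>a\<bar>) / e = \<bar>2 * a * v\<bar>" using K(2) by (simp add: abs_mult)
      moreover have "((e * \<bar>v\<bar>)\<^sup>2 + \<bar>a\<bar>\<^sup>2) / e = e * v\<^sup>2 + a\<^sup>2 / e" using K(2) by (simp add: power2_eq_square field_simps)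
      ultimately show ?thesis by simp
    qed
    have e3: "\<bar>gc \<omega> * (d\<^sup>2 - v\<^sup>2)\<bar> \<le> L * (B\<^sup>2 * dl\<^sup>2 + e * (B\<^sup>2 * (w \<omega>)\<^sup>2) + B\<^sup>2 * dl\<^sup>2 / e)"
    proof -
      have "d\<^sup>2 - v\<^sup>2 = a\<^sup>2 + 2 * a * v" unfolding dav by (simp add: power2_sum)
      then have "\<bar>d\<^sup>2 - v\<^sup>2\<bar> \<le> a\<^sup>2 + (e * v\<^sup>2 + a\<^sup>2 / e)" using young abs_triangle_ineq[of "a\<^sup>2" "2 * a * v"] by simp
      also have "\<dots> \<le> B\<^sup>2 * dl\<^sup>2 + (e * (B\<^sup>2 * (w \<omega>)\<^sup>2) + B\<^sup>2 * dl\<^sup>2 / e)"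
        using a2 v2 K(2) by (intro add_mono mult_left_mono divide_right_mono) auto
      finally show ?thesis unfolding abs_mult using gL(3) elim L(1) by (intro mult_mono) auto
    qed
    have "lin \<omega> = vt * ga \<omega> + a * gb \<omega> + gb \<omega> * v + 1/2 * gc \<omega> * v\<^sup>2"
      unfolding lin_def \<mu>_path[OF elim(4)] using elim(1) by (simp add: vt_def a_def v_def power_mult_distrib algebra_simps)
    moreover have "g (\<Theta> t \<omega>) (Y t \<omega>) - g (\<Theta> s \<omega>) (Y s \<omega>) = gb \<omega> * (a + v) + gxx (\<Theta> s \<omega>) x / 2 * d\<^sup>2 + gt z (Y t \<omega>) * vt"
      unfolding z(3) x(2) dav[symmetric] by (simp add: gb_def d_def vt_def)
    ultimately have "g (\<Theta> t \<omega>) (Y t \<omega>) - g (\<Theta> s \<omega>) (Y s \<omega>) - lin \<omega> =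
      (gt z (Y t \<omega>) - ga \<omega>) * vt + 1/2 * ((gxx (\<Theta> s \<omega>) x - gc \<omega>) * d\<^sup>2) + 1/2 * (gc \<omega> * (d\<^sup>2 - v\<^sup>2))"
      by (simp add: algebra_simps)
    also have "\<bar>\<dots>\<bar> \<le> (e + K * (B * dl + d\<^sup>2)) * (B * dl) + 1/2 * ((e + K * d\<^sup>2) * d\<^sup>2)
       + 1/2 * (L * (B\<^sup>2 * dl\<^sup>2 + e * (B\<^sup>2 * (w \<omega>)\<^sup>2) + B\<^sup>2 * dl\<^sup>2 / e))"
      using e1 e2 e3 by linarith
    also have "\<dots> = err \<omega>" unfolding err_def d_def[symmetric]
      by (simp add: algebra_simps power4_eq_xxxx power2_eq_square)
    finally show ?case .
  qed

  have D: "(\<lambda>\<omega>. Y t \<omega> - Y s \<omega>) \<in> borel_measurable M" by measurable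
  note I = increment_square_bounds[OF s(1) st(2,4) B D displacement(1)[OF st(1-3)], folded dl_def]
  have iw: "integrable M (\<lambda>\<omega>. (w \<omega>)\<^sup>2)" "expectation (\<lambda>\<omega>. (w \<omega>)\<^sup>2) = dl"
    using increment_integrable[OF s(1) st(2), of 2] increment_moments(2)[OF s(1) st(2)] by (auto simp: w_def dl_def)
  have err_int: "integrable M err" unfolding err_def using I(1,3) iw(1) by simp
  have "expectation err = B * dl * (e + K * (B * dl + expectation (\<lambda>\<omega>. (Y t \<omega> - Y s \<omega>)\<^sup>2))) + 1/2 * (e * expectation (\<lambda>\<omega>. (Y t \<omega> - Y s \<omega>)\<^sup>2) + K * expectation (\<lambda>\<omega>. (Y t \<omega> - Y s \<omega>) ^ 4))
    + 1/2 * (L * (B\<^sup>2 * dl\<^sup>2 + e * (B\<^sup>2 * dl) + B\<^sup>2 * dl\<^sup>2 / e))"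
    unfolding err_def using I(1,3) iw by (simp add: prob_space)
  also have "\<dots> \<le> B * dl * (e + K * (B * dl + 4 * B\<^sup>2 * dl)) + 1/2 * (e * (4 * B\<^sup>2 * dl) + K * (32 * B ^ 4 * dl\<^sup>2))
    + 1/2 * (L * (B\<^sup>2 * dl\<^sup>2 + e * (B\<^sup>2 * dl) + B\<^sup>2 * dl\<^sup>2 / e))"
    using I(2,4) B dl K(1,2) by (intro add_mono mult_left_mono order_refl) auto
  finally have err_le: "expectation err \<le> B * dl * (e + K * (B * dl + 4 * B\<^sup>2 * dl)) + 1/2 * (e * (4 * B\<^sup>2 * dl) + K * (32 * B ^ 4 * dl\<^sup>2))
    + 1/2 * (L * (B\<^sup>2 * dl\<^sup>2 + e * (B\<^sup>2 * dl) + B\<^sup>2 * dl\<^sup>2 / e))" .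

  have bi: "integrable M (\<lambda>\<omega>. gb \<omega> * \<eta> \<omega>)" "integrable M (\<lambda>\<omega>. (\<eta> \<omega>)\<^sup>2 * gc \<omega>)"
  proof -
    have "\<bar>gb \<omega> * \<eta> \<omega>\<bar> \<le> L * B" "\<bar>(\<eta> \<omega>)\<^sup>2 * gc \<omega>\<bar> \<le> B\<^sup>2 * L" if "\<omega> \<in> space M" for \<omega>
      unfolding abs_mult using gL[OF that] bounds(3)[OF that] \<eta>2[OF that] L(1) by (auto intro!: mult_mono)
    then show "integrable M (\<lambda>\<omega>. gb \<omega> * \<eta> \<omega>)" "integrable M (\<lambda>\<omega>. (\<eta> \<omega>)\<^sup>2 * gc \<omega>)"
      by - (rule integrable_const_bound[where B="L * B"], auto, rule integrable_const_bound[where B="B\<^sup>2 * L"], auto)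
  qed
  have bF: "(\<lambda>\<omega>. gb \<omega> * \<eta> \<omega>) \<in> borel_measurable (F s)" "(\<lambda>\<omega>. (\<eta> \<omega>)\<^sup>2 * gc \<omega>) \<in> borel_measurable (F s)"
    using gF \<eta>F by auto
  note o1 = increment_orthogonal(1,2)[OF s(1) st(2) bF(1) bi(1), folded w_def]
    and o2 = increment_orthogonal(3,4)[OF s(1) st(2) bF(2) bi(2), folded w_def dl_def]
  have lin_int: "integrable M lin" and lin_exp: "expectation lin = (LINT r:{s..t}|lborel. expectation (\<mu> r))"
    unfolding lin_def fub(3) using fub(2) o1 o2 bi by auto
  have gi: "integrable M (\<lambda>\<omega>. g (\<Theta> r \<omega>) (Y r \<omega>))" if "r \<in> {p..q}" for r
  proof -
    obtain c where "\<forall>s\<in>{0..T}. \<forall>x. \<bar>g s x\<bar> \<le> c"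
      using compact_support_modulus(1)[OF test_function_continuous[OF test] test_function_support[OF test], of g] by auto
    then have "AE \<omega> in M. norm (g (\<Theta> r \<omega>) (Y r \<omega>)) \<le> c" using \<Theta>_in by (auto simp del: atLeastAtMost_iff)
    then show ?thesis using along_M[OF _ that] by (intro integrable_const_bound) auto
  qed
  have "\<bar>expectation (\<lambda>\<omega>. g (\<Theta> t \<omega>) (Y t \<omega>) - g (\<Theta> s \<omega>) (Y s \<omega>) - lin \<omega>)\<bar> \<le> expectation err"
    using lin_int by (intro expectation_dominated(2)[OF _ err_int pointwise]) auto
  then have part1: "\<bar>expectation (\<lambda>\<omega>. g (\<Theta> t \<omega>) (Y t \<omega>)) - expectation (\<lambda>\<omega>. g (\<Theta> s \<omega>) (Y s \<omega>)) - (LINT r:{s..t}|lborel. expectation (\<mu> r))\<bar> \<le> expectation err"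
    using gi s lin_int by (simp add: lin_exp)
  have "\<bar>expectation (\<lambda>\<omega>. g (\<Theta> t \<omega>) (Y t \<omega>)) - expectation (\<lambda>\<omega>. g (\<Theta> s \<omega>) (Y s \<omega>)) - (LINT r:{s..t}|lborel. mean_drift r)\<bar>
    \<le> (B * dl * (e + K * (B * dl + 4 * B\<^sup>2 * dl)) + 1/2 * (e * (4 * B\<^sup>2 * dl) + K * (32 * B ^ 4 * dl\<^sup>2))
    + 1/2 * (L * (B\<^sup>2 * dl\<^sup>2 + e * (B\<^sup>2 * dl) + B\<^sup>2 * dl\<^sup>2 / e))) + (2 * B + 1/2 * B\<^sup>2) * cK * dl"
    using part1 part2 err_le by linarith
  also have "\<dots> = e * (3 * B + 5 * B\<^sup>2 + L * B\<^sup>2) * dl +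
       (K * (3 * B\<^sup>2 + 13 * B ^ 3 + 20 * B ^ 4) + L * (B\<^sup>2 + B\<^sup>2 / e)) * dl\<^sup>2
       - (e * (5/2 * B\<^sup>2 + 1/2 * (L * B\<^sup>2)) * dl + (K * (1/2 * B ^ 3 + 2 * B ^ 4) + 1/2 * (L * (B\<^sup>2 + B\<^sup>2 / e))) * dl\<^sup>2)"
    unfolding cK_def by (simp add: field_simps power2_eq_square power3_eq_cube power4_eq_xxxx)
  also have "\<dots> \<le> e * (3 * B + 5 * B\<^sup>2 + L * B\<^sup>2) * dl +
       (K * (3 * B\<^sup>2 + 13 * B ^ 3 + 20 * B ^ 4) + L * (B\<^sup>2 + B\<^sup>2 / e)) * dl\<^sup>2"
  proof -
    have "0 \<le> e * (5/2 * B\<^sup>2 + 1/2 * (L * B\<^sup>2)) * dl + (K * (1/2 * B ^ 3 + 2 * B ^ 4) + 1/2 * (L * (B\<^sup>2 + B\<^sup>2 / e))) * dl\<^sup>2"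
      using K(1,2) B L(1) dl by (intro add_nonneg_nonneg mult_nonneg_nonneg) auto
    then show ?thesis by linarith
  qed
  finally show ?thesis unfolding dl_def .
qed

text \<open>
  Choosing first \<open>e\<close> and then the length of the steps, the one-step errors become \<open>o(t - s)\<close>, so
  the difference of the two sides does not vary with the end of the interval.
\<close>

lemma ito_interval:
  "expectation (\<lambda>\<omega>. g (\<Theta> q \<omega>) (Y q \<omega>)) - expectation (\<lambda>\<omega>. g (\<Theta> p \<omega>) (Y p \<omega>)) = (LINT r:{p..q}|lborel. mean_drift r)"
proof -
  define D where "D t = expectation (\<lambda>\<omega>. g (\<Theta> t \<omega>) (Y t \<omega>)) - (LINT r:{p..t}|lborel. mean_drift r)" for t
  have "D q = D p"
  proof (rule constant_if_increments_little_o[OF pq(2)])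
    fix \<epsilon> :: real assume \<epsilon>: "0 < \<epsilon>"
    from test_bound obtain L where L0: "0 \<le> L" "\<forall>G\<in>{gt, gx, gxx}. \<forall>r\<in>{0..T}. \<forall>x. \<bar>G r x\<bar> \<le> L" by (elim exE conjE)
    note L = L0(1) L0(2)[rule_format]
    define c where "c = 3 * B + 5 * B\<^sup>2 + L * B\<^sup>2"
    have c: "0 \<le> c" using B L by (auto simp: c_def)
    define e where "e = \<epsilon> / (2 * (c + 1))"
    have e: "0 < e" "e * c \<le> \<epsilon> / 2" using c \<epsilon> by (auto simp: e_def field_simps)
    obtain K where K: "0 \<le> K" "\<And>G s s' x y. G \<in> {gt, gx, gxx} \<Longrightarrow> s \<in> {0..T} \<Longrightarrow> s' \<in> {0..T} \<Longrightarrow>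
       \<bar>G s x - G s' y\<bar> \<le> e + K * (\<bar>s - s'\<bar> + (x - y)\<^sup>2)" using test_modulus[OF e(1)] by metis
    define C where "C = K * (3 * B\<^sup>2 + 13 * B ^ 3 + 20 * B ^ 4) + L * (B\<^sup>2 + B\<^sup>2 / e)"
    have C: "0 \<le> C" using K B L e by (auto simp: C_def)
    define d where "d = min 1 (\<epsilon> / (2 * (C + 1)))"
    have d: "0 < d" "d \<le> 1" "C * d \<le> \<epsilon> / 2"
    proof -
      show "0 < d" "d \<le> 1" using C \<epsilon> by (auto simp: d_def)
      have "C * d \<le> C * (\<epsilon> / (2 * (C + 1)))" using C by (intro mult_left_mono) (auto simp: d_def)
      also have "\<dots> \<le> \<epsilon> / 2" using C \<epsilon> by (auto simp: field_simps)
      finally show "C * d \<le> \<epsilon> / 2" .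
    qed
    have "\<bar>D t - D s\<bar> \<le> \<epsilon> * (t - s)" if st: "p \<le> s" "s \<le> t" "t \<le> q" "t - s < d" for s t
    proof -
      have eq: "D t - D s = expectation (\<lambda>\<omega>. g (\<Theta> t \<omega>) (Y t \<omega>)) - expectation (\<lambda>\<omega>. g (\<Theta> s \<omega>) (Y s \<omega>)) - (LINT r:{s..t}|lborel. mean_drift r)"
        unfolding D_def using set_integral_split[OF mean_drift_integrable[of p t] st(1,2)] by simp
      have "\<bar>D t - D s\<bar> \<le> e * c * (t - s) + C * (t - s)\<^sup>2"
        unfolding eq c_def C_def using st d L K e by (intro step_estimate) auto
      also have "C * (t - s)\<^sup>2 = C * (t - s) * (t - s)" by (simp add: power2_eq_square)
      also have "\<dots> \<le> C * d * (t - s)" using st C by (intro mult_right_mono mult_left_mono) auto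
      also have "\<dots> \<le> \<epsilon> / 2 * (t - s)" using d st by (intro mult_right_mono) auto
      also have "e * c * (t - s) \<le> \<epsilon> / 2 * (t - s)" using e st by (intro mult_right_mono) auto
      finally show ?thesis by simp
    qed
    then show "\<exists>d>0. \<forall>s t. p \<le> s \<longrightarrow> s \<le> t \<longrightarrow> t \<le> q \<longrightarrow> t - s < d \<longrightarrow> \<bar>D t - D s\<bar> \<le> \<epsilon> * (t - s)"
      using d(1) by blast
  qed
  moreover have "(LINT r:{p..p}|lborel. mean_drift r) = 0"
    using abs_set_integral_le[of p p mean_drift "\<bar>mean_drift p\<bar>"] by simp
  ultimately show ?thesis by (simp add: D_def)
qed

end

section \<open>Ito's formula in expectation for simple integrands\<close>

lemma set_integral_cong_except_left:
  fixes f f' :: "real \<Rightarrow> real"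
  assumes "set_integrable lborel {p..q} f" "set_integrable lborel {p..q} f'"
    and "\<And>r. p < r \<Longrightarrow> r \<le> q \<Longrightarrow> f r = f' r"
  shows "(LINT r:{p..q}|lborel. f r) = (LINT r:{p..q}|lborel. f' r)"
  unfolding set_lebesgue_integral_def
proof (rule integral_cong_AE)
  show "AE r in lborel. indicat_real {p..q} r *\<^sub>R f r = indicat_real {p..q} r *\<^sub>R f' r"
    using AE_lborel_singleton[of p] by eventually_elim (use assms(3) in \<open>auto simp: indicator_def\<close>)
qed (use assms in \<open>auto simp: set_integrable_def dest: borel_measurable_integrable\<close>)

lemma set_integral_point [simp]: "(LINT r:{p..p}|lborel. f r) = (0::real)" for p :: real
  using abs_set_integral_le[of p p f "\<bar>f p\<bar>"] by simp

context brownian_setting begin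

context
  fixes n :: nat and s :: "nat \<Rightarrow> real" and h :: "nat \<Rightarrow> 'a \<Rightarrow> real"
  assumes simple: "simple_integrand F n s h"
begin

lemma simple_process_on_piece:
  assumes i: "i < n" and t: "s i < t" "t \<le> s (Suc i)"
  shows "simple_process n s k t \<omega> = k i \<omega>"
proof -
  have "k j \<omega> * indicator {s j<..s (Suc j)} t = (if j = i then k i \<omega> else 0)" if "j < n" for j
  proof -
    consider "j = i" | "Suc j \<le> i" | "Suc i \<le> j" by linarith
    then show ?thesis
    proof cases
      case 2 then show ?thesis using partition_mono[OF simple, of "Suc j" i] i t by (auto simp: indicator_def)
    next
      case 3 then show ?thesis using partition_mono[OF simple, of "Suc i" j] that t by (auto simp: indicator_def)
    qed (use t in auto)
  qed
  then have "simple_process n s k t \<omega> = (\<Sum>j<n. if j = i then k i \<omega> else 0)"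
    unfolding simple_process_def by (intro sum.cong) auto
  then show ?thesis using i by simp
qed

lemma simple_process_off_pieces:
  assumes "t \<le> s 0 \<or> s n < t"
  shows "simple_process n s k t \<omega> = 0"
proof -
  have "k j \<omega> * indicator {s j<..s (Suc j)} t = 0" if "j < n" for j
    using partition_mono[OF simple, of 0 j] partition_mono[OF simple, of "Suc j" n] that assms by (auto simp: indicator_def)
  then show ?thesis unfolding simple_process_def by (intro sum.neutral) auto
qed

text \<open>
  At a given time all simple processes over one partition read off the coefficient with the same
  index, so pointwise relations between coefficients carry over to the processes.
\<close>

lemma simple_process_cases:
  obtains i where "i < n" "\<And>k. simple_process n s k t \<omega> = k i \<omega>" | "\<And>k. simple_process n s k t \<omega> = 0"
proof (cases "t \<le> s 0 \<or> s n < t")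
  case False
  have ex: "\<exists>i<m. s i < t \<and> t \<le> s (Suc i)" if "t \<le> s m" "s 0 < t" for m
    using that
  proof (induction m)
    case (Suc m) then show ?case by (cases "t \<le> s m") (auto simp: less_Suc_eq)
  qed simp
  have "t \<le> s n" "s 0 < t" using False by auto
  from ex[OF this] obtain i where "i < n" "s i < t" "t \<le> s (Suc i)" by blast
  then show ?thesis by (intro that(1)[of i] simple_process_on_piece)
next
  case True
  then show ?thesis by (intro that(2) simple_process_off_pieces)
qed

lemma simple_process_jointly_measurable:
  assumes "\<And>i. i < n \<Longrightarrow> k i \<in> borel_measurable M"
  shows "(\<lambda>(r, \<omega>). simple_process n s k r \<omega>) \<in> borel_measurable (borel \<Otimes>\<^sub>M M)"
  unfolding simple_process_def case_prod_unfold
proof (intro borel_measurable_sum borel_measurable_times)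
  fix i assume "i \<in> {..<n}"
  then show "(\<lambda>p. k i (snd p)) \<in> borel_measurable (borel \<Otimes>\<^sub>M M)"
    using assms by (intro measurable_compose[OF measurable_snd]) auto
  show "(\<lambda>p. indicat_real {s i<..s (Suc i)} (fst p)) \<in> borel_measurable (borel \<Otimes>\<^sub>M M)" by measurable
qed

lemma integral_simple_process:
  assumes t: "0 \<le> t"
  shows "set_integrable lborel {0..t} (\<lambda>r. simple_process n s k r \<omega>)"
    and "(LINT r:{0..t}|lborel. simple_process n s k r \<omega>) = (\<Sum>i<n. k i \<omega> * (min t (s (Suc i)) - min t (s i)))"
proof -
  have piece: "integrable lborel (\<lambda>r. indicator {0..t} r *\<^sub>R (k i \<omega> * indicator {s i<..s (Suc i)} r))"
    "integral\<^sup>L lborel (\<lambda>r. indicator {0..t} r *\<^sub>R (k i \<omega> * indicator {s i<..s (Suc i)} r)) = k i \<omega> * (min t (s (Suc i)) - min t (s i))"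
    if i: "i < n" for i
  proof -
    have "{0..t} \<inter> {s i<..s (Suc i)} = {min t (s i)<..min t (s (Suc i))}"
      using partition_nonneg[OF simple, of i] i t by auto
    then have eq: "indicator {0..t} r *\<^sub>R (k i \<omega> * indicator {s i<..s (Suc i)} r) = k i \<omega> * indicator {min t (s i)<..min t (s (Suc i))} r" for r
      by (auto simp: indicator_def)
    have le: "min t (s i) \<le> min t (s (Suc i))" using partition_step[OF simple i] by auto
    show "integrable lborel (\<lambda>r. indicator {0..t} r *\<^sub>R (k i \<omega> * indicator {s i<..s (Suc i)} r))"
      unfolding eq using le by (intro integrable_mult_right integrable_real_indicator) auto
    show "integral\<^sup>L lborel (\<lambda>r. indicator {0..t} r *\<^sub>R (k i \<omega> * indicator {s i<..s (Suc i)} r)) = k i \<omega> * (min t (s (Suc i)) - min t (s i))"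
      unfolding eq using le by simp
  qed
  have eq: "indicator {0..t} r *\<^sub>R simple_process n s k r \<omega> = (\<Sum>i<n. indicator {0..t} r *\<^sub>R (k i \<omega> * indicator {s i<..s (Suc i)} r))" for r
    unfolding simple_process_def scaleR_sum_right ..
  show "set_integrable lborel {0..t} (\<lambda>r. simple_process n s k r \<omega>)"
    unfolding set_integrable_def eq by (intro Bochner_Integration.integrable_sum piece) auto
  show "(LINT r:{0..t}|lborel. simple_process n s k r \<omega>) = (\<Sum>i<n. k i \<omega> * (min t (s (Suc i)) - min t (s i)))"
    unfolding set_lebesgue_integral_def eq by (subst Bochner_Integration.integral_sum) (auto simp: piece simp del: real_scaleR_def)
qed

lemma simple_integral_on_piece:
  assumes i: "i < n" and ab: "s i \<le> a" "a \<le> b" "b \<le> s (Suc i)"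
  shows "simple_integral W n s h b \<omega> - simple_integral W n s h a \<omega> = h i \<omega> * (W b \<omega> - W a \<omega>)"
proof -
  have "h j \<omega> * (W (min b (s (Suc j))) \<omega> - W (min b (s j)) \<omega>) - h j \<omega> * (W (min a (s (Suc j))) \<omega> - W (min a (s j)) \<omega>)
    = (if j = i then h i \<omega> * (W b \<omega> - W a \<omega>) else 0)" if "j < n" for j
  proof -
    consider "j = i" | "Suc j \<le> i" | "Suc i \<le> j" by linarith
    then show ?thesis
    proof cases
      case 1
      have "s i \<le> b" "a \<le> s (Suc i)" using ab by auto
      then show ?thesis using 1 ab by (simp add: min_absorb1 min_absorb2 algebra_simps)
    next
      case 2 then have "s j \<le> s (Suc j)" "s (Suc j) \<le> s i" using partition_mono[OF simple, of "Suc j" i] i partition_step[OF simple that] by auto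
      then show ?thesis using 2 ab by (simp add: min_absorb2)
    next
      case 3 then have "s (Suc i) \<le> s j" "s j \<le> s (Suc j)" using partition_mono[OF simple, of "Suc i" j] that partition_step[OF simple that] by auto
      then show ?thesis using 3 ab by (simp add: min_absorb1)
    qed
  qed
  then have "simple_integral W n s h b \<omega> - simple_integral W n s h a \<omega> = (\<Sum>j<n. if j = i then h i \<omega> * (W b \<omega> - W a \<omega>) else 0)"
    unfolding simple_integral_def sum_subtractf[symmetric] by (intro sum.cong) auto
  then show ?thesis using i by simp
qed

lemma simple_integral_off_pieces:
  assumes "a \<le> b" "b \<le> s 0 \<or> s n \<le> a"
  shows "simple_integral W n s h b \<omega> = simple_integral W n s h a \<omega>"
  unfolding simple_integral_def
proof (intro sum.cong refl)
  fix i assume "i \<in> {..<n}"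
  then have "s 0 \<le> s i" "s i \<le> s (Suc i)" "s (Suc i) \<le> s n"
    using partition_mono[OF simple, of 0 i] partition_mono[OF simple, of "Suc i" n] partition_step[OF simple, of i] by auto
  then show "h i \<omega> * (W (min b (s (Suc i))) \<omega> - W (min b (s i)) \<omega>) = h i \<omega> * (W (min a (s (Suc i))) \<omega> - W (min a (s i)) \<omega>)"
    using assms by (auto simp: min_absorb1 min_absorb2)
qed

lemma simple_integral_adapted:
  assumes t: "0 \<le> t" shows "simple_integral W n s h t \<in> borel_measurable (F t)"
  unfolding simple_integral_def
proof (intro borel_measurable_sum)
  fix i assume "i \<in> {..<n}"
  then have i: "i < n" by simp
  show "(\<lambda>\<omega>. h i \<omega> * (W (min t (s (Suc i))) \<omega> - W (min t (s i)) \<omega>)) \<in> borel_measurable (F t)"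
  proof (cases "t \<le> s i")
    case True
    then show ?thesis using partition_step[OF simple i] by (simp add: min_absorb1)
  next
    case False
    then show ?thesis
      using partition_nonneg[OF simple, of i] partition_nonneg[OF simple, of "Suc i"] i t
      by (intro borel_measurable_times borel_measurable_diff measurable_F_mono[OF coeff_measurable[OF simple i]] measurable_F_mono[OF W_meas]) auto
  qed
qed

lemma simple_integral_continuous:
  assumes "\<omega> \<in> space M" shows "continuous_on {0..} (\<lambda>t. simple_integral W n s h t \<omega>)"
proof -
  have W: "continuous_on {0..} (\<lambda>t. W t \<omega>)" using bm assms by (simp add: brownian_motion_def)
  have "continuous_on {0..} (\<lambda>t. W (min t (s i)) \<omega>)" if "i \<le> n" for i
    using partition_nonneg[OF simple that] by (intro continuous_on_compose2[OF W] continuous_intros) auto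
  then show ?thesis unfolding simple_integral_def by (intro continuous_intros) auto
qed

end
end

text \<open>
  The part of the data of a stochastic differential that does not depend on the diffusion
  coefficient: the clock \<open>\<Theta>\<close> and the process \<open>A\<close> of bounded variation with drift \<open>\<beta>\<close>, to which
  stochastic integrals will be added.
\<close>

locale drift_setting = brownian_setting M F W
  for M :: "'a measure" and F :: "real \<Rightarrow> 'a measure" and W :: "real \<Rightarrow> 'a \<Rightarrow> real" +
  fixes T B :: real and \<Theta> A \<theta> \<beta> :: "real \<Rightarrow> 'a \<Rightarrow> real"
    and g gt gx gxx :: "real \<Rightarrow> real \<Rightarrow> real"
  assumes test: "test_function T g gt gx gxx"
    and T: "0 \<le> T" and B: "0 \<le> B"
    and \<Theta>_in: "\<And>r \<omega>. \<omega> \<in> space M \<Longrightarrow> \<Theta> r \<omega> \<in> {0..T}"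
    and adapted: "\<And>r. r \<in> {0..T} \<Longrightarrow> \<Theta> r \<in> borel_measurable (F r)" "\<And>r. r \<in> {0..T} \<Longrightarrow> A r \<in> borel_measurable (F r)"
    and joint: "(\<lambda>(r, \<omega>). \<Theta> r \<omega>) \<in> borel_measurable (borel \<Otimes>\<^sub>M M)" "(\<lambda>(r, \<omega>). A r \<omega>) \<in> borel_measurable (borel \<Otimes>\<^sub>M M)"
      "(\<lambda>(r, \<omega>). \<theta> r \<omega>) \<in> borel_measurable (borel \<Otimes>\<^sub>M M)" "(\<lambda>(r, \<omega>). \<beta> r \<omega>) \<in> borel_measurable (borel \<Otimes>\<^sub>M M)"
    and bounds: "\<And>r \<omega>. \<omega> \<in> space M \<Longrightarrow> \<bar>\<theta> r \<omega>\<bar> \<le> B" "\<And>r \<omega>. \<omega> \<in> space M \<Longrightarrow> \<bar>\<beta> r \<omega>\<bar> \<le> B"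
    and dynamics: "\<And>s t. 0 \<le> s \<Longrightarrow> s \<le> t \<Longrightarrow> t \<le> T \<Longrightarrow> AE \<omega> in M. \<Theta> t \<omega> - \<Theta> s \<omega> = (LINT r:{s..t}|lborel. \<theta> r \<omega>)"
      "\<And>s t. 0 \<le> s \<Longrightarrow> s \<le> t \<Longrightarrow> t \<le> T \<Longrightarrow> AE \<omega> in M. A t \<omega> - A s \<omega> = (LINT r:{s..t}|lborel. \<beta> r \<omega>)"
begin

definition drift :: "(real \<Rightarrow> 'a \<Rightarrow> real) \<Rightarrow> (real \<Rightarrow> 'a \<Rightarrow> real) \<Rightarrow> real \<Rightarrow> 'a \<Rightarrow> real" where
  "drift \<eta> Y r \<omega> = \<theta> r \<omega> * gt (\<Theta> r \<omega>) (Y r \<omega>) + \<beta> r \<omega> * gx (\<Theta> r \<omega>) (Y r \<omega>) + 1/2 * (\<eta> r \<omega>)\<^sup>2 * gxx (\<Theta> r \<omega>) (Y r \<omega>)"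

lemma along_joint:
  assumes "G \<in> {g, gt, gx, gxx}" and Y: "(\<lambda>(r, \<omega>). Y r \<omega>) \<in> borel_measurable (borel \<Otimes>\<^sub>M M)"
  shows "(\<lambda>(r, \<omega>). G (\<Theta> r \<omega>) (Y r \<omega>)) \<in> borel_measurable (borel \<Otimes>\<^sub>M M)"
  unfolding case_prod_unfold
  by (rule measurable_clamped_compose[OF test_function_continuous[OF test assms(1)] joint(1)[unfolded case_prod_unfold] Y[unfolded case_prod_unfold]])
    (auto intro!: \<Theta>_in simp: space_pair_measure simp del: atLeastAtMost_iff)

lemma drift_joint:
  assumes Y: "(\<lambda>(r, \<omega>). Y r \<omega>) \<in> borel_measurable (borel \<Otimes>\<^sub>M M)" and \<eta>: "(\<lambda>(r, \<omega>). \<eta> r \<omega>) \<in> borel_measurable (borel \<Otimes>\<^sub>M M)"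
  shows "(\<lambda>(r, \<omega>). drift \<eta> Y r \<omega>) \<in> borel_measurable (borel \<Otimes>\<^sub>M M)"
  unfolding drift_def using joint(3,4) \<eta> along_joint[of gt, OF _ Y] along_joint[of gx, OF _ Y] along_joint[of gxx, OF _ Y]
  by (simp add: case_prod_unfold)

lemma drift_integrable:
  assumes Y: "(\<lambda>(r, \<omega>). Y r \<omega>) \<in> borel_measurable (borel \<Otimes>\<^sub>M M)" and \<eta>: "(\<lambda>(r, \<omega>). \<eta> r \<omega>) \<in> borel_measurable (borel \<Otimes>\<^sub>M M)"
    and b: "\<And>r \<omega>. \<omega> \<in> space M \<Longrightarrow> \<bar>\<eta> r \<omega>\<bar> \<le> B"
  shows "set_integrable lborel {p..q} (\<lambda>r. expectation (drift \<eta> Y r))" and "integrable M (drift \<eta> Y r)"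
proof -
  obtain L where "0 \<le> L" and "\<forall>r\<in>{0..T}. \<forall>x. \<bar>g r x\<bar> \<le> L \<and> \<bar>gt r x\<bar> \<le> L \<and> \<bar>gx r x\<bar> \<le> L \<and> \<bar>gxx r x\<bar> \<le> L"
    using test_function_bound[OF test] by blast
  then have L: "0 \<le> L" "\<And>r x. r \<in> {0..T} \<Longrightarrow> \<bar>gt r x\<bar> \<le> L"
    "\<And>r x. r \<in> {0..T} \<Longrightarrow> \<bar>gx r x\<bar> \<le> L" "\<And>r x. r \<in> {0..T} \<Longrightarrow> \<bar>gxx r x\<bar> \<le> L"
    by blast+
  have bd: "\<bar>drift \<eta> Y r \<omega>\<bar> \<le> B * L + B * L + 1/2 * B\<^sup>2 * L" if \<omega>: "\<omega> \<in> space M" for r \<omega>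
  proof -
    have "(\<eta> r \<omega>)\<^sup>2 \<le> B\<^sup>2" using power_mono[OF b[OF \<omega>], of r 2] by simp
    then have "\<bar>\<theta> r \<omega> * gt (\<Theta> r \<omega>) (Y r \<omega>)\<bar> \<le> B * L" "\<bar>\<beta> r \<omega> * gx (\<Theta> r \<omega>) (Y r \<omega>)\<bar> \<le> B * L"
      "\<bar>1/2 * (\<eta> r \<omega>)\<^sup>2 * gxx (\<Theta> r \<omega>) (Y r \<omega>)\<bar> \<le> 1/2 * B\<^sup>2 * L"
      unfolding abs_mult using bounds \<omega> L \<Theta>_in[OF \<omega>] B by (auto intro!: mult_mono simp del: atLeastAtMost_iff)
    then show ?thesis unfolding drift_def by linarith
  qed
  show "set_integrable lborel {p..q} (\<lambda>r. expectation (drift \<eta> Y r))"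
    by (rule fubini_bounded(1)[OF drift_joint[OF Y \<eta>] bd])
  show "integrable M (drift \<eta> Y r)"
    using bd measurable_Pair2[OF drift_joint[OF Y \<eta>], of r] by (intro integrable_const_bound[where B="B * L + B * L + 1/2 * B\<^sup>2 * L"]) auto
qed

text \<open>
  On each piece of the partition the integrand is frozen, and outside of all pieces it vanishes.
\<close>

lemma ito_simple:
  assumes simple: "simple_integrand F n s h" and hB: "\<And>i \<omega>. i < n \<Longrightarrow> \<omega> \<in> space M \<Longrightarrow> \<bar>h i \<omega>\<bar> \<le> B"
  defines "Y \<equiv> \<lambda>r \<omega>. A r \<omega> + simple_integral W n s h (max 0 r) \<omega>"
  shows "expectation (\<lambda>\<omega>. g (\<Theta> T \<omega>) (Y T \<omega>)) - expectation (\<lambda>\<omega>. g (\<Theta> 0 \<omega>) (Y 0 \<omega>)) =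
     (LINT r:{0..T}|lborel. expectation (drift (simple_process n s h) Y r))"
proof -
  note hM = measurable_F_M[OF coeff_measurable[OF simple]]
  have Sj: "(\<lambda>(r, \<omega>). simple_integral W n s h (max 0 r) \<omega>) \<in> borel_measurable (borel \<Otimes>\<^sub>M M)"
    by (rule continuous_process_measurable)
      (use simple_integral_adapted[OF simple] simple_integral_continuous[OF simple] measurable_F_M in blast)+
  have Yj: "(\<lambda>(r, \<omega>). Y r \<omega>) \<in> borel_measurable (borel \<Otimes>\<^sub>M M)"
    unfolding Y_def using Sj joint(2) by (simp add: case_prod_unfold)
  have pj: "(\<lambda>(r, \<omega>). simple_process n s h r \<omega>) \<in> borel_measurable (borel \<Otimes>\<^sub>M M)"
    using hM by (rule simple_process_jointly_measurable[OF simple])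
  have pB: "\<bar>simple_process n s h r \<omega>\<bar> \<le> B" if "\<omega> \<in> space M" for r \<omega>
    by (rule simple_process_cases[OF simple, of r \<omega>]) (use hB that B in auto)
  note di = drift_integrable(1)[OF Yj pj pB]
  define E where "E t = expectation (\<lambda>\<omega>. g (\<Theta> t \<omega>) (Y t \<omega>))" for t
  have piece: "E q - E p = (LINT r:{p..q}|lborel. expectation (drift (simple_process n s h) Y r))"
    if pq: "0 \<le> p" "p \<le> q" "q \<le> T" and \<eta>: "\<eta> \<in> borel_measurable (F p)" "\<And>\<omega>. \<omega> \<in> space M \<Longrightarrow> \<bar>\<eta> \<omega>\<bar> \<le> B"
      and SI: "\<And>a b \<omega>. p \<le> a \<Longrightarrow> a \<le> b \<Longrightarrow> b \<le> q \<Longrightarrow> simple_integral W n s h b \<omega> - simple_integral W n s h a \<omega> = \<eta> \<omega> * (W b \<omega> - W a \<omega>)"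
      and SP: "\<And>r \<omega>. p < r \<Longrightarrow> r \<le> q \<Longrightarrow> simple_process n s h r \<omega> = \<eta> \<omega>"
    for p q \<eta>
  proof -
    interpret P: ito_piece M F W T p q B \<Theta> Y \<theta> \<beta> \<eta> g gt gx gxx
    proof unfold_locales
      fix r assume r: "r \<in> {p..q}"
      then have "A r \<in> borel_measurable (F r)" "simple_integral W n s h (max 0 r) \<in> borel_measurable (F r)"
        using adapted(2)[of r] simple_integral_adapted[OF simple, of r] pq by (auto simp: max_absorb2)
      then show "Y r \<in> borel_measurable (F r)" unfolding Y_def by simp
    next
      fix a b assume ab: "p \<le> a" "a \<le> b" "b \<le> q"
      have dyn: "AE \<omega> in M. A b \<omega> - A a \<omega> = (LINT r:{a..b}|lborel. \<beta> r \<omega>)"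
        using dynamics(2)[of a b] ab pq by auto
      show "AE \<omega> in M. Y b \<omega> - Y a \<omega> = (LINT r:{a..b}|lborel. \<beta> r \<omega>) + \<eta> \<omega> * (W b \<omega> - W a \<omega>)"
        using dyn
      proof eventually_elim
        case (elim \<omega>)
        then show ?case using SI[OF ab, of \<omega>] ab pq by (simp add: Y_def max_absorb2)
      qed
    qed (use test pq B \<Theta>_in adapted joint bounds \<eta> dynamics Yj in auto)
    have "E q - E p = (LINT r:{p..q}|lborel. P.mean_drift r)" unfolding E_def by (rule P.ito_interval)
    also have "\<dots> = (LINT r:{p..q}|lborel. expectation (drift (simple_process n s h) Y r))"
      using P.mean_drift_integrable di
    proof (rule set_integral_cong_except_left)
      fix r assume "p < r" "r \<le> q"
      then show "P.mean_drift r = expectation (drift (simple_process n s h) Y r)"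
        unfolding P.mean_drift_def drift_def using SP by simp
    qed
    finally show ?thesis .
  qed
  have upto: "E (min T (s i)) - E 0 = (LINT r:{0..min T (s i)}|lborel. expectation (drift (simple_process n s h) Y r))" if "i \<le> n" for i
    using that
  proof (induction i)
    case 0
    show ?case
      using partition_nonneg[OF simple, of 0] T B
      by (intro piece[of _ _ "\<lambda>_. 0"]) (auto simp: simple_integral_off_pieces[OF simple] simple_process_off_pieces[OF simple])
  next
    case (Suc i)
    then have i: "i < n" and IH: "E (min T (s i)) - E 0 = (LINT r:{0..min T (s i)}|lborel. expectation (drift (simple_process n s h) Y r))" by auto
    have le: "s i \<le> s (Suc i)" by (rule partition_step[OF simple i])
    show ?case
    proof (cases "T \<le> s i")
      case True then show ?thesis using IH le by (simp add: min_absorb1)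
    next
      case False
      have "E (min T (s (Suc i))) - E (s i) = (LINT r:{s i..min T (s (Suc i))}|lborel. expectation (drift (simple_process n s h) Y r))"
        using i le False partition_nonneg[OF simple, of i] coeff_measurable[OF simple i] hB[OF i]
        by (intro piece[of _ _ "h i"]) (auto simp: simple_integral_on_piece[OF simple i] simple_process_on_piece[OF simple i])
      then show ?thesis
        using IH False le partition_nonneg[OF simple, of i] i set_integral_split[OF di, of 0 "s i" "min T (s (Suc i))"] by (simp add: min_absorb2)
    qed
  qed
  show ?thesis
  proof (cases "T \<le> s n")
    case True then show ?thesis using upto[of n] by (simp add: min_absorb1 E_def)
  next
    case False
    have "E T - E (s n) = (LINT r:{s n..T}|lborel. expectation (drift (simple_process n s h) Y r))"
      using False partition_nonneg[OF simple, of n] B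
      by (intro piece[of _ _ "\<lambda>_. 0"]) (auto simp: simple_integral_off_pieces[OF simple] simple_process_off_pieces[OF simple])
    then show ?thesis
      using upto[of n] False partition_nonneg[OF simple, of n] set_integral_split[OF di, of 0 "s n" T] by (simp add: min_absorb2 E_def)
  qed
qed

end

section \<open>Ito's formula in expectation for bounded integrands\<close>

text \<open>
  Clamping is the projection to an interval that contains \<open>y\<close>.
\<close>

lemma clamp_closer:
  fixes v y B :: real
  assumes "\<bar>y\<bar> \<le> B"
  shows "(max (-B) (min B v) - y)\<^sup>2 \<le> (v - y)\<^sup>2" "(v - max (-B) (min B v))\<^sup>2 \<le> (v - y)\<^sup>2"
  using assms by (auto simp: abs_le_square_iff[symmetric] max_def min_def)

lemma set_integral_le_nn_integral:
  fixes f z :: "real \<Rightarrow> real"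
  assumes f: "set_integrable lborel {0..t} f" "\<And>r. 0 \<le> f r" and t: "t \<le> T"
    and le: "\<And>r. 0 < r \<Longrightarrow> r \<le> t \<Longrightarrow> f r \<le> z r"
  shows "ennreal (LINT r:{0..t}|lborel. f r) \<le> (\<integral>\<^sup>+r\<in>{0..T}. ennreal (z r) \<partial>lborel)"
proof -
  have "ennreal (LINT r:{0..t}|lborel. f r) = (\<integral>\<^sup>+r. ennreal (indicator {0..t} r *\<^sub>R f r) \<partial>lborel)"
    using f unfolding set_lebesgue_integral_def set_integrable_def
    by (intro nn_integral_eq_integral[symmetric]) auto
  also have "\<dots> \<le> (\<integral>\<^sup>+r\<in>{0..T}. ennreal (z r) \<partial>lborel)"
  proof (rule nn_integral_mono_AE)
    show "AE r in lborel. ennreal (indicator {0..t} r *\<^sub>R f r) \<le> ennreal (z r) * indicator {0..T} r"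
      using AE_lborel_singleton[of 0] by eventually_elim (use le t in \<open>auto simp: indicator_def intro!: ennreal_leI\<close>)
  qed
  finally show ?thesis .
qed

lemma (in prob_space) affine_indicator:
  fixes a b :: real
  assumes "E \<in> events"
  shows "integrable M (\<lambda>\<omega>. a + b * indicator E \<omega>)" "expectation (\<lambda>\<omega>. a + b * indicator E \<omega>) = a + b * prob E"
proof -
  have i: "integrable M (\<lambda>\<omega>. b * indicator E \<omega>)"
    using assms by (intro integrable_mult_right integrable_real_indicator) (auto simp: emeasure_eq_measure)
  then show "integrable M (\<lambda>\<omega>. a + b * indicator E \<omega>)" by (intro Bochner_Integration.integrable_add integrable_const)
  show "expectation (\<lambda>\<omega>. a + b * indicator E \<omega>) = a + b * prob E"
    using assms by (subst Bochner_Integration.integral_add[OF integrable_const i]) (simp add: prob_space)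
qed

context drift_setting begin

text \<open>
  Ito's formula in expectation for integrals of bounded integrands. The definition of the integral
  provides simple integrands that converge to \<open>H\<close> only in probability, and nothing bounds their
  coefficients. The clamped coefficients are bounded by \<open>B\<close> and, as \<open>H\<close> itself takes values in
  \<open>{-B..B}\<close>, no further from \<open>H\<close> than the original ones. The part that is cut off is small in
  \<open>L\<^sup>2\<close> in probability, hence by \<open>simple_integral_tail\<close> its integral is small in probability. So
  the formula for simple integrands applies to the clamped ones with uniform bounds, and passes to
  the limit because all functions involved are bounded. The integrand \<open>H'\<close> is a version of \<open>H\<close>
  that is bounded everywhere, and agrees with \<open>H\<close> on \<open>{0<..T}\<close> almost surely.
\<close>

lemma ito_bounded_integrand:
  assumes ito: "is_ito_integral M F W H I"
    and H'j: "(\<lambda>(r, \<omega>). H' r \<omega>) \<in> borel_measurable (borel \<Otimes>\<^sub>M M)"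
    and H'B: "\<And>r \<omega>. \<omega> \<in> space M \<Longrightarrow> \<bar>H' r \<omega>\<bar> \<le> B"
    and HH': "AE \<omega> in M. \<forall>r. 0 < r \<longrightarrow> r \<le> T \<longrightarrow> H r \<omega> = H' r \<omega>"
  defines "Y \<equiv> \<lambda>r \<omega>. A r \<omega> + I (max 0 r) \<omega>"
  shows "expectation (\<lambda>\<omega>. g (\<Theta> T \<omega>) (Y T \<omega>)) - expectation (\<lambda>\<omega>. g (\<Theta> 0 \<omega>) (Y 0 \<omega>)) =
     (LINT r:{0..T}|lborel. expectation (drift H' Y r))"
proof -
  from ito have Ia: "\<And>t. 0 \<le> t \<Longrightarrow> I t \<in> borel_measurable (F t)" and Ic: "\<And>\<omega>. \<omega> \<in> space M \<Longrightarrow> continuous_on {0..} (\<lambda>t. I t \<omega>)"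
    unfolding is_ito_integral_def adapted_process_def by auto
  from ito obtain n s h where simple: "\<And>k. simple_integrand F (n k) (s k) (h k)"
    and lim: "\<And>T'. 0 \<le> T' \<Longrightarrow> null_in_probability M (\<lambda>k \<omega>. \<integral>\<^sup>+t\<in>{0..T'}. ennreal ((simple_process (n k) (s k) (h k) t \<omega> - H t \<omega>)\<^sup>2) \<partial>lborel)"
      "\<And>T'. 0 \<le> T' \<Longrightarrow> null_in_probability M (\<lambda>k \<omega>. SUP t\<in>{0..T'}. ennreal \<bar>simple_integral W (n k) (s k) (h k) t \<omega> - I t \<omega>\<bar>)"
    unfolding is_ito_integral_def by blast
  define Z where "Z k \<omega> = (\<integral>\<^sup>+t\<in>{0..T}. ennreal ((simple_process (n k) (s k) (h k) t \<omega> - H t \<omega>)\<^sup>2) \<partial>lborel)" for k \<omega>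
  define U where "U k \<omega> = (SUP t\<in>{0..T}. ennreal \<bar>simple_integral W (n k) (s k) (h k) t \<omega> - I t \<omega>\<bar>)" for k \<omega>
  have Zm [measurable]: "Z k \<in> borel_measurable M" and Zlim: "0 < \<epsilon> \<Longrightarrow> (\<lambda>k. prob {\<omega>\<in>space M. ennreal \<epsilon> < Z k \<omega>}) \<longlonglongrightarrow> 0"
    and Um [measurable]: "U k \<in> borel_measurable M" and Ulim: "0 < \<epsilon> \<Longrightarrow> (\<lambda>k. prob {\<omega>\<in>space M. ennreal \<epsilon> < U k \<omega>}) \<longlonglongrightarrow> 0" for k \<epsilon>
    using lim[OF T] unfolding Z_def[symmetric] U_def[symmetric] null_in_probability_def by auto

  (* truncating the approximating coefficients to the range of H' only improves them *)
  define c where "c k i \<omega> = max (-B) (min B (h k i \<omega>))" for k i \<omega>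
  define d where "d k i \<omega> = h k i \<omega> - c k i \<omega>" for k i \<omega>
  have cB: "\<bar>c k i \<omega>\<bar> \<le> B" for k i \<omega> using B by (auto simp: c_def)
  have csimple: "simple_integrand F (n k) (s k) (c k)" for k
    unfolding simple_integrand_def
  proof (intro conjI allI impI)
    fix i assume i: "i < n k"
    show "c k i \<in> borel_measurable (F (s k i))" unfolding c_def using coeff_measurable[OF simple i] by simp
    show "\<exists>C. \<forall>\<omega>\<in>space (F (s k i)). \<bar>c k i \<omega>\<bar> \<le> C" using cB by blast
  qed (use simple[of k] in \<open>auto simp: simple_integrand_def\<close>)
  have dsimple: "simple_integrand F (n k) (s k) (d k)" for k
    unfolding simple_integrand_def
  proof (intro conjI allI impI)
    fix i assume i: "i < n k"
    show "d k i \<in> borel_measurable (F (s k i))"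
      unfolding d_def using coeff_measurable[OF simple i] coeff_measurable[OF csimple i] by simp
    obtain C where C: "\<forall>\<omega>\<in>space (F (s k i)). \<bar>h k i \<omega>\<bar> \<le> C" using simple[of k] i by (auto simp: simple_integrand_def)
    have "\<bar>d k i \<omega>\<bar> \<le> C + B" if "\<omega> \<in> space (F (s k i))" for \<omega>
    proof -
      have "\<bar>h k i \<omega>\<bar> \<le> C" using C that by blast
      then show ?thesis using cB[of k i \<omega>] unfolding d_def by linarith
    qed
    then show "\<exists>C. \<forall>\<omega>\<in>space (F (s k i)). \<bar>d k i \<omega>\<bar> \<le> C" by blast
  qed (use simple[of k] in \<open>auto simp: simple_integrand_def\<close>)
  note cM = measurable_F_M[OF coeff_measurable[OF csimple]] and dM = measurable_F_M[OF coeff_measurable[OF dsimple]]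
  define P where "P k = simple_process (n k) (s k) (c k)" for k
  define S where "S k = simple_integral W (n k) (s k) (c k)" for k
  have Pj: "(\<lambda>(r, \<omega>). P k r \<omega>) \<in> borel_measurable (borel \<Otimes>\<^sub>M M)" for k
    unfolding P_def using cM by (rule simple_process_jointly_measurable[OF simple])
  have PB: "\<bar>P k r \<omega>\<bar> \<le> B" for k r \<omega>
    unfolding P_def by (rule simple_process_cases[OF simple[of k], of r \<omega>]) (use cB B in auto)
  have closer: "(P k r \<omega> - H' r \<omega>)\<^sup>2 \<le> (simple_process (n k) (s k) (h k) r \<omega> - H' r \<omega>)\<^sup>2"
    "simple_process (n k) (s k) (\<lambda>i \<omega>. (d k i \<omega>)\<^sup>2) r \<omega> \<le> (simple_process (n k) (s k) (h k) r \<omega> - H' r \<omega>)\<^sup>2"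
    "0 \<le> simple_process (n k) (s k) (\<lambda>i \<omega>. (d k i \<omega>)\<^sup>2) r \<omega>"
    if "\<omega> \<in> space M" for k r \<omega>
  proof -
    have "(P k r \<omega> - H' r \<omega>)\<^sup>2 \<le> (simple_process (n k) (s k) (h k) r \<omega> - H' r \<omega>)\<^sup>2 \<and>
      simple_process (n k) (s k) (\<lambda>i \<omega>. (d k i \<omega>)\<^sup>2) r \<omega> \<le> (simple_process (n k) (s k) (h k) r \<omega> - H' r \<omega>)\<^sup>2 \<and>
      0 \<le> simple_process (n k) (s k) (\<lambda>i \<omega>. (d k i \<omega>)\<^sup>2) r \<omega>"
    proof (rule simple_process_cases[OF simple[of k], of r \<omega>])
      fix i assume eq: "\<And>f. simple_process (n k) (s k) f r \<omega> = f i \<omega>"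
      show ?thesis unfolding P_def eq unfolding d_def c_def using clamp_closer[OF H'B[OF that]] by auto
    next
      assume eq: "\<And>f. simple_process (n k) (s k) f r \<omega> = 0"
      show ?thesis unfolding P_def eq by simp
    qed
    then show "(P k r \<omega> - H' r \<omega>)\<^sup>2 \<le> (simple_process (n k) (s k) (h k) r \<omega> - H' r \<omega>)\<^sup>2"
    "simple_process (n k) (s k) (\<lambda>i \<omega>. (d k i \<omega>)\<^sup>2) r \<omega> \<le> (simple_process (n k) (s k) (h k) r \<omega> - H' r \<omega>)\<^sup>2"
    "0 \<le> simple_process (n k) (s k) (\<lambda>i \<omega>. (d k i \<omega>)\<^sup>2) r \<omega>" by auto
  qed
  have Qle: "AE \<omega> in M. ennreal (\<Sum>i<n k. (d k i \<omega>)\<^sup>2 * (min t (s k (Suc i)) - min t (s k i))) \<le> Z k \<omega>"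
    if t: "t \<in> {0..T}" for k t
    using HH' AE_space
  proof eventually_elim
    case (elim \<omega>)
    have t0: "0 \<le> t" using t by simp
    show ?case
      unfolding integral_simple_process(2)[OF simple t0, of k "\<lambda>i \<omega>. (d k i \<omega>)\<^sup>2" \<omega>, symmetric] Z_def
      using elim closer[OF elim(2)] t
      by (intro set_integral_le_nn_integral integral_simple_process(1)[OF simple t0]) auto
  qed
  (* Convergence in probability of a bounded quantity gives convergence of the mean square
     error J. *)
  define Dj where "Dj k r \<omega> = (P k r \<omega> - H' r \<omega>)\<^sup>2" for k r \<omega>
  have Djj: "(\<lambda>(r, \<omega>). Dj k r \<omega>) \<in> borel_measurable (borel \<Otimes>\<^sub>M M)" for k
    unfolding Dj_def using Pj[of k] H'j by (simp add: case_prod_unfold)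
  have DjB: "\<bar>Dj k r \<omega>\<bar> \<le> 4 * B\<^sup>2" if "\<omega> \<in> space M" for k r \<omega>
  proof -
    have "\<bar>P k r \<omega> - H' r \<omega>\<bar> \<le> 2 * B" using PB[of k r \<omega>] H'B[OF that, of r] by linarith
    then have "\<bar>P k r \<omega> - H' r \<omega>\<bar>\<^sup>2 \<le> (2 * B)\<^sup>2" by (intro power_mono) auto
    then show ?thesis by (simp add: Dj_def)
  qed
  have Dj_path: "set_integrable lborel {0..T} (\<lambda>r. Dj k r \<omega>)" if \<omega>: "\<omega> \<in> space M" for k \<omega>
  proof -
    have "(\<lambda>r. Dj k r \<omega>) \<in> borel_measurable borel" using measurable_Pair1[OF Djj \<omega>] by simp
    then show ?thesis using DjB[OF \<omega>] unfolding set_integrable_def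
      by (intro integrableI_bounded_set_indicator[where B="4 * B\<^sup>2"]) (auto simp: emeasure_lborel_Icc_eq)
  qed
  define J where "J k = (LINT r:{0..T}|lborel. expectation (Dj k r))" for k
  have Jfub: "set_integrable lborel {0..T} (\<lambda>r. expectation (Dj k r))"
    "integrable M (\<lambda>\<omega>. LINT r:{0..T}|lborel. Dj k r \<omega>)"
    "J k = expectation (\<lambda>\<omega>. LINT r:{0..T}|lborel. Dj k r \<omega>)" for k
    unfolding J_def by (rule fubini_bounded[OF Djj DjB], assumption)+
  have Jsmall: "\<forall>\<^sub>F k in sequentially. J k \<le> \<kappa>" if \<kappa>: "0 < \<kappa>" for \<kappa>
  proof -
    define m where "m = 4 * B\<^sup>2 * T"
    have m: "0 \<le> m" using T by (simp add: m_def)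
    have "\<forall>\<^sub>F k in sequentially. prob {\<omega>\<in>space M. ennreal (\<kappa>/2) < Z k \<omega>} < \<kappa> / (2 * (m + 1))"
      using \<kappa> m by (intro order_tendstoD(2)[OF Zlim]) auto
    then show ?thesis
    proof eventually_elim
      case (elim k)
      define E where "E = {\<omega>\<in>space M. ennreal (\<kappa>/2) < Z k \<omega>}"
      have E: "E \<in> events" unfolding E_def by measurable
      have "expectation (\<lambda>\<omega>. LINT r:{0..T}|lborel. Dj k r \<omega>) \<le> expectation (\<lambda>\<omega>. \<kappa>/2 + m * indicator E \<omega>)"
      proof (rule integral_mono_AE[OF Jfub(2)])
        show "integrable M (\<lambda>\<omega>. \<kappa>/2 + m * indicator E \<omega>)"
          by (rule affine_indicator(1)[OF E])
        show "AE \<omega> in M. (LINT r:{0..T}|lborel. Dj k r \<omega>) \<le> \<kappa>/2 + m * indicator E \<omega>"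
          using HH' AE_space
        proof eventually_elim
          case (elim \<omega>)
          have a: "(LINT r:{0..T}|lborel. Dj k r \<omega>) \<le> m"
            using abs_set_integral_le[OF T, of "\<lambda>r. Dj k r \<omega>" "4 * B\<^sup>2"] DjB[OF elim(2)] by (simp add: m_def)
          have "ennreal (LINT r:{0..T}|lborel. Dj k r \<omega>) \<le> Z k \<omega>"
            unfolding Z_def using elim closer(1)[OF elim(2)] Dj_path[OF elim(2)]
            by (intro set_integral_le_nn_integral) (auto simp: Dj_def)
          then have "(LINT r:{0..T}|lborel. Dj k r \<omega>) \<le> \<kappa>/2" if "Z k \<omega> \<le> ennreal (\<kappa>/2)"
            using that \<kappa> by (metis order_trans ennreal_le_iff half_gt_zero less_imp_le)
          then show ?case using a elim(2) \<kappa> m by (auto simp: indicator_def not_less E_def)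
        qed
      qed
      also have "\<dots> = \<kappa>/2 + m * prob E" by (rule affine_indicator(2)[OF E])
      also have "\<dots> \<le> \<kappa>/2 + m * (\<kappa> / (2 * (m + 1)))" using elim m unfolding E_def by (intro add_left_mono mult_left_mono) auto
      also have "\<dots> \<le> \<kappa>" using m \<kappa> by (simp add: field_simps)
      finally show ?case using Jfub(3) by simp
    qed
  qed

  (* convergence in probability, uniform in time, of the truncated integrals *)
  have Sm: "S k r \<in> borel_measurable M" if "0 \<le> r" for k r
    unfolding S_def using simple_integral_adapted[OF csimple that] measurable_F_M by blast
  have Im: "I r \<in> borel_measurable M" if "0 \<le> r" for r using Ia[OF that] measurable_F_M by blast
  have tail: "prob {\<omega>\<in>space M. 2 * \<epsilon> < \<bar>S k r \<omega> - I r \<omega>\<bar>} \<le> prob {\<omega>\<in>space M. ennreal \<epsilon> < U k \<omega>} + (\<delta> / \<epsilon>\<^sup>2 + prob {\<omega>\<in>space M. ennreal \<delta> < Z k \<omega>})"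
    if r: "r \<in> {0..T}" and \<epsilon>: "0 < \<epsilon>" and \<delta>: "0 < \<delta>" for k r \<epsilon> \<delta>
  proof -
    have r0: "0 \<le> r" using r by simp
    define St where "St = simple_integral W (n k) (s k) (h k) r"
    define Sd where "Sd = simple_integral W (n k) (s k) (d k) r"
    have Sd: "Sd \<omega> = St \<omega> - S k r \<omega>" for \<omega>
      by (simp add: Sd_def St_def S_def simple_integral_def d_def left_diff_distrib sum_subtractf)
    have [measurable]: "Sd \<in> borel_measurable M"
      unfolding Sd_def using simple_integral_adapted[OF dsimple r0] measurable_F_M by blast
    have dQ [measurable]: "(\<lambda>\<omega>. \<Sum>i<n k. (d k i \<omega>)\<^sup>2 * (min r (s k (Suc i)) - min r (s k i))) \<in> borel_measurable M"
      using dM by (intro borel_measurable_sum borel_measurable_times borel_measurable_power) auto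
    have "prob {\<omega>\<in>space M. 2 * \<epsilon> < \<bar>S k r \<omega> - I r \<omega>\<bar>} \<le> prob ({\<omega>\<in>space M. ennreal \<epsilon> < U k \<omega>} \<union> {\<omega>\<in>space M. \<epsilon> < \<bar>Sd \<omega>\<bar>})"
    proof (rule finite_measure_mono)
      show "{\<omega>\<in>space M. 2 * \<epsilon> < \<bar>S k r \<omega> - I r \<omega>\<bar>} \<subseteq> {\<omega>\<in>space M. ennreal \<epsilon> < U k \<omega>} \<union> {\<omega>\<in>space M. \<epsilon> < \<bar>Sd \<omega>\<bar>}"
      proof safe
        fix \<omega> assume \<omega>: "\<omega> \<in> space M" "2 * \<epsilon> < \<bar>S k r \<omega> - I r \<omega>\<bar>" "\<not> \<epsilon> < \<bar>Sd \<omega>\<bar>"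
        then have "\<epsilon> < \<bar>St \<omega> - I r \<omega>\<bar>" using Sd[of \<omega>] by linarith
        then have "ennreal \<epsilon> < ennreal \<bar>St \<omega> - I r \<omega>\<bar>" using \<epsilon> by (simp add: ennreal_less_iff)
        also have "\<dots> \<le> U k \<omega>" unfolding U_def St_def using r by (intro SUP_upper)
        finally show "ennreal \<epsilon> < U k \<omega>" .
      qed
    qed measurable
    also have "\<dots> \<le> prob {\<omega>\<in>space M. ennreal \<epsilon> < U k \<omega>} + prob {\<omega>\<in>space M. \<epsilon> < \<bar>Sd \<omega>\<bar>}"
      by (rule measure_Un_le) measurable
    also have "prob {\<omega>\<in>space M. \<epsilon> < \<bar>Sd \<omega>\<bar>} \<le> \<delta> / \<epsilon>\<^sup>2 + prob {\<omega>\<in>space M. \<delta> < (\<Sum>i<n k. (d k i \<omega>)\<^sup>2 * (min r (s k (Suc i)) - min r (s k i)))}"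
      unfolding Sd_def by (rule simple_integral_tail[OF dsimple r0 \<epsilon> \<delta>])
    also have "prob {\<omega>\<in>space M. \<delta> < (\<Sum>i<n k. (d k i \<omega>)\<^sup>2 * (min r (s k (Suc i)) - min r (s k i)))} \<le> prob {\<omega>\<in>space M. ennreal \<delta> < Z k \<omega>}"
    proof (rule finite_measure_mono_AE)
      show "AE \<omega> in M. \<omega> \<in> {\<omega>\<in>space M. \<delta> < (\<Sum>i<n k. (d k i \<omega>)\<^sup>2 * (min r (s k (Suc i)) - min r (s k i)))} \<longrightarrow> \<omega> \<in> {\<omega>\<in>space M. ennreal \<delta> < Z k \<omega>}"
        using Qle[OF r, of k]
      proof eventually_elim
        case (elim \<omega>)
        show ?case
        proof safe
          assume "\<delta> < (\<Sum>i<n k. (d k i \<omega>)\<^sup>2 * (min r (s k (Suc i)) - min r (s k i)))"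
          then have "ennreal \<delta> < ennreal (\<Sum>i<n k. (d k i \<omega>)\<^sup>2 * (min r (s k (Suc i)) - min r (s k i)))"
            using \<delta> by (simp add: ennreal_less_iff)
          then show "ennreal \<delta> < Z k \<omega>" using elim by (rule less_le_trans)
        qed
      qed
    qed measurable
    finally show ?thesis by simp
  qed
  have conv: "\<forall>\<^sub>F k in sequentially. \<forall>r\<in>{0..T}. prob {\<omega>\<in>space M. \<epsilon> < \<bar>S k r \<omega> - I r \<omega>\<bar>} \<le> \<kappa>"
    if \<epsilon>: "0 < \<epsilon>" and \<kappa>: "0 < \<kappa>" for \<epsilon> \<kappa>
  proof -
    define \<delta> where "\<delta> = \<kappa> / 3 * (\<epsilon> / 2)\<^sup>2"
    have \<delta>: "0 < \<delta>" using \<epsilon> \<kappa> by (simp add: \<delta>_def)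
    have "\<forall>\<^sub>F k in sequentially. prob {\<omega>\<in>space M. ennreal (\<epsilon>/2) < U k \<omega>} < \<kappa> / 3"
      "\<forall>\<^sub>F k in sequentially. prob {\<omega>\<in>space M. ennreal \<delta> < Z k \<omega>} < \<kappa> / 3"
      using \<epsilon> \<kappa> \<delta> by - (rule order_tendstoD(2)[OF Ulim], simp, simp, rule order_tendstoD(2)[OF Zlim], simp, simp)
    then show ?thesis
    proof eventually_elim
      case (elim k)
      have "\<delta> / (\<epsilon> / 2)\<^sup>2 = \<kappa> / 3" using \<epsilon> by (simp add: \<delta>_def)
      then show ?case using tail[of _ "\<epsilon>/2" \<delta> k] \<epsilon> \<delta> elim by fastforce
    qed
  qed

  define Yk where "Yk k r \<omega> = A r \<omega> + S k (max 0 r) \<omega>" for k r \<omega>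
  have Yj: "(\<lambda>(r, \<omega>). Y r \<omega>) \<in> borel_measurable (borel \<Otimes>\<^sub>M M)"
    unfolding Y_def using continuous_process_measurable[OF Im Ic] joint(2) by (simp add: case_prod_unfold)
  have Ykj: "(\<lambda>(r, \<omega>). Yk k r \<omega>) \<in> borel_measurable (borel \<Otimes>\<^sub>M M)" for k
  proof -
    have "(\<lambda>(r, \<omega>). S k (max 0 r) \<omega>) \<in> borel_measurable (borel \<Otimes>\<^sub>M M)"
      by (rule continuous_process_measurable[OF Sm]) (auto simp: S_def intro: simple_integral_continuous[OF csimple])
    then show ?thesis unfolding Yk_def using joint(2) by (simp add: case_prod_unfold)
  qed
  have fixed: "f r \<in> borel_measurable M" if "(\<lambda>(r, \<omega>). f r \<omega>) \<in> borel_measurable (borel \<Otimes>\<^sub>M M)" for f :: "real \<Rightarrow> 'a \<Rightarrow> real" and r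
    using measurable_Pair2[OF that, of r] by simp

  obtain L where L0: "0 \<le> L" and L': "\<forall>r\<in>{0..T}. \<forall>x. \<bar>g r x\<bar> \<le> L \<and> \<bar>gt r x\<bar> \<le> L \<and> \<bar>gx r x\<bar> \<le> L \<and> \<bar>gxx r x\<bar> \<le> L"
    using test_function_bound[OF test] by blast
  have along_M: "(\<lambda>\<omega>. G (\<Theta> r \<omega>) (Yk k r \<omega>)) \<in> borel_measurable M" "(\<lambda>\<omega>. G (\<Theta> r \<omega>) (Y r \<omega>)) \<in> borel_measurable M"
    if G: "G \<in> {g, gt, gx, gxx}" for G k r
    using fixed[OF along_joint[OF G Ykj]] fixed[OF along_joint[OF G Yj]] by auto
  define \<Delta> where "\<Delta> G k r \<omega> = \<bar>G (\<Theta> r \<omega>) (Yk k r \<omega>) - G (\<Theta> r \<omega>) (Y r \<omega>)\<bar>" for G :: "real \<Rightarrow> real \<Rightarrow> real" and k r \<omega>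
  have \<Delta>B: "\<Delta> G k r \<omega> \<le> 2 * L" if G: "G \<in> {g, gt, gx, gxx}" and \<omega>: "\<omega> \<in> space M" for G k r \<omega>
  proof -
    have "\<bar>G (\<Theta> r \<omega>) x\<bar> \<le> L" for x
      using L'[rule_format, OF \<Theta>_in[OF \<omega>], of r x] G by (elim insertE emptyE) (hypsubst, simp)+
    from this[of "Yk k r \<omega>"] this[of "Y r \<omega>"] show ?thesis unfolding \<Delta>_def by linarith
  qed
  have \<Delta>m: "\<Delta> G k r \<in> borel_measurable M" if G: "G \<in> {g, gt, gx, gxx}" for G k r
    unfolding \<Delta>_def using along_M[OF G] by (intro borel_measurable_abs borel_measurable_diff) auto
  have \<Delta>i: "integrable M (\<Delta> G k r)" if G: "G \<in> {g, gt, gx, gxx}" for G k r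
    using \<Delta>B[OF G] \<Delta>m[OF G] by (intro integrable_const_bound[where B="2 * L"]) (auto simp: \<Delta>_def)
  have \<Delta>small: "\<forall>\<^sub>F k in sequentially. \<forall>r\<in>{0..T}. expectation (\<Delta> G k r) \<le> \<kappa>"
    if G: "G \<in> {g, gt, gx, gxx}" and \<kappa>: "0 < \<kappa>" for G \<kappa>
  proof -
    have k3: "0 < \<kappa> / 3" using \<kappa> by simp
    obtain K where K: "0 \<le> K" "\<forall>s\<in>{0..T}. \<forall>s'\<in>{0..T}. \<forall>x y. \<bar>G s x - G s' y\<bar> \<le> \<kappa> / 3 + K * (\<bar>s - s'\<bar> + (x - y)\<^sup>2)"
      using compact_support_modulus(2)[OF test_function_continuous[OF test G] test_function_support[OF test G] k3] by (elim exE conjE)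
    define \<epsilon> where "\<epsilon> = sqrt (\<kappa> / (3 * (K + 1)))"
    have \<epsilon>: "0 < \<epsilon>" "K * \<epsilon>\<^sup>2 \<le> \<kappa> / 3" using K(1) \<kappa> by (auto simp: \<epsilon>_def field_simps)
    have "\<forall>\<^sub>F k in sequentially. \<forall>r\<in>{0..T}. prob {\<omega>\<in>space M. \<epsilon> < \<bar>S k r \<omega> - I r \<omega>\<bar>} \<le> \<kappa> / (3 * (2 * L + 1))"
      using \<epsilon> \<kappa> L0 by (intro conv) auto
    then show ?thesis
    proof eventually_elim
      case (elim k)
      show ?case
      proof
        fix r assume r: "r \<in> {0..T}"
        define E where "E = {\<omega>\<in>space M. \<epsilon> < \<bar>S k r \<omega> - I r \<omega>\<bar>}"
        have r0: "0 \<le> r" using r by simp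
        note [measurable] = Sm[OF r0, of k] Im[OF r0]
        have E: "E \<in> events" unfolding E_def by measurable
        have "expectation (\<Delta> G k r) \<le> expectation (\<lambda>\<omega>. 2 * \<kappa> / 3 + 2 * L * indicator E \<omega>)"
        proof (rule integral_mono[OF \<Delta>i[OF G]])
          fix \<omega> assume \<omega>: "\<omega> \<in> space M"
          show "\<Delta> G k r \<omega> \<le> 2 * \<kappa> / 3 + 2 * L * indicator E \<omega>"
          proof (cases "\<omega> \<in> E")
            case True then show ?thesis using \<Delta>B[OF G \<omega>, of k r] \<kappa> by simp
          next
            case False
            then have "\<bar>S k r \<omega> - I r \<omega>\<bar> \<le> \<epsilon>" using \<omega> by (auto simp: E_def)
            then have "\<bar>S k r \<omega> - I r \<omega>\<bar>\<^sup>2 \<le> \<epsilon>\<^sup>2" by (intro power_mono) auto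
            then have "K * (S k r \<omega> - I r \<omega>)\<^sup>2 \<le> K * \<epsilon>\<^sup>2" using K(1) by (intro mult_left_mono) auto
            then have "K * (S k r \<omega> - I r \<omega>)\<^sup>2 \<le> \<kappa> / 3" using \<epsilon>(2) by linarith
            moreover have "\<Delta> G k r \<omega> \<le> \<kappa> / 3 + K * (S k r \<omega> - I r \<omega>)\<^sup>2"
              using K(2)[rule_format, OF \<Theta>_in[OF \<omega>, of r] \<Theta>_in[OF \<omega>, of r], of "Yk k r \<omega>" "Y r \<omega>"] r
              by (simp add: \<Delta>_def Yk_def Y_def max_absorb2)
            ultimately show ?thesis using False by simp
          qed
        qed (rule affine_indicator(1)[OF E])
        also have "\<dots> = 2 * \<kappa> / 3 + 2 * L * prob E" by (rule affine_indicator(2)[OF E])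
        also have "\<dots> \<le> 2 * \<kappa> / 3 + 2 * L * (\<kappa> / (3 * (2 * L + 1)))"
          using elim r L0 unfolding E_def by (intro add_left_mono mult_left_mono) auto
        also have "\<dots> \<le> \<kappa>" using L0 \<kappa> by (simp add: field_simps)
        finally show "expectation (\<Delta> G k r) \<le> \<kappa>" .
      qed
    qed
  qed
  have in_set: "g \<in> {g, gt, gx, gxx}" "gt \<in> {g, gt, gx, gxx}" "gx \<in> {g, gt, gx, gxx}" "gxx \<in> {g, gt, gx, gxx}" by simp_all

  (* The two sides of the formula are approximated with an error proportional to \<kappa>. A bound \<kappa>\<^sup>2 on
     the mean square error J suffices for the integrand, since it enters divided by \<kappa>. *)
  define lhs where "lhs = expectation (\<lambda>\<omega>. g (\<Theta> T \<omega>) (Y T \<omega>)) - expectation (\<lambda>\<omega>. g (\<Theta> 0 \<omega>) (Y 0 \<omega>))"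
  define rhs where "rhs = (LINT r:{0..T}|lborel. expectation (drift H' Y r))"
  define C where "C = 2 + (2 * B + 1/2 * B\<^sup>2 + 1/2 * L * B) * T + 1/2 * L * B"
  have C: "0 \<le> C" using B L0 T by (auto simp: C_def)
  have est: "\<bar>lhs - rhs\<bar> \<le> C * \<kappa>" if \<kappa>: "0 < \<kappa>" for \<kappa>
  proof -
    have k2: "0 < \<kappa>\<^sup>2" using \<kappa> by simp
    have "\<forall>\<^sub>F k in sequentially. J k \<le> \<kappa>\<^sup>2 \<and> (\<forall>r\<in>{0..T}. expectation (\<Delta> g k r) \<le> \<kappa>) \<and> (\<forall>r\<in>{0..T}. expectation (\<Delta> gt k r) \<le> \<kappa>) \<and>
      (\<forall>r\<in>{0..T}. expectation (\<Delta> gx k r) \<le> \<kappa>) \<and> (\<forall>r\<in>{0..T}. expectation (\<Delta> gxx k r) \<le> \<kappa>)"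
      by (intro eventually_conj Jsmall[OF k2] \<Delta>small[OF in_set(1) \<kappa>] \<Delta>small[OF in_set(2) \<kappa>] \<Delta>small[OF in_set(3) \<kappa>] \<Delta>small[OF in_set(4) \<kappa>])
    from eventually_happens'[OF sequentially_bot this] obtain k where
      k0: "J k \<le> \<kappa>\<^sup>2" "\<forall>r\<in>{0..T}. expectation (\<Delta> g k r) \<le> \<kappa>" "\<forall>r\<in>{0..T}. expectation (\<Delta> gt k r) \<le> \<kappa>"
      "\<forall>r\<in>{0..T}. expectation (\<Delta> gx k r) \<le> \<kappa>" "\<forall>r\<in>{0..T}. expectation (\<Delta> gxx k r) \<le> \<kappa>" by (elim exE conjE)
    note k = k0(1) k0(2-5)[rule_format]
    have ito_k: "expectation (\<lambda>\<omega>. g (\<Theta> T \<omega>) (Yk k T \<omega>)) - expectation (\<lambda>\<omega>. g (\<Theta> 0 \<omega>) (Yk k 0 \<omega>)) =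
       (LINT r:{0..T}|lborel. expectation (drift (P k) (Yk k) r))"
      unfolding P_def Yk_def S_def by (rule ito_simple[OF csimple cB])
    have gclose: "\<bar>expectation (\<lambda>\<omega>. g (\<Theta> r \<omega>) (Yk k r \<omega>)) - expectation (\<lambda>\<omega>. g (\<Theta> r \<omega>) (Y r \<omega>))\<bar> \<le> \<kappa>" if r: "r \<in> {0..T}" for r
    proof -
      have i: "integrable M (\<lambda>\<omega>. g (\<Theta> r \<omega>) (Z \<omega>))" if "(\<lambda>\<omega>. g (\<Theta> r \<omega>) (Z \<omega>)) \<in> borel_measurable M" for Z
        using L' \<Theta>_in that by (intro integrable_const_bound[where B=L]) (auto simp del: atLeastAtMost_iff)
      have "\<bar>expectation (\<lambda>\<omega>. g (\<Theta> r \<omega>) (Yk k r \<omega>) - g (\<Theta> r \<omega>) (Y r \<omega>))\<bar> \<le> expectation (\<Delta> g k r)"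
        unfolding \<Delta>_def by (rule integral_abs_bound)
      then show ?thesis using k(2)[OF r] i[OF along_M(1)[OF in_set(1)]] i[OF along_M(2)[OF in_set(1)]] by simp
    qed
    have H'B': "\<bar>H' r \<omega>\<bar> \<le> B" if "\<omega> \<in> space M" for r \<omega> using H'B[OF that] .
    note dk = drift_integrable[OF Ykj[of k] Pj[of k] PB] and dY = drift_integrable[OF Yj H'j H'B']
    have dclose: "\<bar>expectation (drift (P k) (Yk k) r) - expectation (drift H' Y r)\<bar> \<le>
       (2 * B + 1/2 * B\<^sup>2 + 1/2 * L * B) * \<kappa> + L * B / (2 * \<kappa>) * expectation (Dj k r)" if r: "r \<in> {0..T}" for r
    proof -
      have Di: "integrable M (Dj k r)"
        using fixed[OF Djj] DjB by (intro integrable_const_bound[where B="4 * B\<^sup>2"]) auto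
      define b where "b \<omega> = B * \<Delta> gt k r \<omega> + B * \<Delta> gx k r \<omega> + 1/2 * B\<^sup>2 * \<Delta> gxx k r \<omega> + (1/2 * L * B * \<kappa> + L * B / (2 * \<kappa>) * Dj k r \<omega>)" for \<omega>
      have bi: "integrable M b" unfolding b_def using \<Delta>i[OF in_set(2)] \<Delta>i[OF in_set(3)] \<Delta>i[OF in_set(4)] Di by simp
      have "\<bar>expectation (\<lambda>\<omega>. drift (P k) (Yk k) r \<omega> - drift H' Y r \<omega>)\<bar> \<le> expectation b"
      proof (rule expectation_dominated(2)[OF _ bi])
        show "(\<lambda>\<omega>. drift (P k) (Yk k) r \<omega> - drift H' Y r \<omega>) \<in> borel_measurable M"
          using dk(2)[of r] dY(2)[of r] by (intro borel_measurable_diff borel_measurable_integrable)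
        show "AE \<omega> in M. \<bar>drift (P k) (Yk k) r \<omega> - drift H' Y r \<omega>\<bar> \<le> b \<omega>"
        proof (rule AE_I2)
          fix \<omega> assume \<omega>: "\<omega> \<in> space M"
          define y where "y = Yk k r \<omega>"
          define y' where "y' = Y r \<omega>"
          define p where "p = P k r \<omega>"
          define q where "q = H' r \<omega>"
          have pq: "\<bar>p\<bar> \<le> B" "\<bar>q\<bar> \<le> B" unfolding p_def q_def using PB H'B[OF \<omega>] by auto
          have 1: "\<bar>\<theta> r \<omega> * (gt (\<Theta> r \<omega>) y - gt (\<Theta> r \<omega>) y')\<bar> \<le> B * \<Delta> gt k r \<omega>"
            and 2: "\<bar>\<beta> r \<omega> * (gx (\<Theta> r \<omega>) y - gx (\<Theta> r \<omega>) y')\<bar> \<le> B * \<Delta> gx k r \<omega>"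
            unfolding \<Delta>_def abs_mult y_def y'_def using bounds \<omega> by (auto intro!: mult_right_mono)
          have "p\<^sup>2 \<le> B\<^sup>2" using power_mono[OF pq(1), of 2] by simp
          then have 3: "\<bar>1/2 * p\<^sup>2 * (gxx (\<Theta> r \<omega>) y - gxx (\<Theta> r \<omega>) y')\<bar> \<le> 1/2 * B\<^sup>2 * \<Delta> gxx k r \<omega>"
            unfolding \<Delta>_def abs_mult y_def y'_def by (intro mult_mono) auto
          have "2 * \<bar>p - q\<bar> \<le> \<kappa> + (p - q)\<^sup>2 / \<kappa>"
          proof -
            have "2 * \<kappa> * \<bar>p - q\<bar> \<le> \<kappa>\<^sup>2 + \<bar>p - q\<bar>\<^sup>2" by (rule sum_squares_bound)
            then show ?thesis using \<kappa> by (simp add: field_simps power2_eq_square)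
          qed
          moreover have "\<bar>p\<^sup>2 - q\<^sup>2\<bar> \<le> 2 * B * \<bar>p - q\<bar>"
          proof -
            have "p\<^sup>2 - q\<^sup>2 = (p + q) * (p - q)" by (simp add: power2_eq_square algebra_simps)
            moreover have "\<bar>p + q\<bar> \<le> 2 * B" using pq by linarith
            ultimately show ?thesis by (simp add: abs_mult mult_right_mono)
          qed
          ultimately have "\<bar>p\<^sup>2 - q\<^sup>2\<bar> \<le> B * (\<kappa> + (p - q)\<^sup>2 / \<kappa>)"
            using mult_left_mono[OF _ B, of "2 * \<bar>p - q\<bar>" "\<kappa> + (p - q)\<^sup>2 / \<kappa>"] by linarith
          then have 4: "\<bar>1/2 * (p\<^sup>2 - q\<^sup>2) * gxx (\<Theta> r \<omega>) y'\<bar> \<le> 1/2 * (B * (\<kappa> + (p - q)\<^sup>2 / \<kappa>)) * L"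
            unfolding abs_mult using L' \<Theta>_in[OF \<omega>] B \<kappa> by (intro mult_mono) (auto simp del: atLeastAtMost_iff)
          have "drift (P k) (Yk k) r \<omega> - drift H' Y r \<omega> = \<theta> r \<omega> * (gt (\<Theta> r \<omega>) y - gt (\<Theta> r \<omega>) y') + \<beta> r \<omega> * (gx (\<Theta> r \<omega>) y - gx (\<Theta> r \<omega>) y')
            + 1/2 * p\<^sup>2 * (gxx (\<Theta> r \<omega>) y - gxx (\<Theta> r \<omega>) y') + 1/2 * (p\<^sup>2 - q\<^sup>2) * gxx (\<Theta> r \<omega>) y'"
            unfolding drift_def y_def y'_def p_def q_def by (simp add: algebra_simps)
          also have "\<bar>\<dots>\<bar> \<le> B * \<Delta> gt k r \<omega> + B * \<Delta> gx k r \<omega> + 1/2 * B\<^sup>2 * \<Delta> gxx k r \<omega> + 1/2 * (B * (\<kappa> + (p - q)\<^sup>2 / \<kappa>)) * L"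
            using 1 2 3 4 by linarith
          also have "\<dots> = b \<omega>" unfolding b_def Dj_def p_def[symmetric] q_def[symmetric] using \<kappa> by (simp add: field_simps)
          finally show "\<bar>drift (P k) (Yk k) r \<omega> - drift H' Y r \<omega>\<bar> \<le> b \<omega>" .
        qed
      qed
      also have "expectation b = B * expectation (\<Delta> gt k r) + B * expectation (\<Delta> gx k r) + 1/2 * B\<^sup>2 * expectation (\<Delta> gxx k r)
         + (1/2 * L * B * \<kappa> + L * B / (2 * \<kappa>) * expectation (Dj k r))"
        unfolding b_def using \<Delta>i[OF in_set(2)] \<Delta>i[OF in_set(3)] \<Delta>i[OF in_set(4)] Di by (simp add: prob_space)
      also have "\<dots> \<le> B * \<kappa> + B * \<kappa> + 1/2 * B\<^sup>2 * \<kappa> + (1/2 * L * B * \<kappa> + L * B / (2 * \<kappa>) * expectation (Dj k r))"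
        using k(3,4,5)[OF r] B by (intro add_mono mult_left_mono order_refl) auto
      finally show ?thesis using dk(2)[of r] dY(2)[of r] by (simp add: algebra_simps)
    qed
    have i1: "set_integrable lborel {0..T} (\<lambda>r. (2 * B + 1/2 * B\<^sup>2 + 1/2 * L * B) * \<kappa>)"
      by (intro borel_integrable_atLeastAtMost' continuous_intros)
    have i2: "set_integrable lborel {0..T} (\<lambda>r. L * B / (2 * \<kappa>) * expectation (Dj k r))"
      using Jfub(1) by (intro set_integrable_mult_right)
    have "\<bar>(LINT r:{0..T}|lborel. expectation (drift (P k) (Yk k) r)) - rhs\<bar>
      = \<bar>LINT r:{0..T}|lborel. expectation (drift (P k) (Yk k) r) - expectation (drift H' Y r)\<bar>"
      unfolding rhs_def using set_integral_diff(2)[OF dk(1) dY(1)] by simp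
    also have "\<dots> \<le> (LINT r:{0..T}|lborel. \<bar>expectation (drift (P k) (Yk k) r) - expectation (drift H' Y r)\<bar>)"
      using set_integral_norm_bound[OF set_integral_diff(1)[OF dk(1) dY(1)]] by simp
    also have "\<dots> \<le> (LINT r:{0..T}|lborel. (2 * B + 1/2 * B\<^sup>2 + 1/2 * L * B) * \<kappa> + L * B / (2 * \<kappa>) * expectation (Dj k r))"
    proof (rule set_integral_mono)
      show "set_integrable lborel {0..T} (\<lambda>r. \<bar>expectation (drift (P k) (Yk k) r) - expectation (drift H' Y r)\<bar>)"
        by (intro set_integrable_abs set_integral_diff(1) dk(1) dY(1))
      show "set_integrable lborel {0..T} (\<lambda>r. (2 * B + 1/2 * B\<^sup>2 + 1/2 * L * B) * \<kappa> + L * B / (2 * \<kappa>) * expectation (Dj k r))"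
        by (rule set_integral_add(1)[OF i1 i2])
    qed (rule dclose)
    also have "\<dots> = (LINT r:{0..T}|lborel. (2 * B + 1/2 * B\<^sup>2 + 1/2 * L * B) * \<kappa>) + L * B / (2 * \<kappa>) * J k"
      unfolding J_def set_integral_add(2)[OF i1 i2] by simp
    also have "(LINT r:{0..T}|lborel. (2 * B + 1/2 * B\<^sup>2 + 1/2 * L * B) * \<kappa>) = (2 * B + 1/2 * B\<^sup>2 + 1/2 * L * B) * \<kappa> * T"
      using T by (simp add: set_lebesgue_integral_def)
    also have "L * B / (2 * \<kappa>) * J k \<le> L * B / (2 * \<kappa>) * \<kappa>\<^sup>2" using k(1) L0 B \<kappa> by (intro mult_left_mono) auto
    also have "L * B / (2 * \<kappa>) * \<kappa>\<^sup>2 = 1/2 * L * B * \<kappa>" using \<kappa> by (simp add: power2_eq_square)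
    finally have "\<bar>(LINT r:{0..T}|lborel. expectation (drift (P k) (Yk k) r)) - rhs\<bar> \<le> (2 * B + 1/2 * B\<^sup>2 + 1/2 * L * B) * \<kappa> * T + 1/2 * L * B * \<kappa>" by simp
    moreover have "\<bar>lhs - (LINT r:{0..T}|lborel. expectation (drift (P k) (Yk k) r))\<bar> \<le> 2 * \<kappa>"
      unfolding lhs_def ito_k[symmetric] using gclose[of T] gclose[of 0] T by (simp add: abs_le_iff)
    ultimately have "\<bar>lhs - rhs\<bar> \<le> 2 * \<kappa> + ((2 * B + 1/2 * B\<^sup>2 + 1/2 * L * B) * \<kappa> * T + 1/2 * L * B * \<kappa>)" by linarith
    then show ?thesis by (simp add: C_def algebra_simps)
  qed
  have "\<bar>lhs - rhs\<bar> \<le> 0 + e" if "0 < e" for e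
  proof -
    have "\<bar>lhs - rhs\<bar> \<le> C * (e / (C + 1))" using that C by (intro est) auto
    also have "\<dots> \<le> e" using that C by (simp add: field_simps)
    finally show ?thesis by simp
  qed
  then have "\<bar>lhs - rhs\<bar> \<le> 0" by (rule field_le_epsilon)
  then show ?thesis by (simp add: lhs_def rhs_def)
qed

end

section \<open>The stopped equation and Dynkin's formula\<close>

context brownian_setting begin

text \<open>
  Simple integrals vanish at time \<open>0\<close>, and the approximation includes that time.
\<close>

lemma ito_integral_zero:
  assumes "is_ito_integral M F W H I" shows "AE \<omega> in M. I 0 \<omega> = 0"
proof -
  from assms have "I 0 \<in> borel_measurable (F 0)"
    unfolding is_ito_integral_def adapted_process_def by simp
  then have Im [measurable]: "I 0 \<in> borel_measurable M" by (rule measurable_F_M)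
  from assms obtain n s h where simple: "\<And>k. simple_integrand F (n k) (s k) (h k)"
    and "\<And>T'. 0 \<le> T' \<Longrightarrow> null_in_probability M (\<lambda>k \<omega>. \<integral>\<^sup>+t\<in>{0..T'}. ennreal ((simple_process (n k) (s k) (h k) t \<omega> - H t \<omega>)\<^sup>2) \<partial>lborel)"
      and lim': "\<And>T'. 0 \<le> T' \<Longrightarrow> null_in_probability M (\<lambda>k \<omega>. SUP t\<in>{0..T'}. ennreal \<bar>simple_integral W (n k) (s k) (h k) t \<omega> - I t \<omega>\<bar>)"
    unfolding is_ito_integral_def by blast
  have lim: "null_in_probability M (\<lambda>k \<omega>. SUP t\<in>{0..0}. ennreal \<bar>simple_integral W (n k) (s k) (h k) t \<omega> - I t \<omega>\<bar>)"
    by (rule lim') simp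
  have "simple_integral W (n k) (s k) (h k) 0 \<omega> = 0" for k \<omega>
    using partition_nonneg[OF simple, of _ k] unfolding simple_integral_def
    by (intro sum.neutral) (auto simp: min_absorb1 Suc_le_eq)
  then have "(SUP t\<in>{0..0}. ennreal \<bar>simple_integral W (n k) (s k) (h k) t \<omega> - I t \<omega>\<bar>) = ennreal \<bar>I 0 \<omega>\<bar>" for k \<omega>
    by simp
  with lim have "(\<lambda>k::nat. prob {\<omega>\<in>space M. ennreal \<epsilon> < ennreal \<bar>I 0 \<omega>\<bar>}) \<longlonglongrightarrow> 0" if "0 < \<epsilon>" for \<epsilon>
    using that by (simp add: null_in_probability_def)
  then have z: "prob {\<omega>\<in>space M. \<epsilon> < \<bar>I 0 \<omega>\<bar>} = 0" if "0 < \<epsilon>" for \<epsilon>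
    using that LIMSEQ_unique[OF tendsto_const] by (fastforce simp: ennreal_less_iff)
  have "AE \<omega> in M. \<not> (1 / real (Suc k) < \<bar>I 0 \<omega>\<bar>)" for k
    using z[of "1 / real (Suc k)"] by (subst AE_iff_measurable[OF _ refl]) (auto simp: emeasure_eq_measure)
  then have "AE \<omega> in M. \<forall>k. \<not> (1 / real (Suc k) < \<bar>I 0 \<omega>\<bar>)" unfolding AE_all_countable by blast
  then show ?thesis
  proof eventually_elim
    case (elim \<omega>)
    show ?case
    proof (rule ccontr)
      assume "I 0 \<omega> \<noteq> 0"
      then have "0 < \<bar>I 0 \<omega>\<bar>" by simp
      then obtain k where "inverse (real (Suc k)) < \<bar>I 0 \<omega>\<bar>" using reals_Archimedean by blast
      then show False using elim by (simp add: inverse_eq_divide)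
    qed
  qed
qed

lemma stopping_time_le_measurable:
  assumes "stopping_time F \<rho>" "s \<le> t" shows "Measurable.pred (F t) (\<lambda>\<omega>. \<rho> \<omega> \<le> s)"
  using stopping_timeD[OF assms(1), of s] assms(2) by (rule measurable_F_mono)

lemma stopping_time_min_measurable:
  assumes "stopping_time F \<rho>" shows "(\<lambda>\<omega>. min t (\<rho> \<omega>)) \<in> borel_measurable (F t)"
proof (rule borel_measurableI_le)
  fix c
  show "{\<omega> \<in> space (F t). min t (\<rho> \<omega>) \<le> c} \<in> sets (F t)"
  proof (cases "t \<le> c")
    case True
    then have "{\<omega> \<in> space (F t). min t (\<rho> \<omega>) \<le> c} = space (F t)" by auto
    then show ?thesis by (metis sets.top)
  next
    case False
    then have "{\<omega> \<in> space (F t). min t (\<rho> \<omega>) \<le> c} = {\<omega> \<in> space (F t). \<rho> \<omega> \<le> c}" by auto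
    then show ?thesis using stopping_time_le_measurable[OF assms, of c t] False by (simp add: pred_def)
  qed
qed

lemma stopping_time_measurable: "stopping_time F \<rho> \<Longrightarrow> (\<rho> :: 'a \<Rightarrow> real) \<in> borel_measurable M"
  using measurable_stopping_time[OF _ sets_F_M space_F] .

end

lemma set_integrable_bounded_Icc:
  fixes f :: "real \<Rightarrow> real"
  assumes "f \<in> borel_measurable borel" "\<And>r. \<bar>f r\<bar> \<le> C"
  shows "set_integrable lborel {s..t} f"
  unfolding set_integrable_def using assms
  by (intro integrableI_bounded_set_indicator[where B=C]) (auto simp: emeasure_lborel_Icc_eq)

locale sde_setting = brownian_setting M F W
  for M :: "'a measure" and F :: "real \<Rightarrow> 'a measure" and W :: "real \<Rightarrow> 'a \<Rightarrow> real" +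
  fixes b \<sigma> :: "real \<Rightarrow> real" and \<xi> :: real and X :: "real \<Rightarrow> 'a \<Rightarrow> real" and \<tau> :: "'a \<Rightarrow> ereal"
  assumes b_cont: "continuous_on UNIV b" and \<sigma>_cont: "continuous_on UNIV \<sigma>"
    and sol: "sde_solution_up_to_explosion M F W b \<sigma> \<xi> X \<tau>"
begin

lemma \<tau>_stopping: "0 \<le> t \<Longrightarrow> Measurable.pred (F t) (\<lambda>\<omega>. \<tau> \<omega> \<le> ereal t)"
  and \<tau>_pos: "\<omega> \<in> space M \<Longrightarrow> 0 < \<tau> \<omega>"
  and X_adapted: "0 \<le> t \<Longrightarrow> (\<lambda>\<omega>. if ereal t < \<tau> \<omega> then X t \<omega> else 0) \<in> borel_measurable (F t)"
  and X_continuous: "\<omega> \<in> space M \<Longrightarrow> continuous_on {t. 0 \<le> t \<and> ereal t < \<tau> \<omega>} (\<lambda>t. X t \<omega>)"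
  and explodes: "AE \<omega> in M. \<tau> \<omega> < \<infinity> \<longrightarrow> Limsup (at_left (real_of_ereal (\<tau> \<omega>))) (\<lambda>t. ereal \<bar>X t \<omega>\<bar>) = \<infinity>"
  using sol unfolding sde_solution_up_to_explosion_def adapted_process_def by auto

lemma equation:
  assumes "stopping_time F \<rho>" "\<And>\<omega>. \<omega> \<in> space M \<Longrightarrow> 0 \<le> \<rho> \<omega>" "\<And>\<omega>. \<omega> \<in> space M \<Longrightarrow> ereal (\<rho> \<omega>) < \<tau> \<omega>"
  obtains I where "is_ito_integral M F W (\<lambda>t \<omega>. if t \<le> \<rho> \<omega> then \<sigma> (X t \<omega>) else 0) I"
    "AE \<omega> in M. \<forall>t\<ge>0. X (min t (\<rho> \<omega>)) \<omega> = \<xi> + (LINT r:{0..min t (\<rho> \<omega>)}|lborel. b (X r \<omega>)) + I t \<omega>"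
  using sol assms unfolding sde_solution_up_to_explosion_def by blast

text \<open>
  The equation stopped at time \<open>0\<close>.
\<close>

lemma X_initial: "AE \<omega> in M. X 0 \<omega> = \<xi>"
proof -
  have st: "stopping_time F (\<lambda>\<omega>. 0 :: real)" by (rule stopping_time_const)
  obtain I where I: "is_ito_integral M F W (\<lambda>t \<omega>. if t \<le> 0 then \<sigma> (X t \<omega>) else 0) I"
    "AE \<omega> in M. \<forall>t\<ge>0. X (min t 0) \<omega> = \<xi> + (LINT r:{0..min t 0}|lborel. b (X r \<omega>)) + I t \<omega>"
    by (rule equation[OF st]) (use \<tau>_pos in \<open>auto simp: zero_ereal_def\<close>)
  show ?thesis using I(2) ito_integral_zero[OF I(1)]
  proof eventually_elim
    case (elim \<omega>)
    from elim(1)[rule_format, of 0] elim(2) show ?case by (simp del: atLeastAtMost_singleton)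
  qed
qed

lemma stopped_continuous:
  assumes "\<omega> \<in> space M" "0 \<le> \<rho> \<omega>" "ereal (\<rho> \<omega>) < \<tau> \<omega>"
  shows "continuous_on {0..} (\<lambda>t. X (min t (\<rho> \<omega>)) \<omega>)"
  by (intro continuous_on_compose2[OF X_continuous[OF assms(1)]] continuous_intros)
    (use assms in \<open>auto simp: min_def intro: le_less_trans[of "ereal _" "ereal _"]\<close>)

text \<open>
  Adaptedness of \<open>X\<close> is available at fixed times only, so the time \<open>min t (\<rho> \<omega>)\<close> is discretised.
  Rounding downwards matters: the discretised time stays below \<open>\<rho> < \<tau>\<close>, where \<open>X\<close> is continuous,
  and below \<open>t\<close>, so that the values are known at time \<open>t\<close>.
\<close>

lemma stopped_adapted:
  assumes \<rho>: "stopping_time F \<rho>" "\<And>\<omega>. \<omega> \<in> space M \<Longrightarrow> 0 \<le> \<rho> \<omega>" "\<And>\<omega>. \<omega> \<in> space M \<Longrightarrow> ereal (\<rho> \<omega>) < \<tau> \<omega>"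
    and t: "0 \<le> t"
  shows "(\<lambda>\<omega>. X (min t (\<rho> \<omega>)) \<omega>) \<in> borel_measurable (F t)"
proof -
  define y where "y \<omega> = min t (\<rho> \<omega>)" for \<omega>
  define z where "z k \<omega> = real (nat \<lfloor>y \<omega> * real (Suc k)\<rfloor>) / real (Suc k)" for k \<omega>
  have y [measurable]: "y \<in> borel_measurable (F t)" unfolding y_def using \<rho>(1) by (rule stopping_time_min_measurable)
  have z_le: "z k \<omega> \<le> y \<omega>" "y \<omega> \<le> z k \<omega> + 1 / real (Suc k)" "0 \<le> z k \<omega>" if "\<omega> \<in> space M" for k \<omega>
  proof -
    have y0: "0 \<le> y \<omega> * real (Suc k)" using \<rho>(2)[OF that] t by (simp add: y_def)
    have k: "0 < real (Suc k)" by simp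
    have fl: "real (nat \<lfloor>y \<omega> * real (Suc k)\<rfloor>) = real_of_int \<lfloor>y \<omega> * real (Suc k)\<rfloor>" using y0 by simp
    show "z k \<omega> \<le> y \<omega>" unfolding z_def fl pos_divide_le_eq[OF k] by linarith
    have "y \<omega> * real (Suc k) \<le> real_of_int \<lfloor>y \<omega> * real (Suc k)\<rfloor> + 1" by linarith
    then show "y \<omega> \<le> z k \<omega> + 1 / real (Suc k)"
      unfolding z_def fl add_divide_distrib[symmetric] pos_le_divide_eq[OF k] .
    show "0 \<le> z k \<omega>" by (simp add: z_def)
  qed
  show ?thesis
  proof (rule borel_measurable_LIMSEQ_real[where u="\<lambda>k \<omega>. X (z k \<omega>) \<omega>"])
    fix \<omega> assume "\<omega> \<in> space (F t)"
    then have \<omega>: "\<omega> \<in> space M" by simp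
    have "(\<lambda>k. z k \<omega>) \<longlonglongrightarrow> y \<omega>"
    proof (rule tendsto_sandwich)
      show "\<forall>\<^sub>F k in sequentially. y \<omega> - 1 / real (Suc k) \<le> z k \<omega>" using z_le(2)[OF \<omega>] by (auto simp: algebra_simps)
      show "\<forall>\<^sub>F k in sequentially. z k \<omega> \<le> y \<omega>" using z_le(1)[OF \<omega>] by auto
      show "(\<lambda>k. y \<omega> - 1 / real (Suc k)) \<longlonglongrightarrow> y \<omega>"
        using tendsto_diff[OF tendsto_const LIMSEQ_Suc[OF lim_1_over_n], of "y \<omega>"] by simp
    qed simp
    moreover have "z k \<omega> \<in> {t. 0 \<le> t \<and> ereal t < \<tau> \<omega>}" for k
      using z_le(1,3)[OF \<omega>, of k] \<rho>(3)[OF \<omega>] by (auto simp: y_def min_less_iff_disj intro: le_less_trans[of "ereal _" "ereal (\<rho> \<omega>)"])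
    moreover have "y \<omega> \<in> {t. 0 \<le> t \<and> ereal t < \<tau> \<omega>}"
      using \<rho>(2,3)[OF \<omega>] t by (auto simp: y_def min_less_iff_disj intro: le_less_trans[of "ereal _" "ereal (\<rho> \<omega>)"])
    ultimately show "(\<lambda>k. X (z k \<omega>) \<omega>) \<longlonglongrightarrow> X (min t (\<rho> \<omega>)) \<omega>"
      using continuous_on_tendsto_compose[OF X_continuous[OF \<omega>], of "\<lambda>k. z k \<omega>" "y \<omega>"] by (simp add: y_def)
  next
    fix k
    define f where "f j \<omega> = (if real j / real (Suc k) \<le> t then (if ereal (real j / real (Suc k)) < \<tau> \<omega> then X (real j / real (Suc k)) \<omega> else 0) else 0)" for j \<omega>
    have "(\<lambda>\<omega>. f (nat \<lfloor>y \<omega> * real (Suc k)\<rfloor>) \<omega>) \<in> borel_measurable (F t)"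
    proof (rule measurable_compose_countable[where f=f and g="\<lambda>\<omega>. nat \<lfloor>y \<omega> * real (Suc k)\<rfloor>"])
      fix j
      show "f j \<in> borel_measurable (F t)"
      proof (cases "real j / real (Suc k) \<le> t")
        case True
        then have "f j = (\<lambda>\<omega>. if ereal (real j / real (Suc k)) < \<tau> \<omega> then X (real j / real (Suc k)) \<omega> else 0)" by (intro ext) (simp only: f_def if_True)
        then show ?thesis using measurable_F_mono[OF X_adapted True] by simp
      next
        case False
        then have "f j = (\<lambda>\<omega>. 0)" by (intro ext) (simp only: f_def if_False)
        then show ?thesis by simp
      qed
    qed measurable
    then show "(\<lambda>\<omega>. X (z k \<omega>) \<omega>) \<in> borel_measurable (F t)"
    proof (rule measurable_cong[THEN iffD1, rotated])
      fix \<omega> assume "\<omega> \<in> space (F t)"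
      then have \<omega>: "\<omega> \<in> space M" by simp
      have "z k \<omega> \<le> t" "z k \<omega> \<le> \<rho> \<omega>" using z_le(1)[OF \<omega>, of k] by (auto simp: y_def)
      moreover from this(2) have "ereal (z k \<omega>) < \<tau> \<omega>" using \<rho>(3)[OF \<omega>] by (auto intro: le_less_trans[of "ereal _" "ereal (\<rho> \<omega>)"])
      ultimately show "f (nat \<lfloor>y \<omega> * real (Suc k)\<rfloor>) \<omega> = X (z k \<omega>) \<omega>" by (simp add: f_def z_def del: of_nat_Suc)
    qed
  qed
qed

text \<open>
  The drift of \<open>g (min r \<rho>) (X (min r \<rho>))\<close>: the operator \<open>\<partial>\<^sub>t + b \<partial>\<^sub>x + \<sigma>\<^sup>2/2 \<partial>\<^sub>x\<^sub>x\<close> applied to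
  \<open>g\<close> along the path until \<open>\<rho>\<close>, and zero afterwards. The state in the coefficients is clamped to
  \<open>{-R..R}\<close>, and the time to \<open>{0..T}\<close>, in order that the function be bounded everywhere; the
  clamps are inactive on paths that stay in \<open>{-R..R}\<close> until \<open>\<rho> \<le> T\<close>.
\<close>

definition stopped_generator ::
  "real \<Rightarrow> real \<Rightarrow> ('a \<Rightarrow> real) \<Rightarrow> (real \<Rightarrow> real \<Rightarrow> real) \<Rightarrow> (real \<Rightarrow> real \<Rightarrow> real) \<Rightarrow> (real \<Rightarrow> real \<Rightarrow> real) \<Rightarrow> real \<Rightarrow> 'a \<Rightarrow> real" where
  "stopped_generator T R \<rho> gt gx gxx r \<omega> =
     (let s = min (min T (max 0 r)) (\<rho> \<omega>); x = X (min (max 0 r) (\<rho> \<omega>)) \<omega>; y = max (-R) (min R x)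
      in if 0 \<le> r \<and> r \<le> \<rho> \<omega> then gt s x + b y * gx s x + 1/2 * (\<sigma> y)\<^sup>2 * gxx s x else 0)"

text \<open>
  The stopped solution is the sum of a process of bounded variation and the integral of a bounded
  integrand, with the time itself as a clock that stops at \<open>\<rho>\<close>. The former is taken to be the
  stopped solution minus the integral, so that the sum is the stopped solution on all of the
  space.
\<close>

lemma dynkin_formula:
  assumes \<rho>: "stopping_time F \<rho>" "\<And>\<omega>. \<omega> \<in> space M \<Longrightarrow> 0 \<le> \<rho> \<omega>" "\<And>\<omega>. \<omega> \<in> space M \<Longrightarrow> ereal (\<rho> \<omega>) < \<tau> \<omega>"
    and \<rho>T: "\<And>\<omega>. \<omega> \<in> space M \<Longrightarrow> \<rho> \<omega> \<le> T" and T: "0 \<le> T" and R: "0 \<le> R"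
    and bound: "AE \<omega> in M. \<forall>r. 0 \<le> r \<longrightarrow> r \<le> \<rho> \<omega> \<longrightarrow> \<bar>X r \<omega>\<bar> \<le> R"
    and test: "test_function T g gt gx gxx"
  shows "expectation (\<lambda>\<omega>. g (\<rho> \<omega>) (X (\<rho> \<omega>) \<omega>)) - g 0 \<xi> = (LINT r:{0..T}|lborel. expectation (stopped_generator T R \<rho> gt gx gxx r))"
    and "set_integrable lborel {0..T} (\<lambda>r. expectation (stopped_generator T R \<rho> gt gx gxx r))"
    and "integrable M (stopped_generator T R \<rho> gt gx gxx r)"
proof -
  define cl where "cl x = max (-R) (min R x)" for x :: real
  have cl_in: "cl x \<in> {-R..R}" for x using R by (auto simp: cl_def)
  have bdd: "\<exists>C. \<forall>x\<in>{-R..R}. \<bar>f x\<bar> \<le> C" if "continuous_on UNIV f" for f :: "real \<Rightarrow> real"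
  proof -
    have "bounded (f ` {-R..R})"
      by (intro compact_imp_bounded compact_continuous_image continuous_on_subset[OF that]) auto
    then show ?thesis unfolding bounded_iff by auto
  qed
  obtain Cb Cs where C: "\<forall>x\<in>{-R..R}. \<bar>b x\<bar> \<le> Cb" "\<forall>x\<in>{-R..R}. \<bar>\<sigma> x\<bar> \<le> Cs"
    using bdd[OF b_cont] bdd[OF \<sigma>_cont] by blast
  define B where "B = max 1 (max Cb Cs)"
  have B: "0 \<le> B" "1 \<le> B" "\<bar>b (cl x)\<bar> \<le> B" "\<bar>\<sigma> (cl x)\<bar> \<le> B" for x
    using C cl_in[of x] by (auto simp: B_def le_max_iff_disj simp del: atLeastAtMost_iff)
  obtain I where I: "is_ito_integral M F W (\<lambda>t \<omega>. if t \<le> \<rho> \<omega> then \<sigma> (X t \<omega>) else 0) I"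
    and eq: "AE \<omega> in M. \<forall>t\<ge>0. X (min t (\<rho> \<omega>)) \<omega> = \<xi> + (LINT r:{0..min t (\<rho> \<omega>)}|lborel. b (X r \<omega>)) + I t \<omega>"
    using equation[OF \<rho>] by blast
  from I have Ia: "\<And>t. 0 \<le> t \<Longrightarrow> I t \<in> borel_measurable (F t)" and Ic: "\<And>\<omega>. \<omega> \<in> space M \<Longrightarrow> continuous_on {0..} (\<lambda>t. I t \<omega>)"
    unfolding is_ito_integral_def adapted_process_def by auto
  have \<rho>m [measurable]: "\<rho> \<in> borel_measurable M" using \<rho>(1) by (rule stopping_time_measurable)
  define Xs where "Xs r \<omega> = X (min (max 0 r) (\<rho> \<omega>)) \<omega>" for r \<omega>
  define \<Theta> where "\<Theta> r \<omega> = min (min T (max 0 r)) (\<rho> \<omega>)" for r \<omega>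
  define \<theta> where "\<theta> r \<omega> = (if 0 \<le> r \<and> r \<le> \<rho> \<omega> then 1 else 0 :: real)" for r \<omega>
  define \<beta> where "\<beta> r \<omega> = \<theta> r \<omega> * b (cl (Xs r \<omega>))" for r \<omega>
  define H where "H r \<omega> = \<theta> r \<omega> * \<sigma> (cl (Xs r \<omega>))" for r \<omega>
  define A where "A r \<omega> = Xs r \<omega> - I (max 0 r) \<omega>" for r \<omega>
  have [measurable]: "b \<in> borel_measurable borel" "\<sigma> \<in> borel_measurable borel"
    using b_cont \<sigma>_cont by (auto intro: borel_measurable_continuous_onI)
  have Xs_F: "Xs r \<in> borel_measurable (F r)" if "0 \<le> r" for r
    using stopped_adapted[OF \<rho> that] that by (simp add: Xs_def[abs_def] max_absorb2)
  have Xsj: "(\<lambda>(r, \<omega>). Xs r \<omega>) \<in> borel_measurable (borel \<Otimes>\<^sub>M M)"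
    unfolding Xs_def
    by (rule continuous_process_measurable[where Z="\<lambda>t \<omega>. X (min t (\<rho> \<omega>)) \<omega>"])
      (use stopped_continuous \<rho> stopped_adapted[OF \<rho>] measurable_F_M in blast)+
  have Ij: "(\<lambda>(r, \<omega>). I (max 0 r) \<omega>) \<in> borel_measurable (borel \<Otimes>\<^sub>M M)"
    by (rule continuous_process_measurable) (use Ia Ic measurable_F_M in blast)+
  have [measurable]: "(\<lambda>p. Xs (fst p) (snd p)) \<in> borel_measurable (borel \<Otimes>\<^sub>M M)" "(\<lambda>p. I (max 0 (fst p)) (snd p)) \<in> borel_measurable (borel \<Otimes>\<^sub>M M)"
    using Xsj Ij by (simp_all add: case_prod_unfold)
  have \<theta>j [measurable]: "(\<lambda>p. \<theta> (fst p) (snd p)) \<in> borel_measurable (borel \<Otimes>\<^sub>M M)"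
    unfolding \<theta>_def by measurable
  have \<beta>j: "(\<lambda>(r, \<omega>). \<beta> r \<omega>) \<in> borel_measurable (borel \<Otimes>\<^sub>M M)" and Hj: "(\<lambda>(r, \<omega>). H r \<omega>) \<in> borel_measurable (borel \<Otimes>\<^sub>M M)"
    unfolding \<beta>_def H_def cl_def case_prod_unfold by measurable
  have \<theta>B: "\<bar>\<theta> r \<omega>\<bar> \<le> 1" for r \<omega> by (auto simp: \<theta>_def)
  have \<beta>B: "\<bar>\<beta> r \<omega>\<bar> \<le> B" and HB: "\<bar>H r \<omega>\<bar> \<le> B" for r \<omega>
    unfolding \<beta>_def H_def \<theta>_def using B by auto
  have \<beta>_path: "set_integrable lborel {s..t} (\<lambda>r. \<beta> r \<omega>)" if "\<omega> \<in> space M" for s t \<omega>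
    using measurable_Pair1[OF \<beta>j that] \<beta>B by (intro set_integrable_bounded_Icc) auto
  interpret D: drift_setting M F W T B \<Theta> A \<theta> \<beta> g gt gx gxx
  proof unfold_locales
    show "\<Theta> r \<omega> \<in> {0..T}" if "\<omega> \<in> space M" for r \<omega> using \<rho>(2)[OF that] T by (auto simp: \<Theta>_def)
    show "\<Theta> r \<in> borel_measurable (F r)" if "r \<in> {0..T}" for r
      using stopping_time_min_measurable[OF \<rho>(1), of r] that by (simp add: \<Theta>_def[abs_def] max_absorb2 min_absorb2)
    show "A r \<in> borel_measurable (F r)" if "r \<in> {0..T}" for r
      using Xs_F[of r] Ia[of r] that by (simp add: A_def[abs_def] max_absorb2)
    show "(\<lambda>(r, \<omega>). \<Theta> r \<omega>) \<in> borel_measurable (borel \<Otimes>\<^sub>M M)" "(\<lambda>(r, \<omega>). A r \<omega>) \<in> borel_measurable (borel \<Otimes>\<^sub>M M)"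
      unfolding \<Theta>_def A_def case_prod_unfold by measurable
    show "(\<lambda>(r, \<omega>). \<theta> r \<omega>) \<in> borel_measurable (borel \<Otimes>\<^sub>M M)" using \<theta>j by (simp add: case_prod_unfold)
    show "\<bar>\<theta> r \<omega>\<bar> \<le> B" for r \<omega> using \<theta>B B(2) by (rule order_trans)
    fix s t assume st: "0 \<le> s" "s \<le> t" "t \<le> T"
    show "AE \<omega> in M. \<Theta> t \<omega> - \<Theta> s \<omega> = (LINT r:{s..t}|lborel. \<theta> r \<omega>)"
    proof (rule AE_I2)
      fix \<omega> assume "\<omega> \<in> space M"
      have ind: "indicator {s..t} r *\<^sub>R \<theta> r \<omega> = indicator {s..min t (\<rho> \<omega>)} r" for r
        using st by (auto simp: \<theta>_def indicator_def)
      have "(LINT r:{s..t}|lborel. \<theta> r \<omega>) = (if s \<le> min t (\<rho> \<omega>) then min t (\<rho> \<omega>) - s else 0)"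
        unfolding set_lebesgue_integral_def ind by auto
      then show "\<Theta> t \<omega> - \<Theta> s \<omega> = (LINT r:{s..t}|lborel. \<theta> r \<omega>)" using st by (auto simp: \<Theta>_def)
    qed
    show "AE \<omega> in M. A t \<omega> - A s \<omega> = (LINT r:{s..t}|lborel. \<beta> r \<omega>)"
      using eq bound AE_space
    proof eventually_elim
      case (elim \<omega>)
      have A: "A t' \<omega> = \<xi> + (LINT r:{0..t'}|lborel. \<beta> r \<omega>)" if t': "0 \<le> t'" for t'
      proof -
        have "indicator {0..min t' (\<rho> \<omega>)} r *\<^sub>R b (X r \<omega>) = indicator {0..t'} r *\<^sub>R \<beta> r \<omega>" for r
          using elim(2)[rule_format, of r]
          by (auto simp: indicator_def \<beta>_def \<theta>_def Xs_def cl_def min_absorb1 max_absorb2)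
        then have "(LINT r:{0..min t' (\<rho> \<omega>)}|lborel. b (X r \<omega>)) = (LINT r:{0..t'}|lborel. \<beta> r \<omega>)"
          by (simp add: set_lebesgue_integral_def)
        then show ?thesis using elim(1)[rule_format, OF t'] t' by (simp add: A_def Xs_def max_absorb2)
      qed
      show ?case using A[of t] A[of s] st set_integral_split[OF \<beta>_path[OF elim(3)], of 0 s t] by simp
    qed
  qed (use test T B(1) \<beta>j \<beta>B in auto)
  have Y: "A r \<omega> + I (max 0 r) \<omega> = Xs r \<omega>" for r \<omega> by (simp add: A_def)
  have HH: "AE \<omega> in M. \<forall>r. 0 < r \<longrightarrow> r \<le> T \<longrightarrow> (if r \<le> \<rho> \<omega> then \<sigma> (X r \<omega>) else 0) = H r \<omega>"
    using bound
  proof eventually_elim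
    case (elim \<omega>)
    show ?case
    proof (intro allI impI)
      fix r :: real assume "0 < r"
      then show "(if r \<le> \<rho> \<omega> then \<sigma> (X r \<omega>) else 0) = H r \<omega>"
        using elim[rule_format, of r] by (auto simp: H_def \<theta>_def Xs_def cl_def min_absorb1 max_absorb2)
    qed
  qed
  have gen: "D.drift H Xs r \<omega> = stopped_generator T R \<rho> gt gx gxx r \<omega>" for r \<omega>
    unfolding D.drift_def stopped_generator_def Let_def \<beta>_def H_def \<theta>_def \<Theta>_def Xs_def cl_def by simp
  have gen': "D.drift H Xs r = stopped_generator T R \<rho> gt gx gxx r" for r by (rule ext) (rule gen)
  show "set_integrable lborel {0..T} (\<lambda>r. expectation (stopped_generator T R \<rho> gt gx gxx r))"
    and "integrable M (stopped_generator T R \<rho> gt gx gxx r)"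
    using D.drift_integrable[OF Xsj Hj HB] unfolding gen' by auto
  have E: "expectation (\<lambda>\<omega>. g (\<Theta> T \<omega>) (Xs T \<omega>)) - expectation (\<lambda>\<omega>. g (\<Theta> 0 \<omega>) (Xs 0 \<omega>)) = (LINT r:{0..T}|lborel. expectation (D.drift H Xs r))"
    using D.ito_bounded_integrand[OF I Hj HB HH] unfolding Y by blast
  have e1: "expectation (\<lambda>\<omega>. g (\<Theta> T \<omega>) (Xs T \<omega>)) = expectation (\<lambda>\<omega>. g (\<rho> \<omega>) (X (\<rho> \<omega>) \<omega>))"
    using \<rho>T T by (intro Bochner_Integration.integral_cong refl) (simp add: \<Theta>_def Xs_def max_absorb2 min_absorb2)
  have "expectation (\<lambda>\<omega>. g (\<Theta> 0 \<omega>) (Xs 0 \<omega>)) = expectation (\<lambda>\<omega>. g 0 \<xi>)"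
  proof (rule integral_cong_AE)
    show "(\<lambda>\<omega>. g (\<Theta> 0 \<omega>) (Xs 0 \<omega>)) \<in> borel_measurable M"
      using measurable_Pair2[OF D.along_joint[of g, OF _ Xsj], of 0] by simp
    show "AE \<omega> in M. g (\<Theta> 0 \<omega>) (Xs 0 \<omega>) = g 0 \<xi>"
      using X_initial AE_space by eventually_elim (use \<rho>(2) T in \<open>simp add: \<Theta>_def Xs_def min_absorb1\<close>)
  qed simp
  then have e2: "expectation (\<lambda>\<omega>. g (\<Theta> 0 \<omega>) (Xs 0 \<omega>)) = g 0 \<xi>" by (simp add: prob_space)
  show "expectation (\<lambda>\<omega>. g (\<rho> \<omega>) (X (\<rho> \<omega>) \<omega>)) - g 0 \<xi> = (LINT r:{0..T}|lborel. expectation (stopped_generator T R \<rho> gt gx gxx r))"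
    using E unfolding e1 e2 gen' .
qed

end

context sde_setting begin

text \<open>
  Dynkin's formula between two stopping times: the two drifts cancel up to \<open>\<rho>1\<close>, and between \<open>\<rho>1\<close>
  and \<open>\<rho>2\<close> at most \<open>C\<close> is gained per unit of time.
\<close>

lemma dynkin_difference:
  assumes st: "stopping_time F \<rho>1" "stopping_time F \<rho>2"
    and ord: "\<And>\<omega>. \<omega> \<in> space M \<Longrightarrow> 0 \<le> \<rho>1 \<omega>" "\<And>\<omega>. \<omega> \<in> space M \<Longrightarrow> \<rho>1 \<omega> \<le> \<rho>2 \<omega>"
      "\<And>\<omega>. \<omega> \<in> space M \<Longrightarrow> ereal (\<rho>2 \<omega>) < \<tau> \<omega>" "\<And>\<omega>. \<omega> \<in> space M \<Longrightarrow> \<rho>2 \<omega> \<le> T"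
      "\<And>\<omega>. \<omega> \<in> space M \<Longrightarrow> \<rho>2 \<omega> \<le> \<rho>1 \<omega> + c"
    and T: "0 \<le> T" and R: "0 \<le> R"
    and bound: "AE \<omega> in M. \<forall>r. 0 \<le> r \<longrightarrow> r \<le> \<rho>2 \<omega> \<longrightarrow> \<bar>X r \<omega>\<bar> \<le> R"
    and test: "test_function T g gt gx gxx"
    and gen: "\<And>s x. s \<in> {0..T} \<Longrightarrow> \<bar>x\<bar> \<le> R \<Longrightarrow> \<bar>gt s x + b x * gx s x + 1/2 * (\<sigma> x)\<^sup>2 * gxx s x\<bar> \<le> C"
    and C: "0 \<le> C"
  shows "\<bar>expectation (\<lambda>\<omega>. g (\<rho>2 \<omega>) (X (\<rho>2 \<omega>) \<omega>)) - expectation (\<lambda>\<omega>. g (\<rho>1 \<omega>) (X (\<rho>1 \<omega>) \<omega>))\<bar> \<le> C * c"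
proof -
  have ord': "0 \<le> \<rho>2 \<omega>" "ereal (\<rho>1 \<omega>) < \<tau> \<omega>" "\<rho>1 \<omega> \<le> T" if "\<omega> \<in> space M" for \<omega>
    using ord(1-4)[OF that] by (auto intro: le_less_trans[of "ereal _" "ereal (\<rho>2 \<omega>)"])
  have bound1: "AE \<omega> in M. \<forall>r. 0 \<le> r \<longrightarrow> r \<le> \<rho>1 \<omega> \<longrightarrow> \<bar>X r \<omega>\<bar> \<le> R"
    using bound AE_space by eventually_elim (use ord(2) order_trans in blast)
  define G1 where "G1 = stopped_generator T R \<rho>1 gt gx gxx"
  define G2 where "G2 = stopped_generator T R \<rho>2 gt gx gxx"
  have D1: "expectation (\<lambda>\<omega>. g (\<rho>1 \<omega>) (X (\<rho>1 \<omega>) \<omega>)) - g 0 \<xi> = (LINT r:{0..T}|lborel. expectation (G1 r))"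
    "set_integrable lborel {0..T} (\<lambda>r. expectation (G1 r))" "integrable M (G1 r)" for r
    unfolding G1_def
    by - (rule dynkin_formula(1)[OF st(1) _ _ _ T R bound1 test], simp_all only: ord ord',
      rule dynkin_formula(2)[OF st(1) _ _ _ T R bound1 test], simp_all only: ord ord',
      rule dynkin_formula(3)[OF st(1) _ _ _ T R bound1 test], simp_all only: ord ord')
  have D2: "expectation (\<lambda>\<omega>. g (\<rho>2 \<omega>) (X (\<rho>2 \<omega>) \<omega>)) - g 0 \<xi> = (LINT r:{0..T}|lborel. expectation (G2 r))"
    "set_integrable lborel {0..T} (\<lambda>r. expectation (G2 r))" "integrable M (G2 r)" for r
    unfolding G2_def
    by - (rule dynkin_formula(1)[OF st(2) _ _ _ T R bound test], simp_all only: ord ord',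
      rule dynkin_formula(2)[OF st(2) _ _ _ T R bound test], simp_all only: ord ord',
      rule dynkin_formula(3)[OF st(2) _ _ _ T R bound test], simp_all only: ord ord')
  define K where "K r \<omega> = (indicator {\<rho>1 \<omega><..\<rho>2 \<omega>} r :: real)" for r \<omega>
  have [measurable]: "\<rho>1 \<in> borel_measurable M" "\<rho>2 \<in> borel_measurable M"
    using st by (auto intro: stopping_time_measurable)
  have Kj: "(\<lambda>(r, \<omega>). K r \<omega>) \<in> borel_measurable (borel \<Otimes>\<^sub>M M)"
  proof -
    have "(\<lambda>(r, \<omega>). K r \<omega>) = (\<lambda>p. if \<rho>1 (snd p) < fst p \<and> fst p \<le> \<rho>2 (snd p) then 1 else 0)"
      by (auto simp: K_def indicator_def fun_eq_iff)
    then show ?thesis by (simp only:) measurable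
  qed
  have KB: "\<bar>K r \<omega>\<bar> \<le> 1" for r \<omega> by (simp add: K_def indicator_def)
  have fK: "set_integrable lborel {0..T} (\<lambda>r. expectation (K r))" "integrable M (\<lambda>\<omega>. LINT r:{0..T}|lborel. K r \<omega>)"
    "(LINT r:{0..T}|lborel. expectation (K r)) = expectation (\<lambda>\<omega>. LINT r:{0..T}|lborel. K r \<omega>)"
    by (rule fubini_bounded[OF Kj KB])+
  have Ki: "integrable M (K r)" for r
    using measurable_Pair2[OF Kj, of r] KB by (intro integrable_const_bound[where B=1]) auto
  have close: "\<bar>expectation (G2 r) - expectation (G1 r)\<bar> \<le> C * expectation (K r)" if r: "r \<in> {0..T}" for r
  proof -
    have "\<bar>expectation (\<lambda>\<omega>. G2 r \<omega> - G1 r \<omega>)\<bar> \<le> expectation (\<lambda>\<omega>. C * K r \<omega>)"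
    proof (rule expectation_dominated(2))
      show "(\<lambda>\<omega>. G2 r \<omega> - G1 r \<omega>) \<in> borel_measurable M"
        using D1(3)[of r] D2(3)[of r] by (intro borel_measurable_diff borel_measurable_integrable)
      show "integrable M (\<lambda>\<omega>. C * K r \<omega>)" using Ki by simp
      show "AE \<omega> in M. \<bar>G2 r \<omega> - G1 r \<omega>\<bar> \<le> C * K r \<omega>"
        using bound AE_space
      proof eventually_elim
        case (elim \<omega>)
        consider "r \<le> \<rho>1 \<omega>" | "\<rho>1 \<omega> < r" "r \<le> \<rho>2 \<omega>" | "\<rho>2 \<omega> < r" by linarith
        then show ?case
        proof cases
          case 1
          then have "r \<le> \<rho>2 \<omega>" using ord(2)[OF elim(2)] by simp
          then have "G2 r \<omega> = G1 r \<omega>" using 1 r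
            by (simp add: G1_def G2_def stopped_generator_def min_absorb1 max_absorb2)
          then show ?thesis using 1 by (simp add: K_def)
        next
          case 2
          have "\<bar>X r \<omega>\<bar> \<le> R" using elim(1) 2 r by auto
          then have "max (-R) (min R (X r \<omega>)) = X r \<omega>" by auto
          moreover have "G1 r \<omega> = 0" using 2 by (simp add: G1_def stopped_generator_def)
          ultimately show ?thesis using 2 r gen[OF r \<open>\<bar>X r \<omega>\<bar> \<le> R\<close>]
            by (simp add: G2_def stopped_generator_def min_absorb1 min_absorb2 max_absorb2 K_def Let_def)
        next
          case 3
          then have "\<rho>1 \<omega> < r" using ord(2)[OF elim(2)] by simp
          then show ?thesis using 3 by (simp add: G1_def G2_def stopped_generator_def K_def)
        qed
      qed
    qed
    then show ?thesis using D1(3)[of r] D2(3)[of r] by simp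
  qed
  have "\<bar>expectation (\<lambda>\<omega>. g (\<rho>2 \<omega>) (X (\<rho>2 \<omega>) \<omega>)) - expectation (\<lambda>\<omega>. g (\<rho>1 \<omega>) (X (\<rho>1 \<omega>) \<omega>))\<bar>
    = \<bar>(LINT r:{0..T}|lborel. expectation (G2 r)) - (LINT r:{0..T}|lborel. expectation (G1 r))\<bar>"
    using D1(1) D2(1) by simp
  also have "\<dots> = \<bar>LINT r:{0..T}|lborel. expectation (G2 r) - expectation (G1 r)\<bar>"
    using set_integral_diff(2)[OF D2(2) D1(2)] by simp
  also have "\<dots> \<le> (LINT r:{0..T}|lborel. \<bar>expectation (G2 r) - expectation (G1 r)\<bar>)"
    using set_integral_norm_bound[OF set_integral_diff(1)[OF D2(2) D1(2)]] by simp
  also have "\<dots> \<le> (LINT r:{0..T}|lborel. C * expectation (K r))"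
    by (rule set_integral_mono[OF set_integrable_abs[OF set_integral_diff(1)[OF D2(2) D1(2)]] _ close])
      (rule set_integrable_mult_right, rule fK(1))
  also have "\<dots> = C * expectation (\<lambda>\<omega>. LINT r:{0..T}|lborel. K r \<omega>)" using fK(3) by simp
  also have "\<dots> \<le> C * c"
  proof (rule mult_left_mono[OF _ C])
    have "(LINT r:{0..T}|lborel. K r \<omega>) \<le> c" if "\<omega> \<in> space M" for \<omega>
    proof -
      have ind: "indicator {0..T} r *\<^sub>R K r \<omega> = indicator {\<rho>1 \<omega><..\<rho>2 \<omega>} r" for r
        using ord(1,4)[OF that] by (auto simp: K_def indicator_def)
      show ?thesis unfolding set_lebesgue_integral_def ind using ord(2,5)[OF that] by simp
    qed
    then have "expectation (\<lambda>\<omega>. LINT r:{0..T}|lborel. K r \<omega>) \<le> expectation (\<lambda>\<omega>. c)"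
      using fK(2) by (intro integral_mono) auto
    then show "expectation (\<lambda>\<omega>. LINT r:{0..T}|lborel. K r \<omega>) \<le> c" by (simp add: prob_space)
  qed
  finally show ?thesis .
qed

section \<open>Hitting times and exit times\<close>

text \<open>
  The times between \<open>\<alpha>\<close> and \<open>\<kappa>\<close> at which \<open>D X\<close> has reached the level \<open>c\<close>. Exit from a bounded
  interval is the case of \<open>D x = \<bar>x\<bar>\<close>, and return to one the case of \<open>D x = - \<bar>x\<bar>\<close>. The hitting
  time is \<open>\<kappa>\<close> if the level is not reached.
\<close>

definition hitting_set :: "(real \<Rightarrow> real) \<Rightarrow> real \<Rightarrow> ('a \<Rightarrow> real) \<Rightarrow> ('a \<Rightarrow> real) \<Rightarrow> 'a \<Rightarrow> real set" where
  "hitting_set D c \<alpha> \<kappa> \<omega> = {s. \<alpha> \<omega> \<le> s \<and> s \<le> \<kappa> \<omega> \<and> ereal s < \<tau> \<omega> \<and> c \<le> D (X s \<omega>)}"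

definition hitting_time :: "(real \<Rightarrow> real) \<Rightarrow> real \<Rightarrow> ('a \<Rightarrow> real) \<Rightarrow> ('a \<Rightarrow> real) \<Rightarrow> 'a \<Rightarrow> real" where
  "hitting_time D c \<alpha> \<kappa> \<omega> = Inf (insert (\<kappa> \<omega>) (hitting_set D c \<alpha> \<kappa> \<omega>))"

lemma continuous_along_path:
  assumes "\<omega> \<in> space M" "continuous_on UNIV D" "0 \<le> a" "ereal e < \<tau> \<omega>"
  shows "continuous_on {a..e} (\<lambda>s. D (X s \<omega>))"
proof -
  have "continuous_on {a..e} (\<lambda>s. X s \<omega>)"
    by (rule continuous_on_subset[OF X_continuous[OF assms(1)]])
      (use assms in \<open>auto intro: le_less_trans[of "ereal _" "ereal e"]\<close>)
  then show ?thesis by (intro continuous_on_compose2[OF assms(2)]) auto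
qed

lemma hitting_time_attained:
  assumes \<omega>: "\<omega> \<in> space M" and a: "0 \<le> \<alpha> \<omega>" and D: "continuous_on UNIV D"
    and ne: "hitting_set D c \<alpha> \<kappa> \<omega> \<noteq> {}"
  shows "hitting_time D c \<alpha> \<kappa> \<omega> \<in> hitting_set D c \<alpha> \<kappa> \<omega>"
proof -
  obtain s1 where s1: "\<alpha> \<omega> \<le> s1" "s1 \<le> \<kappa> \<omega>" "ereal s1 < \<tau> \<omega>" "c \<le> D (X s1 \<omega>)"
    using ne by (auto simp: hitting_set_def)
  define S where "S = {s\<in>{\<alpha> \<omega>..s1}. c \<le> D (X s \<omega>)}"
  have "closed S" unfolding S_def
    by (intro continuous_on_closed_Collect_le continuous_on_const continuous_along_path \<omega> D a s1) auto
  then have m: "Inf S \<in> S" using s1 by (intro closed_contains_Inf) (auto simp: S_def intro!: bdd_belowI[of _ "\<alpha> \<omega>"])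
  then have in_set: "Inf S \<in> hitting_set D c \<alpha> \<kappa> \<omega>"
    using s1 by (auto simp: S_def hitting_set_def intro: le_less_trans[of "ereal _" "ereal s1"])
  have "hitting_time D c \<alpha> \<kappa> \<omega> = Inf S"
    unfolding hitting_time_def
  proof (rule cInf_eq_minimum)
    show "Inf S \<in> insert (\<kappa> \<omega>) (hitting_set D c \<alpha> \<kappa> \<omega>)" using in_set by simp
    have lower: "Inf S \<le> s" if "s \<in> S" for s
      using that by (intro cInf_lower) (auto simp: S_def intro!: bdd_belowI[of _ "\<alpha> \<omega>"])
    fix s assume "s \<in> insert (\<kappa> \<omega>) (hitting_set D c \<alpha> \<kappa> \<omega>)"
    moreover have "Inf S \<le> s1" using m by (auto simp: S_def)
    ultimately show "Inf S \<le> s"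
      using lower[of s] s1 by (cases "s \<le> s1") (auto simp: S_def hitting_set_def)
  qed
  then show ?thesis using in_set by simp
qed

lemma hitting_time_bounds:
  assumes "\<alpha> \<omega> \<le> \<kappa> \<omega>"
  shows "\<alpha> \<omega> \<le> hitting_time D c \<alpha> \<kappa> \<omega>" "hitting_time D c \<alpha> \<kappa> \<omega> \<le> \<kappa> \<omega>"
    and "s \<in> hitting_set D c \<alpha> \<kappa> \<omega> \<Longrightarrow> hitting_time D c \<alpha> \<kappa> \<omega> \<le> s"
    and "hitting_set D c \<alpha> \<kappa> \<omega> = {} \<Longrightarrow> hitting_time D c \<alpha> \<kappa> \<omega> = \<kappa> \<omega>"
proof -
  have bdd: "bdd_below (insert (\<kappa> \<omega>) (hitting_set D c \<alpha> \<kappa> \<omega>))"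
    using assms by (intro bdd_belowI[of _ "\<alpha> \<omega>"]) (auto simp: hitting_set_def)
  show "\<alpha> \<omega> \<le> hitting_time D c \<alpha> \<kappa> \<omega>"
    unfolding hitting_time_def using assms by (intro cInf_greatest) (auto simp: hitting_set_def)
  show "hitting_time D c \<alpha> \<kappa> \<omega> \<le> \<kappa> \<omega>" "s \<in> hitting_set D c \<alpha> \<kappa> \<omega> \<Longrightarrow> hitting_time D c \<alpha> \<kappa> \<omega> \<le> s"
    unfolding hitting_time_def using bdd by (auto intro: cInf_lower)
  show "hitting_set D c \<alpha> \<kappa> \<omega> = {} \<Longrightarrow> hitting_time D c \<alpha> \<kappa> \<omega> = \<kappa> \<omega>"
    unfolding hitting_time_def by simp
qed

text \<open>
  The filtration need not be right-continuous, so the event has to be expressed by the path up to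
  time \<open>t\<close>. By continuity on the compact interval \<open>{\<alpha> \<omega>..t}\<close>, the level \<open>c\<close> is reached iff it is
  approached at rational times or at \<open>t\<close> itself. The values of \<open>X\<close> enter only in the form in which
  they are adapted.
\<close>

lemma hitting_time_le_iff:
  assumes \<omega>: "\<omega> \<in> space M" and a: "0 \<le> \<alpha> \<omega>" "\<alpha> \<omega> \<le> \<kappa> \<omega>" and D: "continuous_on UNIV D" and t: "0 \<le> t"
    and before: "ereal (hitting_time D c \<alpha> \<kappa> \<omega>) < \<tau> \<omega>"
  shows "hitting_time D c \<alpha> \<kappa> \<omega> \<le> t \<longleftrightarrow> \<kappa> \<omega> \<le> t \<or> \<tau> \<omega> \<le> ereal t \<or>
    (\<forall>k. \<exists>q\<in>insert t (\<rat> \<inter> {0..t}). \<alpha> \<omega> \<le> q \<and> c - 1 / real (Suc k) < D (if ereal q < \<tau> \<omega> then X q \<omega> else 0))"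
    (is "?hit \<le> t \<longleftrightarrow> _ \<or> _ \<or> ?near")
proof
  assume le: "?hit \<le> t"
  show "\<kappa> \<omega> \<le> t \<or> \<tau> \<omega> \<le> ereal t \<or> ?near"
  proof (cases "\<kappa> \<omega> \<le> t \<or> \<tau> \<omega> \<le> ereal t")
    case False
    then have \<kappa>: "t < \<kappa> \<omega>" and \<tau>: "ereal t < \<tau> \<omega>" by auto
    have "hitting_set D c \<alpha> \<kappa> \<omega> \<noteq> {}" using hitting_time_bounds(4)[of \<alpha> \<omega> \<kappa> D c] a le \<kappa> by auto
    then have "?hit \<in> hitting_set D c \<alpha> \<kappa> \<omega>" using hitting_time_attained[where \<alpha>=\<alpha> and \<kappa>=\<kappa> and \<omega>=\<omega> and D=D and c=c] \<omega> a(1) D by blast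
    then have hit: "\<alpha> \<omega> \<le> ?hit" "c \<le> D (X ?hit \<omega>)" by (auto simp: hitting_set_def)
    have ?near
    proof
      fix k
      have e: "0 < 1 / real (Suc k)" by simp
      show "\<exists>q\<in>insert t (\<rat> \<inter> {0..t}). \<alpha> \<omega> \<le> q \<and> c - 1 / real (Suc k) < D (if ereal q < \<tau> \<omega> then X q \<omega> else 0)"
      proof (cases "?hit = t")
        case True
        have "c - 1 / real (Suc k) < c" using e by linarith
        also have "c \<le> D (X t \<omega>)" using hit(2) unfolding True .
        finally have "c - 1 / real (Suc k) < D (X t \<omega>)" .
        then show ?thesis using True hit(1) \<tau> by (intro bexI[of _ t]) simp_all
      next
        case False
        then have lt: "?hit < t" using le by simp
        have "continuous_on {0..t} (\<lambda>s. D (X s \<omega>))" by (rule continuous_along_path[OF \<omega> D order_refl \<tau>])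
        then obtain d where d: "0 < d" "\<And>s. s \<in> {0..t} \<Longrightarrow> dist s ?hit < d \<Longrightarrow> dist (D (X s \<omega>)) (D (X ?hit \<omega>)) < 1 / real (Suc k)"
          unfolding continuous_on_iff using e hit(1) a le by (metis atLeastAtMost_iff order_trans)
        obtain q where q: "q \<in> \<rat>" "?hit < q" "q < min t (?hit + d)" using Rats_dense_in_real[of ?hit "min t (?hit + d)"] lt d(1) by auto
        have "q \<in> {0..t}" using q hit(1) a by auto
        moreover have "dist q ?hit < d" using q by (auto simp: dist_real_def)
        ultimately have "\<bar>D (X q \<omega>) - D (X ?hit \<omega>)\<bar> < 1 / real (Suc k)" using d(2) by (simp add: dist_real_def)
        moreover have "ereal q < \<tau> \<omega>" using q \<tau> by (auto intro: less_trans[of "ereal q" "ereal t"])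
        ultimately show ?thesis using q hit \<open>q \<in> {0..t}\<close> by (intro bexI[of _ q]) auto
      qed
    qed
    then show ?thesis by simp
  qed auto
next
  assume "\<kappa> \<omega> \<le> t \<or> \<tau> \<omega> \<le> ereal t \<or> ?near"
  then consider "\<kappa> \<omega> \<le> t" | "\<tau> \<omega> \<le> ereal t" | "t < \<kappa> \<omega>" "ereal t < \<tau> \<omega>" ?near by fastforce
  then show "?hit \<le> t"
  proof cases
    case 1 then show ?thesis using hitting_time_bounds(2)[of \<alpha> \<omega> \<kappa> D c] a by simp
  next
    case 2
    then have "ereal ?hit < ereal t" using before by (rule less_le_trans[rotated])
    then show ?thesis by simp
  next
    case 3
    have "continuous_on {\<alpha> \<omega>..t} (\<lambda>s. D (X s \<omega>))" by (rule continuous_along_path[OF \<omega> D a(1) 3(2)])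
    moreover have "\<alpha> \<omega> \<le> t" using 3(3)[rule_format, of 0] by auto
    ultimately obtain s where s: "s \<in> {\<alpha> \<omega>..t}" "\<And>s'. s' \<in> {\<alpha> \<omega>..t} \<Longrightarrow> D (X s' \<omega>) \<le> D (X s \<omega>)"
      using continuous_attains_sup[of "{\<alpha> \<omega>..t}" "\<lambda>s. D (X s \<omega>)"] by auto
    have "c \<le> D (X s \<omega>)"
    proof (rule ccontr)
      assume "\<not> c \<le> D (X s \<omega>)"
      then have "0 < c - D (X s \<omega>)" by simp
      then obtain k where k: "inverse (real (Suc k)) < c - D (X s \<omega>)" using reals_Archimedean by blast
      obtain q where q: "q \<in> insert t (\<rat> \<inter> {0..t})" "\<alpha> \<omega> \<le> q" "c - 1 / real (Suc k) < D (if ereal q < \<tau> \<omega> then X q \<omega> else 0)"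
        using 3(3) by blast
      have "q \<le> t" using q(1) t by auto
      then have "ereal q < \<tau> \<omega>" using 3(2) by (auto intro: le_less_trans[of "ereal q" "ereal t"])
      then have "D (X s \<omega>) < D (X q \<omega>)" using q(3) k by (simp add: inverse_eq_divide)
      then show False using s(2)[of q] q(2) \<open>q \<le> t\<close> by auto
    qed
    then have "s \<in> hitting_set D c \<alpha> \<kappa> \<omega>"
      using s(1) 3 by (auto simp: hitting_set_def intro: le_less_trans[of "ereal _" "ereal t"])
    then have "?hit \<le> s" using hitting_time_bounds(3)[where \<alpha>=\<alpha> and \<kappa>=\<kappa> and \<omega>=\<omega>] a(2) by blast
    then show ?thesis using s(1) by auto
  qed
qed

lemma hitting_time_stopping:
  assumes \<alpha>: "stopping_time F \<alpha>" and \<kappa>: "stopping_time F \<kappa>"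
    and a: "\<And>\<omega>. \<omega> \<in> space M \<Longrightarrow> 0 \<le> \<alpha> \<omega>" "\<And>\<omega>. \<omega> \<in> space M \<Longrightarrow> \<alpha> \<omega> \<le> \<kappa> \<omega>"
    and D: "continuous_on UNIV D"
    and before: "\<And>\<omega>. \<omega> \<in> space M \<Longrightarrow> ereal (hitting_time D c \<alpha> \<kappa> \<omega>) < \<tau> \<omega>"
  shows "stopping_time F (hitting_time D c \<alpha> \<kappa>)"
proof
  fix t
  show "Measurable.pred (F t) (\<lambda>\<omega>. hitting_time D c \<alpha> \<kappa> \<omega> \<le> t)"
  proof (cases "0 \<le> t")
    case False
    have "\<not> hitting_time D c \<alpha> \<kappa> \<omega> \<le> t" if "\<omega> \<in> space (F t)" for \<omega>
    proof -
      have "\<omega> \<in> space M" using that by simp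
      then have "0 \<le> hitting_time D c \<alpha> \<kappa> \<omega>"
        using a(1)[of \<omega>] a(2)[of \<omega>] hitting_time_bounds(1)[where \<alpha>=\<alpha> and \<kappa>=\<kappa> and \<omega>=\<omega> and D=D and c=c] by linarith
      then show ?thesis using False by linarith
    qed
    then have "{\<omega> \<in> space (F t). hitting_time D c \<alpha> \<kappa> \<omega> \<le> t} = {}" by blast
    then show ?thesis unfolding pred_def by (simp only: sets.empty_sets)
  next
    case True
    have Dm [measurable]: "D \<in> borel_measurable borel" using D by (rule borel_measurable_continuous_onI)
    have km: "Measurable.pred (F t) (\<lambda>\<omega>. \<kappa> \<omega> \<le> t)" "Measurable.pred (F t) (\<lambda>\<omega>. \<tau> \<omega> \<le> ereal t)"
      using stopping_timeD[OF \<kappa>] \<tau>_stopping[OF True] by auto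
    have q: "Measurable.pred (F t) (\<lambda>\<omega>. \<alpha> \<omega> \<le> q \<and> c - 1 / real (Suc k) < D (if ereal q < \<tau> \<omega> then X q \<omega> else 0))"
      if "q \<in> insert t (\<rat> \<inter> {0..t})" for q k
    proof -
      have q: "0 \<le> q" "q \<le> t" using that True by auto
      have [measurable]: "(\<lambda>\<omega>. if ereal q < \<tau> \<omega> then X q \<omega> else 0) \<in> borel_measurable (F t)" "Measurable.pred (F t) (\<lambda>\<omega>. \<alpha> \<omega> \<le> q)"
        using measurable_F_mono[OF X_adapted[OF q(1)] q(2)] stopping_time_le_measurable[OF \<alpha> q(2)] by auto
      show ?thesis by measurable
    qed
    have cnt: "countable (insert t (\<rat> \<inter> {0..t}))" using countable_rat by auto
    have ex: "Measurable.pred (F t) (\<lambda>\<omega>. \<exists>q\<in>insert t (\<rat> \<inter> {0..t}). P q \<omega>)"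
      if "\<And>q. q \<in> insert t (\<rat> \<inter> {0..t}) \<Longrightarrow> Measurable.pred (F t) (P q)" for P :: "real \<Rightarrow> 'a \<Rightarrow> bool"
    proof -
      have "(\<Union>q\<in>insert t (\<rat> \<inter> {0..t}). {\<omega>\<in>space (F t). P q \<omega>}) \<in> sets (F t)"
        using that by (intro sets.countable_UN'' cnt) (simp add: pred_def)
      moreover have "(\<Union>q\<in>insert t (\<rat> \<inter> {0..t}). {\<omega>\<in>space (F t). P q \<omega>}) = {\<omega>\<in>space (F t). \<exists>q\<in>insert t (\<rat> \<inter> {0..t}). P q \<omega>}" by blast
      ultimately show ?thesis by (simp only: pred_def)
    qed
    have "Measurable.pred (F t) (\<lambda>\<omega>. \<kappa> \<omega> \<le> t \<or> \<tau> \<omega> \<le> ereal t \<or>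
      (\<forall>k. \<exists>q\<in>insert t (\<rat> \<inter> {0..t}). \<alpha> \<omega> \<le> q \<and> c - 1 / real (Suc k) < D (if ereal q < \<tau> \<omega> then X q \<omega> else 0)))"
    proof (intro pred_intros_logic(5) pred_intros_countable(1) ex)
    qed (rule km q, assumption?)+
    then show ?thesis
      by (rule measurable_cong[THEN iffD1, rotated])
        (use hitting_time_le_iff[OF _ a D True before] in auto)
  qed
qed

text \<open>
  The regular paths. The solution is specified almost surely only, whereas the stopping times in
  the equation have to be below \<open>\<tau>\<close> on the whole space; stopping at time \<open>0\<close> outside of \<open>good\<close>
  achieves this.
\<close>

definition good :: "'a \<Rightarrow> bool" where
  "good \<omega> \<longleftrightarrow> X 0 \<omega> = \<xi> \<and> (\<tau> \<omega> < \<infinity> \<longrightarrow> Limsup (at_left (real_of_ereal (\<tau> \<omega>))) (\<lambda>t. ereal \<bar>X t \<omega>\<bar>) = \<infinity>)"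

lemma AE_good: "AE \<omega> in M. good \<omega>"
  using X_initial explodes by eventually_elim (simp add: good_def)

lemma good_unbounded:
  assumes \<omega>: "\<omega> \<in> space M" and g: "good \<omega>" and \<tau>: "\<tau> \<omega> \<le> ereal t" and a: "ereal a < \<tau> \<omega>"
  shows "\<exists>s>a. 0 \<le> s \<and> ereal s < \<tau> \<omega> \<and> c < \<bar>X s \<omega>\<bar>"
proof -
  obtain T where T: "\<tau> \<omega> = ereal T" using \<tau> \<tau>_pos[OF \<omega>] by (cases "\<tau> \<omega>") auto
  then have T0: "0 < T" "a < T" using \<tau>_pos[OF \<omega>] a by auto
  have L: "Limsup (at_left T) (\<lambda>t. ereal \<bar>X t \<omega>\<bar>) = \<infinity>" using g T by (simp add: good_def)
  show ?thesis
  proof (rule ccontr)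
    assume "\<not> ?thesis"
    then have no: "\<bar>X s \<omega>\<bar> \<le> c" if "a < s" "0 \<le> s" "s < T" for s 
    proof -
      have "ereal s < \<tau> \<omega>" using T that by simp
      then show ?thesis using \<open>\<not> (\<exists>s>a. 0 \<le> s \<and> ereal s < \<tau> \<omega> \<and> c < \<bar>X s \<omega>\<bar>)\<close> that not_less by blast
    qed
    have "\<forall>y>max 0 a. y < T \<longrightarrow> ereal \<bar>X y \<omega>\<bar> \<le> ereal c" by (auto intro!: no)
    then have "\<forall>\<^sub>F y in at_left T. ereal \<bar>X y \<omega>\<bar> \<le> ereal c"
      unfolding eventually_at_left_field using T0 by (intro exI[of _ "max 0 a"]) auto
    then have "Limsup (at_left T) (\<lambda>t. ereal \<bar>X t \<omega>\<bar>) \<le> ereal c" by (rule Limsup_bounded)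
    then show False using L by simp
  qed
qed

text \<open>
  This is a stopping time because the null sets belong to \<open>F 0\<close>.
\<close>

definition horizon :: "real \<Rightarrow> 'a \<Rightarrow> real" where "horizon T \<omega> = (if good \<omega> then T else 0)"

lemma horizon_stopping:
  assumes T: "0 \<le> T" shows "stopping_time F (horizon T)"
proof
  fix t
  interpret C: complete_measure M by (rule complete)
  have "{\<omega>\<in>space M. \<not> good \<omega>} \<in> null_sets M" using AE_good unfolding C.AE_iff_null_sets .
  then have N: "{\<omega>\<in>space M. \<not> good \<omega>} \<in> sets (F 0)" using filt by (auto simp: complete_filtration_def)
  consider "T \<le> t" | "0 \<le> t" "t < T" | "t < 0" by linarith
  then show "Measurable.pred (F t) (\<lambda>\<omega>. horizon T \<omega> \<le> t)"
  proof cases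
    case 1
    then have "(\<lambda>\<omega>. horizon T \<omega> \<le> t) = (\<lambda>\<omega>. True)" using T by (auto simp: horizon_def)
    then show ?thesis by simp
  next
    case 2
    then have "{\<omega>\<in>space (F t). horizon T \<omega> \<le> t} = {\<omega>\<in>space M. \<not> good \<omega>}" by (auto simp: horizon_def)
    then show ?thesis unfolding pred_def using N sets_F_mono[OF 2(1)] by auto
  next
    case 3
    then have "(\<lambda>\<omega>. horizon T \<omega> \<le> t) = (\<lambda>\<omega>. False)" using T by (auto simp: horizon_def)
    then show ?thesis by simp
  qed
qed

lemma continuous_abs: "continuous_on UNIV (abs :: real \<Rightarrow> real)"
  using continuous_on_rabs[OF continuous_on_id, of UNIV] by simp

text \<open>
  The exit time from \<open>{-m<..<m}\<close>, but at most \<open>T\<close>. It is below \<open>\<tau>\<close> even if \<open>\<tau> \<le> T\<close>, since a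
  regular path is unbounded before its explosion.
\<close>

definition exit_time :: "real \<Rightarrow> real \<Rightarrow> 'a \<Rightarrow> real" where
  "exit_time T m = hitting_time abs m (\<lambda>_. 0) (horizon T)"

lemma exit_time_basic:
  assumes T: "0 \<le> T"
  shows "0 \<le> exit_time T m \<omega>" "exit_time T m \<omega> \<le> T"
    and "\<omega> \<in> space M \<Longrightarrow> ereal (exit_time T m \<omega>) < \<tau> \<omega>"
    and "stopping_time F (exit_time T m)"
proof -
  have h: "0 \<le> horizon T \<omega>" "horizon T \<omega> \<le> T" for \<omega> using T by (auto simp: horizon_def)
  show "0 \<le> exit_time T m \<omega>" "exit_time T m \<omega> \<le> T"
    unfolding exit_time_def using hitting_time_bounds(1,2)[of "\<lambda>_. 0" \<omega> "horizon T" abs m] h(1)[of \<omega>] h(2)[of \<omega>] by linarith+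
  have before: "ereal (hitting_time abs m (\<lambda>_. 0) (horizon T) \<omega>) < \<tau> \<omega>" if \<omega>: "\<omega> \<in> space M" for \<omega>
  proof (cases "hitting_set abs m (\<lambda>_. 0) (horizon T) \<omega> = {}")
    case False
    then have "hitting_time abs m (\<lambda>_. 0) (horizon T) \<omega> \<in> hitting_set abs m (\<lambda>_. 0) (horizon T) \<omega>"
      by (intro hitting_time_attained[OF \<omega>]) (auto intro: continuous_abs)
    then show ?thesis by (simp add: hitting_set_def)
  next
    case True
    have eq: "hitting_time abs m (\<lambda>_. 0) (horizon T) \<omega> = horizon T \<omega>"
      using hitting_time_bounds(4)[of "\<lambda>_. 0" \<omega> "horizon T"] h True by simp
    show ?thesis
    proof (cases "ereal (horizon T \<omega>) < \<tau> \<omega>")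
      case False
      then have g: "good \<omega>" "\<tau> \<omega> \<le> ereal T" using \<tau>_pos[OF \<omega>] by (auto simp: horizon_def zero_ereal_def split: if_splits)
      obtain s where s: "0 < s" "ereal s < \<tau> \<omega>" "m < \<bar>X s \<omega>\<bar>"
        using good_unbounded[OF \<omega> g, of 0 m] \<tau>_pos[OF \<omega>] by (auto simp: zero_ereal_def)
      then have "ereal s < ereal T" using g(2) by (rule_tac less_le_trans)
      then have "s \<in> hitting_set abs m (\<lambda>_. 0) (horizon T) \<omega>" using s g by (auto simp: hitting_set_def horizon_def)
      then show ?thesis using True by simp
    qed (use eq in simp)
  qed
  then show "\<omega> \<in> space M \<Longrightarrow> ereal (exit_time T m \<omega>) < \<tau> \<omega>" by (simp add: exit_time_def)
  show "stopping_time F (exit_time T m)"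
    unfolding exit_time_def
    by (rule hitting_time_stopping[OF stopping_time_const horizon_stopping[OF T]]) (use h before in \<open>auto intro: continuous_abs\<close>)
qed

lemma exit_time_bound:
  assumes \<omega>: "\<omega> \<in> space M" "good \<omega>" and m: "\<bar>\<xi>\<bar> \<le> m" and T: "0 \<le> T" and r: "0 \<le> r" "r \<le> exit_time T m \<omega>"
  shows "\<bar>X r \<omega>\<bar> \<le> m"
proof (rule ccontr)
  assume "\<not> \<bar>X r \<omega>\<bar> \<le> m"
  then have gt: "m < \<bar>X r \<omega>\<bar>" by simp
  have r\<tau>: "ereal r < \<tau> \<omega>" using exit_time_basic(3)[OF T \<omega>(1), of m] r(2) by (auto intro: le_less_trans[of "ereal r" "ereal (exit_time T m \<omega>)"])
  have "continuous_on {0..r} (\<lambda>s. \<bar>X s \<omega>\<bar>)"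
    by (rule continuous_along_path[OF \<omega>(1) continuous_abs order_refl r\<tau>])
  moreover have "\<bar>X 0 \<omega>\<bar> \<le> m" using \<omega>(2) m by (simp add: good_def)
  ultimately obtain s where s: "0 \<le> s" "s \<le> r" "\<bar>X s \<omega>\<bar> = m"
    using IVT'[of "\<lambda>s. \<bar>X s \<omega>\<bar>" 0 m r] gt r(1) by auto
  then have "s < r" using gt by (cases "s = r") auto
  have "s \<in> hitting_set abs m (\<lambda>_. 0) (horizon T) \<omega>"
    using s r exit_time_basic(2)[OF T, of m \<omega>] \<omega>(2) r\<tau>
    by (auto simp: hitting_set_def horizon_def intro: le_less_trans[of "ereal s" "ereal r"])
  then have "exit_time T m \<omega> \<le> s"
    unfolding exit_time_def using T by (intro hitting_time_bounds(3)) (auto simp: horizon_def)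
  then show False using \<open>s < r\<close> r by simp
qed

lemma exit_time_ge:
  assumes \<omega>: "\<omega> \<in> space M" "good \<omega>" and s: "0 \<le> s" "s \<le> T" "\<And>r. 0 \<le> r \<Longrightarrow> r < s \<Longrightarrow> \<bar>X r \<omega>\<bar> < m"
  shows "s \<le> exit_time T m \<omega>"
  unfolding exit_time_def hitting_time_def
proof (rule cInf_greatest)
  fix r assume "r \<in> insert (horizon T \<omega>) (hitting_set abs m (\<lambda>_. 0) (horizon T) \<omega>)"
  then show "s \<le> r" using s \<omega>(2) by (force simp: hitting_set_def horizon_def)
qed simp

lemma exit_time_explosion:
  assumes \<omega>: "\<omega> \<in> space M" "good \<omega>" and m: "\<bar>\<xi>\<bar> \<le> m" and T: "0 \<le> T" and \<tau>: "\<tau> \<omega> \<le> ereal T"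
  shows "\<bar>X (exit_time T m \<omega>) \<omega>\<bar> = m"
proof -
  have "ereal (exit_time T m \<omega>) < ereal T" using exit_time_basic(3)[OF T \<omega>(1), of m] \<tau> by (rule less_le_trans)
  then have "hitting_set abs m (\<lambda>_. 0) (horizon T) \<omega> \<noteq> {}"
    using hitting_time_bounds(4)[of "\<lambda>_. 0" \<omega> "horizon T" abs m] \<omega>(2) T by (auto simp: exit_time_def horizon_def)
  then have "exit_time T m \<omega> \<in> hitting_set abs m (\<lambda>_. 0) (horizon T) \<omega>"
    unfolding exit_time_def by (intro hitting_time_attained[OF \<omega>(1)]) (auto intro: continuous_abs)
  then have "m \<le> \<bar>X (exit_time T m \<omega>) \<omega>\<bar>" by (simp add: hitting_set_def)
  moreover have "\<bar>X (exit_time T m \<omega>) \<omega>\<bar> \<le> m"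
    using exit_time_basic(1)[OF T] by (intro exit_time_bound[OF \<omega> m T]) auto
  ultimately show ?thesis by simp
qed

lemma AE_exit_time_bound:
  assumes "\<bar>\<xi>\<bar> \<le> m" "0 \<le> T"
  shows "AE \<omega> in M. \<forall>r. 0 \<le> r \<longrightarrow> r \<le> exit_time T m \<omega> \<longrightarrow> \<bar>X r \<omega>\<bar> \<le> m"
  using AE_good AE_space by eventually_elim (use exit_time_bound assms in blast)

end

section \<open>Compactly supported functions of the state\<close>

lemma truncated_power_derivative:
  "((\<lambda>y. max 0 y ^ Suc (Suc n)) has_real_derivative real (Suc (Suc n)) * max 0 y ^ Suc n) (at y)" for y :: real
proof -
  consider "0 < y" | "y < 0" | "y = 0" by linarith
  then show ?thesis
  proof cases
    case 1
    have "((\<lambda>y. y ^ Suc (Suc n)) has_real_derivative real (Suc (Suc n)) * max 0 y ^ Suc n) (at y)"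
      using 1 DERIV_pow[of "Suc (Suc n)" y UNIV] by (simp add: max_absorb2)
    then show ?thesis
      by (rule has_field_derivative_transform_within_open[of _ _ _ "{0<..}"]) (use 1 in \<open>auto simp: max_absorb2\<close>)
  next
    case 2
    have "((\<lambda>y. 0) has_real_derivative real (Suc (Suc n)) * max 0 y ^ Suc n) (at y)"
      using 2 by (simp add: max_absorb1)
    then show ?thesis
      by (rule has_field_derivative_transform_within_open[of _ _ _ "{..<0}"]) (use 2 in \<open>auto simp: max_absorb1\<close>)
  next
    case 3
    have "((\<lambda>h :: real. max 0 h ^ Suc n) \<longlongrightarrow> max 0 0 ^ Suc n) (at 0)" by (intro tendsto_intros)
    then have "((\<lambda>h. max 0 h ^ Suc n) \<longlongrightarrow> (0 :: real)) (at 0)" by simp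
    then have "((\<lambda>h. (max 0 (0 + h) ^ Suc (Suc n) - max 0 0 ^ Suc (Suc n)) / h) \<longlongrightarrow> (0 :: real)) (at 0)"
    proof (rule Lim_transform_eventually)
      show "\<forall>\<^sub>F h in at 0. max 0 h ^ Suc n = (max 0 (0 + h) ^ Suc (Suc n) - max 0 0 ^ Suc (Suc n)) / (h :: real)"
        unfolding eventually_at by (intro exI[of _ 1]) (auto simp: max_def)
    qed
    then show ?thesis using 3 by (simp add: DERIV_def)
  qed
qed

lemma truncated_square_derivative: "((\<lambda>y. (max 0 y)\<^sup>2) has_real_derivative 2 * max 0 y) (at y)" for y :: real
  using truncated_power_derivative[of 0 y] by (simp add: power2_eq_square)

lemma truncated_cube_derivative: "((\<lambda>y. (max 0 y) ^ 3) has_real_derivative 3 * (max 0 y)\<^sup>2) (at y)" for y :: real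
  using truncated_power_derivative[of 1 y] by (simp add: eval_nat_numeral)

text \<open>
  The third power is the least one that makes the truncated parabola twice continuously
  differentiable.
\<close>

lemma bump_test_function:
  fixes R T :: real
  defines "p \<equiv> \<lambda>x. max 0 (R\<^sup>2 - x\<^sup>2)"
  assumes R: "0 \<le> R"
  shows "test_function T (\<lambda>s x. p x ^ 3) (\<lambda>s x. 0) (\<lambda>s x. - 6 * x * (p x)\<^sup>2) (\<lambda>s x. 24 * x\<^sup>2 * p x - 6 * (p x)\<^sup>2)"
  unfolding test_function_def
proof (intro conjI ballI allI)
  have inner: "((\<lambda>x. R\<^sup>2 - x\<^sup>2) has_real_derivative - 2 * x) (at x)" for x by (auto intro!: derivative_eq_intros)
  fix s x
  show "((\<lambda>s. p x ^ 3) has_real_derivative 0) (at s within {0..T})" by simp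
  show "((\<lambda>x. p x ^ 3) has_real_derivative - 6 * x * (p x)\<^sup>2) (at x)"
    using DERIV_chain2[OF truncated_cube_derivative inner, of x] by (simp add: p_def algebra_simps)
  have sq: "((\<lambda>x. (p x)\<^sup>2) has_real_derivative 2 * p x * (- 2 * x)) (at x)"
    using DERIV_chain2[OF truncated_square_derivative inner, of x] by (simp add: p_def)
  show "((\<lambda>x. - 6 * x * (p x)\<^sup>2) has_real_derivative 24 * x\<^sup>2 * p x - 6 * (p x)\<^sup>2) (at x)"
    by (rule derivative_eq_intros sq refl)+ (simp add: power2_eq_square algebra_simps)
next
  have z: "p x = 0" if "R \<le> \<bar>x\<bar>" for x
  proof -
    have "R\<^sup>2 \<le> \<bar>x\<bar>\<^sup>2" using that R by (intro power_mono)
    then show ?thesis by (simp add: p_def)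
  qed
  have c: "continuous_on UNIV p" unfolding p_def by (intro continuous_intros)
  have c': "continuous_on S (\<lambda>q. p (snd q))" for S :: "(real \<times> real) set"
    by (intro continuous_on_compose2[OF c] continuous_intros) auto
  fix G :: "real \<Rightarrow> real \<Rightarrow> real" assume "G \<in> {\<lambda>s x. p x ^ 3, \<lambda>s x. 0, \<lambda>s x. - 6 * x * (p x)\<^sup>2, \<lambda>s x. 24 * x\<^sup>2 * p x - 6 * (p x)\<^sup>2}"
  then consider "G = (\<lambda>s x. p x ^ 3)" | "G = (\<lambda>s x. 0)" | "G = (\<lambda>s x. - 6 * x * (p x)\<^sup>2)" | "G = (\<lambda>s x. 24 * x\<^sup>2 * p x - 6 * (p x)\<^sup>2)" by blast
  then show "continuous_on ({0..T} \<times> UNIV) (\<lambda>(s, x). G s x)"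
    by cases (simp_all add: case_prod_unfold, (intro continuous_intros c')+)
  from \<open>G \<in> _\<close> show "\<exists>R. \<forall>s\<in>{0..T}. \<forall>x. R \<le> \<bar>x\<bar> \<longrightarrow> G s x = 0"
    by (intro exI[of _ R]) (auto simp: z)
qed

text \<open>
  Third differences of the truncated cube give a step \<open>s\<close>, that is \<open>0\<close> below \<open>0\<close> and \<open>1\<close> above
  \<open>3\<close>: it is the integral of the quadratic B-spline \<open>s1\<close>. Two such steps, one of them reflected,
  form the cutoff.
\<close>

lemma smooth_cutoff:
  fixes R :: real
  assumes R: "0 \<le> R"
  obtains \<psi> \<psi>1 \<psi>2 :: "real \<Rightarrow> real" where
    "\<And>x. (\<psi> has_real_derivative \<psi>1 x) (at x)" "\<And>x. (\<psi>1 has_real_derivative \<psi>2 x) (at x)" "continuous_on UNIV \<psi>2"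
    "\<And>x. \<bar>x\<bar> \<le> R \<Longrightarrow> \<psi> x = 1 \<and> \<psi>1 x = 0 \<and> \<psi>2 x = 0" "\<And>x. R + 3 \<le> \<bar>x\<bar> \<Longrightarrow> \<psi> x = 0 \<and> \<psi>1 x = 0 \<and> \<psi>2 x = 0"
proof -
  define s where "s y = ((max 0 y) ^ 3 - 3 * (max 0 (y - 1)) ^ 3 + 3 * (max 0 (y - 2)) ^ 3 - (max 0 (y - 3)) ^ 3) / 6" for y :: real
  define s1 where "s1 y = ((max 0 y)\<^sup>2 - 3 * (max 0 (y - 1))\<^sup>2 + 3 * (max 0 (y - 2))\<^sup>2 - (max 0 (y - 3))\<^sup>2) / 2" for y :: real
  define s2 where "s2 y = max 0 y - 3 * max 0 (y - 1) + 3 * max 0 (y - 2) - max 0 (y - 3)" for y :: real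
  have sh: "((\<lambda>y. y - c) has_real_derivative 1) (at y)" for c y :: real by (auto intro!: derivative_eq_intros)
  have cu: "((\<lambda>y. (max 0 (y - c)) ^ 3) has_real_derivative 3 * (max 0 (y - c))\<^sup>2) (at y)"
    and sq: "((\<lambda>y. (max 0 (y - c))\<^sup>2) has_real_derivative 2 * max 0 (y - c)) (at y)" for c y :: real
    using DERIV_chain2[OF truncated_cube_derivative sh, of c y] DERIV_chain2[OF truncated_square_derivative sh, of c y] by simp_all
  have ds: "(s has_real_derivative s1 y) (at y)" for y
    unfolding s_def[abs_def] s1_def
    by (rule derivative_eq_intros cu truncated_cube_derivative refl | simp)+
  have ds1: "(s1 has_real_derivative s2 y) (at y)" for y
    unfolding s1_def[abs_def] s2_def
    by (rule derivative_eq_intros sq truncated_square_derivative refl | simp)+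
  have low: "s y = 0" "s1 y = 0" "s2 y = 0" if "y \<le> 0" for y
    using that by (simp_all add: s_def s1_def s2_def max_absorb1)
  have high: "s y = 1" "s1 y = 0" "s2 y = 0" if "3 \<le> y" for y
    using that by (simp_all add: s_def s1_def s2_def max_absorb2 power3_eq_cube power2_eq_square algebra_simps)
  define \<psi> where "\<psi> x = s (x + R + 3) + s (R + 3 - x) - 1" for x
  define \<psi>1 where "\<psi>1 x = s1 (x + R + 3) - s1 (R + 3 - x)" for x
  define \<psi>2 where "\<psi>2 x = s2 (x + R + 3) + s2 (R + 3 - x)" for x
  have up: "((\<lambda>x. x + R + 3) has_real_derivative 1) (at x)" and down: "((\<lambda>x. R + 3 - x) has_real_derivative - 1) (at x)" for x
    by (auto intro!: derivative_eq_intros)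
  show ?thesis
  proof (rule that[of \<psi> \<psi>1 \<psi>2])
    fix x
    show "(\<psi> has_real_derivative \<psi>1 x) (at x)"
      unfolding \<psi>_def[abs_def] \<psi>1_def
      by (rule derivative_eq_intros DERIV_chain2[OF ds up] DERIV_chain2[OF ds down] refl | simp)+
    show "(\<psi>1 has_real_derivative \<psi>2 x) (at x)"
      unfolding \<psi>1_def[abs_def] \<psi>2_def
      by (rule derivative_eq_intros DERIV_chain2[OF ds1 up] DERIV_chain2[OF ds1 down] refl | simp)+
    show "\<bar>x\<bar> \<le> R \<Longrightarrow> \<psi> x = 1 \<and> \<psi>1 x = 0 \<and> \<psi>2 x = 0"
      using high[of "x + R + 3"] high[of "R + 3 - x"] by (simp add: \<psi>_def \<psi>1_def \<psi>2_def abs_le_iff)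
    show "R + 3 \<le> \<bar>x\<bar> \<Longrightarrow> \<psi> x = 0 \<and> \<psi>1 x = 0 \<and> \<psi>2 x = 0"
      using low[of "x + R + 3"] low[of "R + 3 - x"] high[of "x + R + 3"] high[of "R + 3 - x"] R
      by (auto simp: \<psi>_def \<psi>1_def \<psi>2_def abs_if split: if_splits)
  next
    show "continuous_on UNIV \<psi>2" unfolding \<psi>2_def s2_def by (intro continuous_intros)
  qed
qed

section \<open>The left limit at the explosion time\<close>

text \<open>
  The limes inferior of events is an increasing union, each member of which is contained in almost
  all of the events.
\<close>

lemma (in prob_space) prob_liminf_le:
  assumes E: "\<And>n. E n \<in> events" and le: "\<And>n. N0 \<le> n \<Longrightarrow> prob (E n) \<le> c"
  shows "(\<Union>N. \<Inter>n\<in>{N..}. E n) \<in> events" "prob (\<Union>N. \<Inter>n\<in>{N::nat..}. E n) \<le> c"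
proof -
  have m: "(\<Inter>n\<in>{N..}. E n) \<in> events" for N using E by (intro sets.countable_INT') auto
  then show "(\<Union>N. \<Inter>n\<in>{N..}. E n) \<in> events" by auto
  have "(\<lambda>N. prob (\<Inter>n\<in>{N..}. E n)) \<longlonglongrightarrow> prob (\<Union>N. \<Inter>n\<in>{N..}. E n)"
    using m by (intro finite_Lim_measure_incseq) (auto simp: incseq_def)
  moreover have "prob (\<Inter>n\<in>{N..}. E n) \<le> c" for N
  proof -
    have "prob (\<Inter>n\<in>{N..}. E n) \<le> prob (E (max N N0))" using E by (intro finite_measure_mono) auto
    also have "\<dots> \<le> c" by (rule le) simp
    finally show ?thesis .
  qed
  ultimately show "prob (\<Union>N. \<Inter>n\<in>{N::nat..}. E n) \<le> c" by (intro LIMSEQ_le_const2) auto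
qed

context sde_setting begin

lemma stopped_value_measurable:
  assumes "stopping_time F \<rho>" "\<And>\<omega>. \<omega> \<in> space M \<Longrightarrow> 0 \<le> \<rho> \<omega>" "\<And>\<omega>. \<omega> \<in> space M \<Longrightarrow> ereal (\<rho> \<omega>) < \<tau> \<omega>"
    and "\<And>\<omega>. \<omega> \<in> space M \<Longrightarrow> \<rho> \<omega> \<le> T" "0 \<le> T"
  shows "(\<lambda>\<omega>. X (\<rho> \<omega>) \<omega>) \<in> borel_measurable M"
proof -
  have "(\<lambda>\<omega>. X (min T (\<rho> \<omega>)) \<omega>) \<in> borel_measurable M"
    using stopped_adapted[OF assms(1-3,5)] by (rule measurable_F_M)
  then show ?thesis by (rule measurable_cong[THEN iffD1, rotated]) (use assms(4) in \<open>simp add: min_absorb2\<close>)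
qed

lemma exit_time_mono:
  assumes "m \<le> m'" "0 \<le> T" shows "exit_time T m \<omega> \<le> exit_time T m' \<omega>"
  unfolding exit_time_def hitting_time_def
  by (rule cInf_superset_mono) (use assms in \<open>auto simp: hitting_set_def horizon_def intro!: bdd_belowI[of _ 0]\<close>)

lemma path_bounded:
  assumes \<omega>: "\<omega> \<in> space M" and s: "ereal s < \<tau> \<omega>"
  obtains N :: nat where "\<And>r. 0 \<le> r \<Longrightarrow> r \<le> s \<Longrightarrow> \<bar>X r \<omega>\<bar> < real N"
proof -
  have "bounded ((\<lambda>r. \<bar>X r \<omega>\<bar>) ` {0..s})"
    by (intro compact_imp_bounded compact_continuous_image continuous_along_path[OF \<omega> continuous_abs order_refl s]) auto
  then obtain K where K: "\<forall>r\<in>{0..s}. \<bar>X r \<omega>\<bar> \<le> K" unfolding bounded_iff by auto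
  obtain N :: nat where "K < real N" using reals_Archimedean2 by blast
  then have "\<bar>X r \<omega>\<bar> < real N" if "0 \<le> r" "r \<le> s" for r
    using K[rule_format, of r] that by simp
  then show ?thesis by (rule that)
qed

lemma eventually_exit_time_ge:
  assumes \<omega>: "\<omega> \<in> space M" "good \<omega>" and s: "0 \<le> s" "s \<le> T" "ereal s < \<tau> \<omega>"
  shows "\<forall>\<^sub>F n in sequentially. s \<le> exit_time T (real n) \<omega>"
proof -
  obtain N where N: "\<And>r. 0 \<le> r \<Longrightarrow> r \<le> s \<Longrightarrow> \<bar>X r \<omega>\<bar> < real N" using path_bounded[OF \<omega>(1) s(3)] by blast
  show ?thesis
    using eventually_ge_at_top[of N]
  proof eventually_elim
    case (elim n)
    show ?case
    proof (rule exit_time_ge[OF \<omega> s(1,2)])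
      fix r assume "0 \<le> r" "r < s"
      then show "\<bar>X r \<omega>\<bar> < real n" using N[of r] elim by simp
    qed
  qed
qed

text \<open>
  The first time, after the exit from the interval of radius \<open>n\<close>, at which the solution is back in
  \<open>{-a..a}\<close>. The search ends at the exit from the interval of radius \<open>m\<close>, to keep the solution
  bounded, and after time \<open>h\<close>.
\<close>

definition return_time :: "real \<Rightarrow> real \<Rightarrow> real \<Rightarrow> nat \<Rightarrow> nat \<Rightarrow> 'a \<Rightarrow> real" where
  "return_time T a h n m = hitting_time (\<lambda>x. - \<bar>x\<bar>) (- a) (exit_time T (real n)) (\<lambda>\<omega>. min (exit_time T (real m) \<omega>) (exit_time T (real n) \<omega> + h))"

lemma return_time_basic:
  assumes T: "0 \<le> T" and h: "0 \<le> h" and nm: "n \<le> m"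
  shows "exit_time T (real n) \<omega> \<le> return_time T a h n m \<omega>"
    "return_time T a h n m \<omega> \<le> exit_time T (real m) \<omega>" "return_time T a h n m \<omega> \<le> exit_time T (real n) \<omega> + h"
    and "stopping_time F (return_time T a h n m)"
proof -
  have le: "exit_time T (real n) \<omega> \<le> min (exit_time T (real m) \<omega>) (exit_time T (real n) \<omega> + h)" for \<omega>
    using exit_time_mono[of "real n" "real m" T \<omega>] T h nm by simp
  have b: "exit_time T (real n) \<omega> \<le> return_time T a h n m \<omega>" "return_time T a h n m \<omega> \<le> min (exit_time T (real m) \<omega>) (exit_time T (real n) \<omega> + h)" for \<omega>
    unfolding return_time_def
    using hitting_time_bounds(1,2)[of "exit_time T (real n)" \<omega> "\<lambda>\<omega>. min (exit_time T (real m) \<omega>) (exit_time T (real n) \<omega> + h)"] le by auto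
  show "exit_time T (real n) \<omega> \<le> return_time T a h n m \<omega>"
    "return_time T a h n m \<omega> \<le> exit_time T (real m) \<omega>" "return_time T a h n m \<omega> \<le> exit_time T (real n) \<omega> + h"
    using b[of \<omega>] by auto
  have st: "stopping_time F (\<lambda>\<omega>. exit_time T (real n) \<omega> + h)"
  proof
    fix t
    have "Measurable.pred (F t) (\<lambda>\<omega>. exit_time T (real n) \<omega> \<le> t - h)"
      using exit_time_basic(4)[OF T] h by (intro stopping_time_le_measurable) auto
    then show "Measurable.pred (F t) (\<lambda>\<omega>. exit_time T (real n) \<omega> + h \<le> t)" by (simp add: le_diff_eq)
  qed
  show "stopping_time F (return_time T a h n m)"
    unfolding return_time_def
  proof (rule hitting_time_stopping[OF exit_time_basic(4)[OF T] stopping_time_min[OF exit_time_basic(4)[OF T] st]])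
    show "continuous_on UNIV (\<lambda>x :: real. - \<bar>x\<bar>)" by (intro continuous_intros)
    fix \<omega> assume \<omega>: "\<omega> \<in> space M"
    show "0 \<le> exit_time T (real n) \<omega>" by (rule exit_time_basic(1)[OF T])
    show "exit_time T (real n) \<omega> \<le> min (exit_time T (real m) \<omega>) (exit_time T (real n) \<omega> + h)" by (rule le)
    show "ereal (hitting_time (\<lambda>x. - \<bar>x\<bar>) (- a) (exit_time T (real n)) (\<lambda>\<omega>. min (exit_time T (real m) \<omega>) (exit_time T (real n) \<omega> + h)) \<omega>) < \<tau> \<omega>"
      using b(2)[of \<omega>] exit_time_basic(3)[OF T \<omega>, of "real m"] unfolding return_time_def
      by (auto intro: le_less_trans[of "ereal _" "ereal (exit_time T (real m) \<omega>)"])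
  qed
qed

definition return_event :: "real \<Rightarrow> real \<Rightarrow> real \<Rightarrow> nat \<Rightarrow> nat \<Rightarrow> 'a set" where
  "return_event T a h n m = {\<omega>\<in>space M. n \<le> m \<and> \<bar>X (return_time T a h n m \<omega>) \<omega>\<bar> \<le> a \<and> real n \<le> \<bar>X (exit_time T (real n) \<omega>) \<omega>\<bar>}"

lemma exit_value_measurable: "0 \<le> T \<Longrightarrow> (\<lambda>\<omega>. X (exit_time T m \<omega>) \<omega>) \<in> borel_measurable M"
  by (rule stopped_value_measurable[of _ T]) (use exit_time_basic in auto)

lemma return_value_measurable:
  assumes T: "0 \<le> T" and h: "0 \<le> h" and nk: "n \<le> k"
  shows "(\<lambda>\<omega>. X (return_time T a h n k \<omega>) \<omega>) \<in> borel_measurable M"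
proof (rule stopped_value_measurable[of _ T])
  show "stopping_time F (return_time T a h n k)" by (rule return_time_basic(4)[OF T h nk])
  fix \<omega> assume \<omega>: "\<omega> \<in> space M"
  show "0 \<le> return_time T a h n k \<omega>" using return_time_basic(1)[OF T h nk] exit_time_basic(1)[OF T] by (rule order_trans[rotated])
  show "return_time T a h n k \<omega> \<le> T" using return_time_basic(2)[OF T h nk] exit_time_basic(2)[OF T] by (rule order_trans)
  show "ereal (return_time T a h n k \<omega>) < \<tau> \<omega>"
    using return_time_basic(2)[OF T h nk, of a \<omega>] exit_time_basic(3)[OF T \<omega>, of "real k"]
    by (auto intro: le_less_trans[of "ereal _" "ereal (exit_time T (real k) \<omega>)"])
qed (rule T)

lemma return_event_measurable: "0 \<le> T \<Longrightarrow> 0 \<le> h \<Longrightarrow> return_event T a h n m \<in> events"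
proof (cases "n \<le> m")
  case True
  assume "0 \<le> T" "0 \<le> h"
  note [measurable] = exit_value_measurable[OF \<open>0 \<le> T\<close>] return_value_measurable[OF this True]
  show ?thesis unfolding return_event_def by measurable
qed (simp add: return_event_def)

text \<open>
  It takes time to come back from far away. Let \<open>f\<close> be a bump function that vanishes outside of
  the interval of radius \<open>a + 1\<close> and is at least \<open>1\<close> on \<open>{-a..a}\<close>. Between the exit and the
  return, \<open>f (X)\<close> rises from \<open>0\<close> to at least \<open>1\<close>, while its expectation can grow at most at the
  rate \<open>C\<close>, the bound of the generator applied to \<open>f\<close>. This rate involves \<open>b\<close> and \<open>\<sigma>\<close> on the
  support of \<open>f\<close> only, so \<open>C\<close> does not depend on \<open>n\<close> and \<open>m\<close>.
\<close>

lemma return_event_prob: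
  assumes T: "0 \<le> T" and a: "0 \<le> a"
  obtains C where "0 \<le> C" "\<And>h n m. 0 \<le> h \<Longrightarrow> a + 1 \<le> real n \<Longrightarrow> \<bar>\<xi>\<bar> \<le> real n \<Longrightarrow> prob (return_event T a h n m) \<le> C * h"
proof -
  define R where "R = a + 1"
  define p where "p x = max 0 (R\<^sup>2 - x\<^sup>2)" for x
  have R: "0 \<le> R" using a by (simp add: R_def)
  note test = bump_test_function[OF R, of T, folded p_def]
  define L where "L x = 0 + b x * (- 6 * x * (p x)\<^sup>2) + 1/2 * (\<sigma> x)\<^sup>2 * (24 * x\<^sup>2 * p x - 6 * (p x)\<^sup>2)" for x
  have pc: "continuous_on UNIV p" unfolding p_def by (intro continuous_intros)
  have "continuous_on {-R..R} L"
    unfolding L_def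
    by (intro continuous_intros continuous_on_subset[OF b_cont] continuous_on_subset[OF \<sigma>_cont] continuous_on_subset[OF pc]) auto
  then have "bounded (L ` {-R..R})" by (intro compact_imp_bounded compact_continuous_image) auto
  then obtain C0 where "\<forall>x\<in>{-R..R}. \<bar>L x\<bar> \<le> C0" unfolding bounded_iff by auto
  then have C0: "\<bar>L x\<bar> \<le> C0" if "x \<in> {-R..R}" for x using that by blast
  have C0nn: "0 \<le> C0" using C0[of 0] R abs_ge_zero order_trans by auto
  have p0: "p x = 0" if "R \<le> \<bar>x\<bar>" for x
  proof -
    have "R\<^sup>2 \<le> \<bar>x\<bar>\<^sup>2" using that R by (intro power_mono)
    then show ?thesis by (simp add: p_def)
  qed
  have L: "\<bar>L x\<bar> \<le> C0" for x
  proof (cases "x \<in> {-R..R}")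
    case False
    then have "R \<le> \<bar>x\<bar>" by auto
    then show ?thesis using p0 C0nn by (simp add: L_def)
  qed (rule C0)
  show ?thesis
  proof (rule that[OF C0nn])
    fix h :: real and n m :: nat
    assume h: "0 \<le> h" and n: "a + 1 \<le> real n" "\<bar>\<xi>\<bar> \<le> real n"
    show "prob (return_event T a h n m) \<le> C0 * h"
    proof (cases "n \<le> m")
      case False
      then have "return_event T a h n m = {}" by (auto simp: return_event_def)
      then show ?thesis using C0nn h by simp
    next
      case nm: True
      define \<theta> where "\<theta> = return_time T a h n m"
      define \<rho> where "\<rho> = exit_time T (real n)"
      note rb = return_time_basic[where a=a, OF T h nm, folded \<theta>_def \<rho>_def]
      have m: "\<bar>\<xi>\<bar> \<le> real m" using n(2) nm by linarith
      have diff: "\<bar>expectation (\<lambda>\<omega>. p (X (\<theta> \<omega>) \<omega>) ^ 3) - expectation (\<lambda>\<omega>. p (X (\<rho> \<omega>) \<omega>) ^ 3)\<bar> \<le> C0 * h"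
      proof (rule dynkin_difference[OF _ _ _ _ _ _ _ T _ _ test])
        show "stopping_time F \<rho>" "stopping_time F \<theta>" unfolding \<rho>_def \<theta>_def by (rule exit_time_basic(4)[OF T] return_time_basic(4)[OF T h nm])+
        show "AE \<omega> in M. \<forall>r. 0 \<le> r \<longrightarrow> r \<le> \<theta> \<omega> \<longrightarrow> \<bar>X r \<omega>\<bar> \<le> real m"
          using AE_exit_time_bound[OF m T]
        proof eventually_elim
          case (elim \<omega>)
          then show ?case using rb(2)[of \<omega>] by (meson order_trans)
        qed
        show "\<bar>0 + b x * (- 6 * x * (p x)\<^sup>2) + 1 / 2 * (\<sigma> x)\<^sup>2 * (24 * x\<^sup>2 * p x - 6 * (p x)\<^sup>2)\<bar> \<le> C0" for x
          using L[of x] by (simp only: L_def)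
        fix \<omega> assume \<omega>: "\<omega> \<in> space M"
        show "0 \<le> \<rho> \<omega>" unfolding \<rho>_def by (rule exit_time_basic(1)[OF T])
        show "\<rho> \<omega> \<le> \<theta> \<omega>" "\<theta> \<omega> \<le> \<rho> \<omega> + h" by (rule rb)+
        show "\<theta> \<omega> \<le> T" using rb(2) exit_time_basic(2)[OF T] by (rule order_trans)
        show "ereal (\<theta> \<omega>) < \<tau> \<omega>"
          using rb(2)[of \<omega>] exit_time_basic(3)[OF T \<omega>, of "real m"] by (auto intro: le_less_trans[of "ereal _" "ereal (exit_time T (real m) \<omega>)"])
      qed (use C0nn in auto)
      have pm: "p \<in> borel_measurable borel" using pc by (rule borel_measurable_continuous_onI)
      have pb: "0 \<le> p x" "p x \<le> R\<^sup>2" for x by (auto simp: p_def)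
      have pi: "integrable M (\<lambda>\<omega>. p (Z \<omega>) ^ 3)" if "Z \<in> borel_measurable M" for Z
      proof (rule integrable_const_bound)
        show "AE \<omega> in M. norm (p (Z \<omega>) ^ 3) \<le> (R\<^sup>2) ^ 3" 
          by (intro AE_I2) (simp only: real_norm_def abs_of_nonneg zero_le_power pb power_mono)
        show "(\<lambda>\<omega>. p (Z \<omega>) ^ 3) \<in> borel_measurable M" using measurable_compose[OF that pm] by simp
      qed
      have i\<theta>: "integrable M (\<lambda>\<omega>. p (X (\<theta> \<omega>) \<omega>) ^ 3)" and i\<rho>: "integrable M (\<lambda>\<omega>. p (X (\<rho> \<omega>) \<omega>) ^ 3)"
        unfolding \<theta>_def \<rho>_def by (intro pi exit_value_measurable[OF T] return_value_measurable[OF T h nm])+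
      have ev: "return_event T a h n m \<in> events" by (rule return_event_measurable[OF T h])
      have "prob (return_event T a h n m) = expectation (indicator (return_event T a h n m))" using ev by simp
      also have "\<dots> \<le> expectation (\<lambda>\<omega>. p (X (\<theta> \<omega>) \<omega>) ^ 3 - p (X (\<rho> \<omega>) \<omega>) ^ 3)"
      proof (rule integral_mono)
        show "integrable M (indicator (return_event T a h n m) :: 'a \<Rightarrow> real)" using ev by (simp add: emeasure_eq_measure)
        show "integrable M (\<lambda>\<omega>. p (X (\<theta> \<omega>) \<omega>) ^ 3 - p (X (\<rho> \<omega>) \<omega>) ^ 3)" using i\<theta> i\<rho> by simp
        fix \<omega> assume \<omega>: "\<omega> \<in> space M"
        show "indicator (return_event T a h n m) \<omega> \<le> p (X (\<theta> \<omega>) \<omega>) ^ 3 - p (X (\<rho> \<omega>) \<omega>) ^ 3"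
        proof (cases "real n \<le> \<bar>X (\<rho> \<omega>) \<omega>\<bar>")
          case True
          then have "p (X (\<rho> \<omega>) \<omega>) = 0" using n(1) by (intro p0) (simp add: R_def)
          moreover have "1 \<le> p (X (\<theta> \<omega>) \<omega>) ^ 3" if "\<omega> \<in> return_event T a h n m"
          proof -
            have "\<bar>X (\<theta> \<omega>) \<omega>\<bar> \<le> a" using that by (simp add: return_event_def \<theta>_def)
            then have "\<bar>X (\<theta> \<omega>) \<omega>\<bar>\<^sup>2 \<le> a\<^sup>2" by (intro power_mono) auto
            moreover have "R\<^sup>2 = a\<^sup>2 + 2 * a + 1" by (simp add: R_def power2_eq_square algebra_simps)
            ultimately have "1 \<le> p (X (\<theta> \<omega>) \<omega>)" using a by (simp add: p_def)
            then show ?thesis by (rule one_le_power)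
          qed
          ultimately show ?thesis using pb by (auto simp: indicator_def)
        next
          (* Without an exit before the horizon, the search for a return ends where it begins,
             and the two values of p agree. *)
          case False
          have "\<rho> \<omega> = horizon T \<omega>"
          proof (rule ccontr)
            assume "\<rho> \<omega> \<noteq> horizon T \<omega>"
            moreover have "0 \<le> horizon T \<omega>" using T by (simp add: horizon_def)
            ultimately have "hitting_set abs (real n) (\<lambda>_. 0) (horizon T) \<omega> \<noteq> {}"
              using hitting_time_bounds(4)[of "\<lambda>_. 0" \<omega> "horizon T" abs "real n"] by (auto simp: \<rho>_def exit_time_def)
            then have "\<rho> \<omega> \<in> hitting_set abs (real n) (\<lambda>_. 0) (horizon T) \<omega>"
              unfolding \<rho>_def exit_time_def by (intro hitting_time_attained[OF \<omega>]) (auto intro: continuous_abs)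
            then show False using False by (simp add: hitting_set_def)
          qed
          moreover have "exit_time T (real m) \<omega> \<le> horizon T \<omega>"
            unfolding exit_time_def using T by (intro hitting_time_bounds(2)) (simp add: horizon_def)
          ultimately have "\<theta> \<omega> = \<rho> \<omega>" using rb(1,2)[of \<omega>] by linarith
          then show ?thesis using False by (simp add: return_event_def \<rho>_def)
        qed
      qed
      also have "\<dots> \<le> C0 * h" using diff i\<theta> i\<rho> by simp
      finally show ?thesis .
    qed
  qed
qed

text \<open>
  The exit times tend to \<open>\<tau>\<close>. Those in the last \<open>h\<close> time units before \<open>\<tau>\<close> leave less than \<open>h\<close> for
  the return, and a return before \<open>\<tau>\<close> takes place before the exit from the interval of radius \<open>m\<close>,
  for large \<open>m\<close>.
\<close>

lemma eventually_return_event: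
  assumes \<omega>: "\<omega> \<in> space M" "good \<omega>" and \<tau>: "\<tau> \<omega> \<le> ereal T" and h: "0 < h"
    and returns: "\<And>s. 0 \<le> s \<Longrightarrow> ereal s < \<tau> \<omega> \<Longrightarrow> \<exists>s'>s. ereal s' < \<tau> \<omega> \<and> \<bar>X s' \<omega>\<bar> \<le> a"
  shows "\<omega> \<in> (\<Union>N. \<Inter>n\<in>{N..}. \<Union>K. \<Inter>m\<in>{K..}. return_event T a h n m)"
proof -
  obtain T' where T': "\<tau> \<omega> = ereal T'" using \<tau> \<tau>_pos[OF \<omega>(1)] by (cases "\<tau> \<omega>") auto
  then have T'0: "0 < T'" "T' \<le> T" using \<tau>_pos[OF \<omega>(1)] \<tau> by auto
  then have T: "0 \<le> T" by simp
  define s0 where "s0 = max 0 (T' - h/2)"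
  have s0: "0 \<le> s0" "s0 < T'" "T' < s0 + h" using T'0 h by (auto simp: s0_def)
  have "\<forall>\<^sub>F n in sequentially. s0 \<le> exit_time T (real n) \<omega> \<and> \<bar>\<xi>\<bar> \<le> real n"
    by (intro eventually_conj eventually_exit_time_ge[OF \<omega>]) (use s0 T'0 T' in \<open>auto intro: filterlim_real_sequentially[THEN filterlim_at_top[THEN iffD1], rule_format]\<close>)
  then obtain N where N: "\<And>n. N \<le> n \<Longrightarrow> s0 \<le> exit_time T (real n) \<omega> \<and> \<bar>\<xi>\<bar> \<le> real n" unfolding eventually_sequentially by blast
  have "\<omega> \<in> (\<Union>K. \<Inter>m\<in>{K..}. return_event T a h n m)" if n: "N \<le> n" for n
  proof -
    define r where "r = exit_time T (real n) \<omega>"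
    have r: "s0 \<le> r" "\<bar>\<xi>\<bar> \<le> real n" using N[OF n] by (auto simp: r_def)
    have r\<tau>: "ereal r < \<tau> \<omega>" unfolding r_def by (rule exit_time_basic(3)[OF T \<omega>(1)])
    obtain s' where s': "r < s'" "ereal s' < \<tau> \<omega>" "\<bar>X s' \<omega>\<bar> \<le> a" using returns[of r] r\<tau> r(1) s0(1) by auto
    have "s' \<le> T" using s'(2) T' T'0 by simp
    then have "\<forall>\<^sub>F m in sequentially. s' \<le> exit_time T (real m) \<omega> \<and> n \<le> m"
      using s' r(1) s0(1) by (intro eventually_conj eventually_exit_time_ge[OF \<omega>] eventually_ge_at_top) auto
    then obtain K where K: "\<And>m. K \<le> m \<Longrightarrow> s' \<le> exit_time T (real m) \<omega> \<and> n \<le> m" unfolding eventually_sequentially by blast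
    have "\<omega> \<in> return_event T a h n m" if m: "K \<le> m" for m
    proof -
      have "s' \<in> hitting_set (\<lambda>x. - \<bar>x\<bar>) (- a) (exit_time T (real n)) (\<lambda>\<omega>. min (exit_time T (real m) \<omega>) (exit_time T (real n) \<omega> + h)) \<omega>"
        using s' K[OF m] r(1) s0(3) T' by (auto simp: hitting_set_def r_def)
      then have "return_time T a h n m \<omega> \<in> hitting_set (\<lambda>x. - \<bar>x\<bar>) (- a) (exit_time T (real n)) (\<lambda>\<omega>. min (exit_time T (real m) \<omega>) (exit_time T (real n) \<omega> + h)) \<omega>"
        unfolding return_time_def by (intro hitting_time_attained[OF \<omega>(1)] exit_time_basic(1)[OF T]) (auto intro!: continuous_intros)
      then have "\<bar>X (return_time T a h n m \<omega>) \<omega>\<bar> \<le> a" by (simp add: hitting_set_def)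
      then show ?thesis using \<omega>(1) K[OF m] exit_time_explosion[OF \<omega> r(2) T \<tau>] by (simp add: return_event_def)
    qed
    then show ?thesis by auto
  qed
  then show ?thesis by auto
qed

text \<open>
  A path that returns to \<open>{-a..a}\<close> arbitrarily shortly before the explosion belongs, for every
  \<open>h > 0\<close>, to a limes inferior of events of probability at most \<open>C * h\<close>.
\<close>

lemma AE_no_return:
  assumes T: "0 \<le> T" and a: "0 \<le> a"
  shows "AE \<omega> in M. \<tau> \<omega> \<le> ereal T \<longrightarrow> (\<exists>s\<ge>0. ereal s < \<tau> \<omega> \<and> (\<forall>s'>s. ereal s' < \<tau> \<omega> \<longrightarrow> a < \<bar>X s' \<omega>\<bar>))"
proof -
  obtain C where C: "0 \<le> C" "\<And>h n m. 0 \<le> h \<Longrightarrow> a + 1 \<le> real n \<Longrightarrow> \<bar>\<xi>\<bar> \<le> real n \<Longrightarrow> prob (return_event T a h n m) \<le> C * h"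
    using return_event_prob[OF T a] by blast
  define E where "E h = (\<Union>N. \<Inter>n\<in>{N::nat..}. \<Union>K. \<Inter>m\<in>{K::nat..}. return_event T a h n m)" for h
  obtain N0 :: nat where N0: "a + 1 \<le> real N0" "\<bar>\<xi>\<bar> \<le> real N0"
    using real_arch_simple[of "max (a + 1) \<bar>\<xi>\<bar>"] by auto
  have E: "E h \<in> events" "prob (E h) \<le> C * h" if h: "0 \<le> h" for h
  proof -
    have inner: "(\<Union>K. \<Inter>m\<in>{K..}. return_event T a h n m) \<in> events" for n
      by (rule prob_liminf_le(1)[of _ 0 1]) (auto intro: return_event_measurable T h)
    have le: "prob (\<Union>K. \<Inter>m\<in>{K..}. return_event T a h n m) \<le> C * h" if "N0 \<le> n" for n
      by (rule prob_liminf_le(2)[of _ 0]) (use C(2)[OF h, of n] N0 that in \<open>auto intro: return_event_measurable T h\<close>)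
    show "E h \<in> events" "prob (E h) \<le> C * h"
      unfolding E_def by (rule prob_liminf_le[of _ N0]; use inner le in blast)+
  qed
  define Z where "Z = (\<Inter>j. E (1 / real (Suc j)))"
  have Zm: "Z \<in> events" unfolding Z_def using E(1) by (intro sets.countable_INT) auto
  have "prob Z \<le> C * (1 / real (Suc j))" for j
  proof -
    have "prob Z \<le> prob (E (1 / real (Suc j)))" by (rule finite_measure_mono) (use E(1) in \<open>auto simp: Z_def\<close>)
    also have "\<dots> \<le> C * (1 / real (Suc j))" by (rule E(2)) simp
    finally show ?thesis .
  qed
  moreover have "(\<lambda>j. C * (1 / real (Suc j))) \<longlonglongrightarrow> C * 0" by (intro tendsto_intros LIMSEQ_Suc[OF lim_1_over_n])
  ultimately have "prob Z \<le> 0" using LIMSEQ_le_const[of "\<lambda>j. C * (1 / real (Suc j))" "C * 0" "prob Z"] by simp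
  then have "prob Z = 0" using measure_nonneg[of M Z] by linarith
  then have "Z \<in> null_sets M" using Zm by (auto simp: null_sets_def emeasure_eq_measure)
  from AE_not_in[OF this] AE_good AE_space show ?thesis
  proof eventually_elim
    case (elim \<omega>)
    show ?case
    proof (rule impI, rule ccontr)
      assume \<tau>: "\<tau> \<omega> \<le> ereal T" and no: "\<not> (\<exists>s\<ge>0. ereal s < \<tau> \<omega> \<and> (\<forall>s'>s. ereal s' < \<tau> \<omega> \<longrightarrow> a < \<bar>X s' \<omega>\<bar>))"
      have "\<omega> \<in> E (1 / real (Suc j))" for j
        unfolding E_def
      proof (rule eventually_return_event[OF elim(3,2) \<tau>])
        fix s assume "0 \<le> s" "ereal s < \<tau> \<omega>"
        then show "\<exists>s'>s. ereal s' < \<tau> \<omega> \<and> \<bar>X s' \<omega>\<bar> \<le> a" using no not_less by blast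
      qed simp
      then show False using elim(1) by (simp add: Z_def)
    qed
  qed
qed

text \<open>
  By \<open>AE_no_return\<close> for all natural numbers \<open>a\<close>, the absolute value tends to infinity; by the
  intermediate value theorem, a continuous path without zeros near \<open>\<tau>\<close> keeps its sign.
\<close>

lemma AE_explosion_limit:
  "AE \<omega> in M. \<tau> \<omega> < \<infinity> \<longrightarrow>
     filterlim (\<lambda>s. X s \<omega>) at_top (at_left (real_of_ereal (\<tau> \<omega>))) \<or> filterlim (\<lambda>s. X s \<omega>) at_bot (at_left (real_of_ereal (\<tau> \<omega>)))"
proof -
  have "AE \<omega> in M. \<forall>T a :: nat. \<tau> \<omega> \<le> ereal (real T) \<longrightarrow> (\<exists>s\<ge>0. ereal s < \<tau> \<omega> \<and> (\<forall>s'>s. ereal s' < \<tau> \<omega> \<longrightarrow> real a < \<bar>X s' \<omega>\<bar>))"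
    unfolding AE_all_countable by (intro allI AE_no_return) auto
  then show ?thesis using AE_space
  proof eventually_elim
    case (elim \<omega>)
    show ?case
    proof
      assume "\<tau> \<omega> < \<infinity>"
      then obtain t where t: "\<tau> \<omega> = ereal t" using \<tau>_pos[OF elim(2)] by (cases "\<tau> \<omega>") auto
      obtain T :: nat where "t \<le> real T" using real_arch_simple by blast
      then have ev: "\<exists>s\<ge>0. s < t \<and> (\<forall>s'>s. s' < t \<longrightarrow> real a < \<bar>X s' \<omega>\<bar>)" for a :: nat
        using elim(1)[rule_format, of T a] t by simp
      obtain s0 where s0: "0 \<le> s0" "s0 < t" "\<And>s. s0 < s \<Longrightarrow> s < t \<Longrightarrow> 0 < \<bar>X s \<omega>\<bar>" using ev[of 0] by auto
      have abs_lim: "filterlim (\<lambda>s. \<bar>X s \<omega>\<bar>) at_top (at_left t)"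
        unfolding filterlim_at_top
      proof
        fix Z :: real
        obtain a :: nat where "Z \<le> real a" using real_arch_simple by blast
        moreover obtain s where "s < t" "\<forall>s'>s. s' < t \<longrightarrow> real a < \<bar>X s' \<omega>\<bar>" using ev[of a] by blast
        ultimately show "\<forall>\<^sub>F s in at_left t. Z \<le> \<bar>X s \<omega>\<bar>"
          unfolding eventually_at_left_field by (intro exI[of _ s]) (auto intro: order_trans less_imp_le)
      qed
      have cont: "continuous_on {x..y} (\<lambda>s. X s \<omega>)" if "s0 < x" "y < t" for x y
        by (rule continuous_along_path[OF elim(2), of "\<lambda>x. x"]) (use that s0 t in \<open>auto intro: continuous_intros\<close>)
      have no_zero: False if xy: "s0 < x" "x < t" "s0 < y" "y < t" and sg: "X x \<omega> \<le> 0" "0 \<le> X y \<omega>" for x y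
      proof (cases "x \<le> y")
        case True
        then obtain z where "x \<le> z" "z \<le> y" "X z \<omega> = 0" using IVT'[of "\<lambda>s. X s \<omega>" x 0 y] sg cont[of x y] xy by auto
        then show False using s0(3)[of z] xy by simp
      next
        case False
        then obtain z where "y \<le> z" "z \<le> x" "X z \<omega> = 0" using IVT2'[of "\<lambda>s. X s \<omega>" x 0 y] sg cont[of y x] xy by auto
        then show False using s0(3)[of z] xy by simp
      qed
      obtain y where y: "s0 < y" "y < t" using s0 dense by blast
      have at: "real_of_ereal (\<tau> \<omega>) = t" using t by simp
      show "filterlim (\<lambda>s. X s \<omega>) at_top (at_left (real_of_ereal (\<tau> \<omega>))) \<or> filterlim (\<lambda>s. X s \<omega>) at_bot (at_left (real_of_ereal (\<tau> \<omega>)))"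
        unfolding at
      proof (cases "0 \<le> X y \<omega>")
        case True
        then have sgn: "0 < X s \<omega>" if "s0 < s" "s < t" for s using no_zero[of s y] that y by force
        have "\<forall>\<^sub>F s in at_left t. \<bar>X s \<omega>\<bar> = X s \<omega>"
          unfolding eventually_at_left_field using s0(2) by (intro exI[of _ s0] conjI allI impI abs_of_pos sgn)
        then have "filterlim (\<lambda>s. X s \<omega>) at_top (at_left t)" using abs_lim by (rule filterlim_cong[OF refl refl, THEN iffD1])
        then show "filterlim (\<lambda>s. X s \<omega>) at_top (at_left t) \<or> filterlim (\<lambda>s. X s \<omega>) at_bot (at_left t)" ..
      next
        case False
        then have sgn: "X s \<omega> < 0" if "s0 < s" "s < t" for s using no_zero[of y s] that y by force
        have "\<forall>\<^sub>F s in at_left t. \<bar>X s \<omega>\<bar> = - X s \<omega>"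
          unfolding eventually_at_left_field using s0(2) by (intro exI[of _ s0] conjI allI impI abs_of_neg sgn)
        then have "filterlim (\<lambda>s. - X s \<omega>) at_top (at_left t)" using abs_lim by (rule filterlim_cong[OF refl refl, THEN iffD1])
        then have "filterlim (\<lambda>s. X s \<omega>) at_bot (at_left t)" by (simp add: filterlim_uminus_at_top)
        then show "filterlim (\<lambda>s. X s \<omega>) at_top (at_left t) \<or> filterlim (\<lambda>s. X s \<omega>) at_bot (at_left t)" ..
      qed
    qed
  qed
qed

end

section \<open>Explosion probabilities and the boundary value problem\<close>

locale kolmogorov_setting = sde_setting M F W b \<sigma> \<xi> X \<tau>
  for M :: "'a measure" and F :: "real \<Rightarrow> 'a measure" and W :: "real \<Rightarrow> 'a \<Rightarrow> real"
    and b \<sigma> :: "real \<Rightarrow> real" and \<xi> :: real and X :: "real \<Rightarrow> 'a \<Rightarrow> real" and \<tau> :: "'a \<Rightarrow> ereal" +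
  fixes u :: "real \<Rightarrow> real \<Rightarrow> real" and K :: real
  assumes u_bound: "\<And>t x. 0 \<le> t \<Longrightarrow> \<bar>u t x\<bar> \<le> K"
    and u_sol: "kolmogorov_solution b \<sigma> u"
begin

lemma u_differentiable:
  assumes "0 < t"
  shows "(\<lambda>s. u s x) differentiable at t" "u t differentiable at x" "partial_x u t differentiable at x"
  using u_sol assms unfolding kolmogorov_solution_def C12_on_positive_times_def by blast+

lemma u_t: "0 < t \<Longrightarrow> ((\<lambda>s. u s x) has_real_derivative partial_t u t x) (at t)"
  and u_x: "0 < t \<Longrightarrow> (u t has_real_derivative partial_x u t x) (at x)"
  and u_xx: "0 < t \<Longrightarrow> (partial_x u t has_real_derivative partial_x (partial_x u) t x) (at x)"
  unfolding partial_t_def partial_x_def[of u t x] partial_x_def[of "partial_x u"] DERIV_deriv_iff_real_differentiable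
  by (rule u_differentiable, assumption)+

lemma u_t_cont: "continuous_on ({0<..} \<times> UNIV) (\<lambda>(t, x). partial_t u t x)"
  and u_x_cont: "continuous_on ({0<..} \<times> UNIV) (\<lambda>(t, x). partial_x u t x)"
  and u_xx_cont: "continuous_on ({0<..} \<times> UNIV) (\<lambda>(t, x). partial_x (partial_x u) t x)"
  and u_equation: "0 < t \<Longrightarrow> partial_t u t x = 1 / 2 * (\<sigma> x)\<^sup>2 * partial_x (partial_x u) t x + b x * partial_x u t x"
  and u_0: "u 0 x = 0" and u_initial: "((\<lambda>t. u t x) \<longlongrightarrow> 0) (at_right 0)"
  using u_sol unfolding kolmogorov_solution_def C12_on_positive_times_def by blast+

text \<open>
  Continuity in both variables: the partial derivatives exist, and the one in space is continuous.
\<close>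

lemma u_cont: "continuous_on ({0<..} \<times> UNIV) (\<lambda>(t, x). u t x)"
  unfolding continuous_on_eq_continuous_within
proof
  fix p :: "real \<times> real" assume p: "p \<in> {0<..} \<times> UNIV"
  then obtain t x where tx: "p = (t, x)" "0 < t" by auto
  have "((\<lambda>(t, x). u t x) has_derivative (\<lambda>(h, k). (*) (partial_t u t x) h + blinfun_apply (partial_x u t x *\<^sub>R id_blinfun) k)) (at (t, x) within {0<..} \<times> UNIV)"
  proof (rule has_derivative_partialsI[where fy="\<lambda>t x. partial_x u t x *\<^sub>R id_blinfun"])
    show "((\<lambda>s. u s x) has_derivative (*) (partial_t u t x)) (at t within {0<..})"
      using u_t[OF tx(2), of x] by (auto simp: has_field_derivative_def intro: has_derivative_at_withinI)
    show "((\<lambda>y. u s y) has_derivative blinfun_apply (partial_x u s y *\<^sub>R id_blinfun)) (at y within UNIV)" if "s \<in> {0<..}" for s y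
    proof -
      have "blinfun_apply (partial_x u s y *\<^sub>R id_blinfun) = (*) (partial_x u s y)" by (auto simp: blinfun.scaleR_left)
      then show ?thesis using u_x[of s y] that by (simp add: has_field_derivative_def)
    qed
    have "continuous (at (t, x) within {0<..} \<times> UNIV) (\<lambda>(t, x). partial_x u t x)"
      using u_x_cont p tx by (simp add: continuous_on_eq_continuous_within)
    then show "continuous (at (t, x) within {0<..} \<times> UNIV) (\<lambda>(t, x). partial_x u t x *\<^sub>R id_blinfun)"
      unfolding case_prod_unfold by (intro continuous_intros)
  qed auto
  then show "continuous (at p within {0<..} \<times> UNIV) (\<lambda>(t, x). u t x)"
    unfolding tx by (rule has_derivative_continuous)
qed

lemma u_measurable:
  assumes [measurable]: "f \<in> borel_measurable N" "y \<in> borel_measurable N" and pos: "\<And>x. x \<in> space N \<Longrightarrow> 0 < f x"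
  shows "(\<lambda>x. u (f x) (y x)) \<in> borel_measurable N"
proof -
  have "(\<lambda>p. indicator ({0<..} \<times> UNIV) p *\<^sub>R (\<lambda>(t, x). u t x) p) \<in> borel_measurable borel"
    by (intro borel_measurable_continuous_on_indicator u_cont) (auto simp: open_Times borel_open)
  then have "(\<lambda>x. indicator ({0<..} \<times> UNIV) (f x, y x) *\<^sub>R (\<lambda>(t, x). u t x) (f x, y x)) \<in> borel_measurable N"
    by (rule measurable_compose[rotated]) measurable
  then show ?thesis by (rule measurable_cong[THEN iffD1, rotated]) (use pos in auto)
qed

text \<open>
  Time runs backwards, and the shift by \<open>e\<close> keeps the time argument away from \<open>0\<close>, where \<open>u\<close> need
  not be smooth.
\<close>

lemma u_test_function:
  assumes t: "0 \<le> t" and e: "0 < e"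
    and \<psi>: "\<And>x. (\<psi> has_real_derivative \<psi>1 x) (at x)" "\<And>x. (\<psi>1 has_real_derivative \<psi>2 x) (at x)" "continuous_on UNIV \<psi>2"
    and supp: "\<And>x. R \<le> \<bar>x\<bar> \<Longrightarrow> \<psi> x = 0 \<and> \<psi>1 x = 0 \<and> \<psi>2 x = 0"
  shows "test_function t (\<lambda>s x. \<psi> x * u (t + e - s) x) (\<lambda>s x. - (\<psi> x * partial_t u (t + e - s) x))
    (\<lambda>s x. \<psi>1 x * u (t + e - s) x + \<psi> x * partial_x u (t + e - s) x)
    (\<lambda>s x. \<psi>2 x * u (t + e - s) x + 2 * (\<psi>1 x * partial_x u (t + e - s) x) + \<psi> x * partial_x (partial_x u) (t + e - s) x)"
  unfolding test_function_def
proof (intro conjI ballI allI)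
  fix s x assume "s \<in> {0..t}"
  then have pos: "0 < t + e - s" using e by auto
  have "((\<lambda>s. t + e - s) has_real_derivative - 1) (at s)" by (auto intro!: derivative_eq_intros)
  from DERIV_chain2[OF u_t[OF pos] this, of x]
  have "((\<lambda>s. u (t + e - s) x) has_real_derivative partial_t u (t + e - s) x * - 1) (at s within {0..t})"
    by (rule has_field_derivative_at_within)
  then show "((\<lambda>s. \<psi> x * u (t + e - s) x) has_real_derivative - (\<psi> x * partial_t u (t + e - s) x)) (at s within {0..t})"
    by (rule DERIV_cmult[THEN DERIV_cong]) simp
  show "((\<lambda>x. \<psi> x * u (t + e - s) x) has_real_derivative \<psi>1 x * u (t + e - s) x + \<psi> x * partial_x u (t + e - s) x) (at x)"
    by (rule DERIV_mult[OF \<psi>(1) u_x[OF pos], THEN DERIV_cong]) (simp add: algebra_simps)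
  show "((\<lambda>x. \<psi>1 x * u (t + e - s) x + \<psi> x * partial_x u (t + e - s) x) has_real_derivative
     \<psi>2 x * u (t + e - s) x + 2 * (\<psi>1 x * partial_x u (t + e - s) x) + \<psi> x * partial_x (partial_x u) (t + e - s) x) (at x)"
    by (rule DERIV_add[OF DERIV_mult[OF \<psi>(2) u_x[OF pos]] DERIV_mult[OF \<psi>(1) u_xx[OF pos]], THEN DERIV_cong]) (simp add: algebra_simps)
next
  have sub: "continuous_on ({0..t} \<times> UNIV) (\<lambda>p. f (t + e - fst p) (snd p))"
    if "continuous_on ({0<..} \<times> UNIV) (\<lambda>(t, x). f t x)" for f :: "real \<Rightarrow> real \<Rightarrow> real"
  proof -
    have "continuous_on ({0..t} \<times> UNIV) (\<lambda>p. (\<lambda>(t, x). f t x) (t + e - fst p, snd p))"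
      by (rule continuous_on_compose2[OF that]) (use e in \<open>auto intro!: continuous_intros\<close>)
    then show ?thesis by simp
  qed
  have c: "continuous_on UNIV \<psi>" "continuous_on UNIV \<psi>1"
    using \<psi>(1,2) by (auto intro!: continuous_at_imp_continuous_on DERIV_isCont)
  have \<psi>c: "continuous_on ({0..t} \<times> UNIV) (\<lambda>p. f (snd p))" if "continuous_on UNIV f" for f :: "real \<Rightarrow> real"
    by (rule continuous_on_compose2[OF that]) (auto intro!: continuous_intros)
  fix G :: "real \<Rightarrow> real \<Rightarrow> real" assume G: "G \<in> {\<lambda>s x. \<psi> x * u (t + e - s) x, \<lambda>s x. - (\<psi> x * partial_t u (t + e - s) x),
    \<lambda>s x. \<psi>1 x * u (t + e - s) x + \<psi> x * partial_x u (t + e - s) x,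
    \<lambda>s x. \<psi>2 x * u (t + e - s) x + 2 * (\<psi>1 x * partial_x u (t + e - s) x) + \<psi> x * partial_x (partial_x u) (t + e - s) x}"
  from G show "continuous_on ({0..t} \<times> UNIV) (\<lambda>(s, x). G s x)"
    by (elim insertE emptyE; hypsubst; unfold case_prod_unfold)
      (intro continuous_intros sub[OF u_cont] sub[OF u_t_cont] sub[OF u_x_cont] sub[OF u_xx_cont] \<psi>c[OF c(1)] \<psi>c[OF c(2)] \<psi>c[OF \<psi>(3)])+
  from G show "\<exists>R. \<forall>s\<in>{0..t}. \<forall>x. R \<le> \<bar>x\<bar> \<longrightarrow> G s x = 0"
    by (intro exI[of _ R]) (elim insertE emptyE; simp add: supp)
qed

text \<open>
  The process \<open>u (t + e - s) (X s)\<close> has no drift until the exit from \<open>{-m..m}\<close>: the time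
  derivative of \<open>u\<close> cancels the generator in space, and the cutoff \<open>\<psi>\<close> is constant there.
\<close>

lemma u_along_exit:
  assumes t: "0 \<le> t" and e: "0 < e" and m: "\<bar>\<xi>\<bar> \<le> m"
  shows "expectation (\<lambda>\<omega>. u (t + e - exit_time t m \<omega>) (X (exit_time t m \<omega>) \<omega>)) = u (t + e) \<xi>"
proof -
  have m0: "0 \<le> m" using m by linarith
  obtain \<psi> \<psi>1 \<psi>2 where \<psi>: "\<And>x. (\<psi> has_real_derivative \<psi>1 x) (at x)" "\<And>x. (\<psi>1 has_real_derivative \<psi>2 x) (at x)" "continuous_on UNIV \<psi>2"
    "\<And>x. \<bar>x\<bar> \<le> m \<Longrightarrow> \<psi> x = 1 \<and> \<psi>1 x = 0 \<and> \<psi>2 x = 0" "\<And>x. m + 3 \<le> \<bar>x\<bar> \<Longrightarrow> \<psi> x = 0 \<and> \<psi>1 x = 0 \<and> \<psi>2 x = 0"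
    using smooth_cutoff[OF m0] by metis
  define \<rho> where "\<rho> = exit_time t m"
  note \<rho> = exit_time_basic[OF t, where m=m, folded \<rho>_def]
  note test = u_test_function[OF t e \<psi>(1,2,3,5)]
  have "\<bar>expectation (\<lambda>\<omega>. \<psi> (X (\<rho> \<omega>) \<omega>) * u (t + e - \<rho> \<omega>) (X (\<rho> \<omega>) \<omega>)) - expectation (\<lambda>\<omega>. \<psi> (X 0 \<omega>) * u (t + e - 0) (X 0 \<omega>))\<bar> \<le> 0 * t"
  proof (rule dynkin_difference[OF stopping_time_const \<rho>(4) _ \<rho>(1) \<rho>(3) \<rho>(2) _ t m0 _ test])
    show "AE \<omega> in M. \<forall>r. 0 \<le> r \<longrightarrow> r \<le> \<rho> \<omega> \<longrightarrow> \<bar>X r \<omega>\<bar> \<le> m" unfolding \<rho>_def by (rule AE_exit_time_bound[OF m t])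
    fix s x assume s: "s \<in> {0..t}" and x: "\<bar>x\<bar> \<le> m"
    have "0 < t + e - s" using s e by auto
    then show "\<bar>- (\<psi> x * partial_t u (t + e - s) x) + b x * (\<psi>1 x * u (t + e - s) x + \<psi> x * partial_x u (t + e - s) x) +
      1 / 2 * (\<sigma> x)\<^sup>2 * (\<psi>2 x * u (t + e - s) x + 2 * (\<psi>1 x * partial_x u (t + e - s) x) + \<psi> x * partial_x (partial_x u) (t + e - s) x)\<bar> \<le> 0"
      using \<psi>(4)[OF x] u_equation[of "t + e - s" x] by simp
  qed (use \<rho>(2) in auto)
  then have eq: "expectation (\<lambda>\<omega>. \<psi> (X (\<rho> \<omega>) \<omega>) * u (t + e - \<rho> \<omega>) (X (\<rho> \<omega>) \<omega>)) = expectation (\<lambda>\<omega>. \<psi> (X 0 \<omega>) * u (t + e) (X 0 \<omega>))" by simp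
  have Xm [measurable]: "(\<lambda>\<omega>. X (\<rho> \<omega>) \<omega>) \<in> borel_measurable M" unfolding \<rho>_def by (rule exit_value_measurable[OF t])
  have X0 [measurable]: "(\<lambda>\<omega>. X 0 \<omega>) \<in> borel_measurable M"
    by (rule stopped_value_measurable[of "\<lambda>_. 0" 0]) (use \<tau>_pos in \<open>auto simp: zero_ereal_def stopping_time_const\<close>)
  have \<rho>m [measurable]: "\<rho> \<in> borel_measurable M" using \<rho>(4) by (rule stopping_time_measurable)
  have um [measurable]: "(\<lambda>\<omega>. u (t + e - \<rho> \<omega>) (X (\<rho> \<omega>) \<omega>)) \<in> borel_measurable M"
    by (rule u_measurable) (use \<rho>(2) e in \<open>auto simp: algebra_simps add_pos_nonneg intro: add_strict_increasing\<close>)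
  have um0 [measurable]: "(\<lambda>\<omega>. u (t + e) (X 0 \<omega>)) \<in> borel_measurable M"
    by (rule u_measurable) (use t e in auto)
  have [measurable]: "\<psi> \<in> borel_measurable borel"
    using \<psi>(1) by (intro borel_measurable_continuous_onI continuous_at_imp_continuous_on) (auto intro: DERIV_isCont)
  have "expectation (\<lambda>\<omega>. \<psi> (X (\<rho> \<omega>) \<omega>) * u (t + e - \<rho> \<omega>) (X (\<rho> \<omega>) \<omega>)) = expectation (\<lambda>\<omega>. u (t + e - \<rho> \<omega>) (X (\<rho> \<omega>) \<omega>))"
  proof (rule integral_cong_AE)
    show "AE \<omega> in M. \<psi> (X (\<rho> \<omega>) \<omega>) * u (t + e - \<rho> \<omega>) (X (\<rho> \<omega>) \<omega>) = u (t + e - \<rho> \<omega>) (X (\<rho> \<omega>) \<omega>)"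
      using AE_exit_time_bound[OF m t, folded \<rho>_def] by eventually_elim (use \<psi>(4) \<rho>(1) in simp)
  qed measurable
  moreover have "expectation (\<lambda>\<omega>. \<psi> (X 0 \<omega>) * u (t + e) (X 0 \<omega>)) = expectation (\<lambda>\<omega>. u (t + e) \<xi>)"
  proof (rule integral_cong_AE)
    show "AE \<omega> in M. \<psi> (X 0 \<omega>) * u (t + e) (X 0 \<omega>) = u (t + e) \<xi>"
      using X_initial by eventually_elim (use \<psi>(4)[of \<xi>] m in simp)
  qed measurable
  ultimately show ?thesis using eq by (simp add: \<rho>_def prob_space)
qed

text \<open>
  The mean of \<open>u\<close> over the times between \<open>s + \<delta>\<close> and \<open>s + 2 * \<delta>\<close>. Boundary values are prescribed
  for each time separately, without uniformity in time; averages have the corresponding limits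
  even if the times vary. Writing \<open>max 0 z\<close> for \<open>z\<close>, which changes nothing on the domain of
  integration, keeps the time positive for all \<open>z\<close>.
\<close>

definition avg :: "real \<Rightarrow> real \<Rightarrow> real \<Rightarrow> real" where
  "avg \<delta> s x = (LINT z:{0..1}|lborel. u (s + \<delta> * (1 + max 0 z)) x)"

lemma shifted_time_pos: "0 \<le> s \<Longrightarrow> 0 < \<delta> \<Longrightarrow> 0 < s + \<delta> * (1 + max 0 z)" for s \<delta> z :: real
proof -
  assume s: "0 \<le> s" "0 < \<delta>"
  have "0 < \<delta> * (1 + max 0 z)" using s(2) by (intro mult_pos_pos) auto
  then show ?thesis using s(1) by linarith
qed

lemma shifted_u_bound: "0 \<le> s \<Longrightarrow> 0 < \<delta> \<Longrightarrow> \<bar>u (s + \<delta> * (1 + max 0 z)) x\<bar> \<le> K"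
  by (rule u_bound[OF less_imp_le[OF shifted_time_pos]])

lemma avg_integrand_measurable:
  assumes "0 \<le> s" "0 < \<delta>" shows "(\<lambda>z. u (s + \<delta> * (1 + max 0 z)) x) \<in> borel_measurable borel"
  using shifted_time_pos[OF assms] by (intro u_measurable) auto

lemma avg_integrable:
  assumes "0 \<le> s" "0 < \<delta>" shows "set_integrable lborel {0..1} (\<lambda>z. u (s + \<delta> * (1 + max 0 z)) x)"
  by (rule set_integrable_bounded_Icc[OF avg_integrand_measurable[OF assms], of x K]) (rule shifted_u_bound[OF assms])

lemma avg_bound: "0 \<le> s \<Longrightarrow> 0 < \<delta> \<Longrightarrow> \<bar>avg \<delta> s x\<bar> \<le> K"
proof -
  assume s: "0 \<le> s" "0 < \<delta>"
  have "\<bar>avg \<delta> s x\<bar> \<le> K * (1 - 0)"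
    unfolding avg_def by (rule abs_set_integral_le[OF zero_le_one shifted_u_bound[OF s]])
  then show ?thesis by simp
qed

lemma avg_expectation:
  assumes [measurable]: "f \<in> borel_measurable M" "y \<in> borel_measurable M" and f: "\<And>\<omega>. \<omega> \<in> space M \<Longrightarrow> 0 \<le> f \<omega>" and \<delta>: "0 < \<delta>"
  shows "integrable M (\<lambda>\<omega>. avg \<delta> (f \<omega>) (y \<omega>))"
    and "expectation (\<lambda>\<omega>. avg \<delta> (f \<omega>) (y \<omega>)) = (LINT z:{0..1}|lborel. expectation (\<lambda>\<omega>. u (f \<omega> + \<delta> * (1 + max 0 z)) (y \<omega>)))"
proof -
  have j: "(\<lambda>(z, \<omega>). u (f \<omega> + \<delta> * (1 + max 0 z)) (y \<omega>)) \<in> borel_measurable (borel \<Otimes>\<^sub>M M)"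
    unfolding case_prod_unfold
  proof (rule u_measurable)
    show "0 < f (snd p) + \<delta> * (1 + max 0 (fst p))" if "p \<in> space (borel \<Otimes>\<^sub>M M)" for p
      using that f[of "snd p"] \<delta> by (intro shifted_time_pos) (auto simp: space_pair_measure)
  qed measurable
  have bd: "\<bar>u (f \<omega> + \<delta> * (1 + max 0 z)) (y \<omega>)\<bar> \<le> K" if "\<omega> \<in> space M" for z \<omega>
    by (rule shifted_u_bound[OF f[OF that] \<delta>])
  show "integrable M (\<lambda>\<omega>. avg \<delta> (f \<omega>) (y \<omega>))" unfolding avg_def by (rule fubini_bounded(2)[OF j bd])
  show "expectation (\<lambda>\<omega>. avg \<delta> (f \<omega>) (y \<omega>)) = (LINT z:{0..1}|lborel. expectation (\<lambda>\<omega>. u (f \<omega> + \<delta> * (1 + max 0 z)) (y \<omega>)))"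
    unfolding avg_def by (rule fubini_bounded(3)[OF j bd, symmetric])
qed

lemma avg_along_exit:
  assumes t: "0 \<le> t" and \<delta>: "0 < \<delta>" and m: "\<bar>\<xi>\<bar> \<le> m"
  shows "expectation (\<lambda>\<omega>. avg \<delta> (t - exit_time t m \<omega>) (X (exit_time t m \<omega>) \<omega>)) = avg \<delta> t \<xi>"
proof -
  have [measurable]: "(\<lambda>\<omega>. X (exit_time t m \<omega>) \<omega>) \<in> borel_measurable M" by (rule exit_value_measurable[OF t])
  have [measurable]: "exit_time t m \<in> borel_measurable M" using exit_time_basic(4)[OF t] by (rule stopping_time_measurable)
  have A: "expectation (\<lambda>\<omega>. avg \<delta> (t - exit_time t m \<omega>) (X (exit_time t m \<omega>) \<omega>))
      = (LINT z:{0..1}|lborel. expectation (\<lambda>\<omega>. u (t - exit_time t m \<omega> + \<delta> * (1 + max 0 z)) (X (exit_time t m \<omega>) \<omega>)))"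
    by (rule avg_expectation(2); use exit_time_basic(2)[OF t] \<delta> in simp)
  have ex: "expectation (\<lambda>\<omega>. u (t - exit_time t m \<omega> + \<delta> * (1 + max 0 z)) (X (exit_time t m \<omega>) \<omega>)) = u (t + \<delta> * (1 + max 0 z)) \<xi>" for z
  proof -
    have "t - exit_time t m \<omega> + \<delta> * (1 + max 0 z) = t + \<delta> * (1 + max 0 z) - exit_time t m \<omega>" for \<omega> by simp
    moreover have "0 < \<delta> * (1 + max 0 z)" using shifted_time_pos[OF order_refl \<delta>] by simp
    ultimately show ?thesis using u_along_exit[OF t _ m] by (simp only:)
  qed
  show "expectation (\<lambda>\<omega>. avg \<delta> (t - exit_time t m \<omega>) (X (exit_time t m \<omega>) \<omega>)) = avg \<delta> t \<xi>"
    unfolding A ex avg_def[of \<delta> t \<xi>] ..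
qed

text \<open>
  The averages lie strictly to the right of \<open>s\<close>, hence at \<open>s = 0\<close> they see the initial value as a
  limit from the right.
\<close>

lemma avg_shrinking:
  assumes s: "0 \<le> s"
  shows "(\<lambda>j. avg (1 / real (Suc j)) s x) \<longlonglongrightarrow> u s x"
proof -
  define d where "d j = 1 / real (Suc j)" for j
  have d: "0 < d j" for j by (simp add: d_def)
  have d0: "d \<longlonglongrightarrow> 0" unfolding d_def[abs_def] by (rule LIMSEQ_Suc[OF lim_1_over_n])
  have lim: "(\<lambda>j. u (s + d j * (1 + max 0 z)) x) \<longlonglongrightarrow> u s x" for z
  proof -
    have pos: "0 < d j * (1 + max 0 z)" for j using d by (intro mult_pos_pos add_pos_nonneg) auto
    have to: "(\<lambda>j. s + d j * (1 + max 0 z)) \<longlonglongrightarrow> s"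
      using tendsto_add[OF tendsto_const tendsto_mult[OF d0 tendsto_const], of s "1 + max 0 z"] by simp
    show ?thesis
    proof (cases "s = 0")
      case True
      have "filterlim (\<lambda>j. s + d j * (1 + max 0 z)) (at_right 0) sequentially"
      proof (rule filterlim_at_withinI)
        show "filterlim (\<lambda>j. s + d j * (1 + max 0 z)) (nhds 0) sequentially" using to True by simp
        show "\<forall>\<^sub>F j in sequentially. s + d j * (1 + max 0 z) \<in> {0<..} - {0}"
          using shifted_time_pos[OF s d] by (intro always_eventually allI) (simp only: greaterThan_iff Diff_iff singleton_iff, simp only: less_imp_neq[THEN not_sym] simp_thms)
      qed
      then show ?thesis using filterlim_compose[OF u_initial[of x]] True by (simp add: u_0)
    next
      case False
      then have "isCont (\<lambda>s. u s x) s" using u_t[of s x] s by (intro DERIV_isCont) auto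
      then show ?thesis using to by (rule isCont_tendsto_compose)
    qed
  qed
  have "(\<lambda>j. LINT z|lborel. indicator {0..1} z *\<^sub>R u (s + d j * (1 + max 0 z)) x) \<longlonglongrightarrow> integral\<^sup>L lborel (\<lambda>z :: real. indicator {0..1} z *\<^sub>R u s x)"
  proof (rule integral_dominated_convergence[where w="\<lambda>z. K * indicator {0..1} z"])
    show "(\<lambda>z :: real. indicator {0..1} z *\<^sub>R u s x) \<in> borel_measurable lborel" by measurable
    show "(\<lambda>z. indicator {0..1} z *\<^sub>R u (s + d j * (1 + max 0 z)) x) \<in> borel_measurable lborel" for j
      using avg_integrable[OF s d[of j], of x] by (auto simp: set_integrable_def dest: borel_measurable_integrable)
    show "integrable lborel (\<lambda>z. K * indicator {0..1::real} z)" by (intro integrable_mult_right integrable_real_indicator) auto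
    show "AE z :: real in lborel. (\<lambda>j. indicator {0..1} z *\<^sub>R u (s + d j * (1 + max 0 z)) x) \<longlonglongrightarrow> indicator {0..1} z *\<^sub>R u s x"
      using lim by (intro AE_I2 tendsto_intros)
    show "AE z in lborel. norm (indicator {0..1} z *\<^sub>R u (s + d j * (1 + max 0 z)) x) \<le> K * indicator {0..1} z" for j
    proof (rule AE_I2)
      fix z
      have "\<bar>u (s + d j * (1 + max 0 z)) x\<bar> \<le> K" by (rule shifted_u_bound[OF s d])
      then show "norm (indicator {0..1} z *\<^sub>R u (s + d j * (1 + max 0 z)) x) \<le> K * indicator {0..1} z" by (cases "z \<in> {0..1}") simp_all
    qed
  qed
  then show ?thesis by (simp add: avg_def set_lebesgue_integral_def d_def)
qed

text \<open>
  Substituting the time for \<open>z\<close>, the distance to \<open>c\<close> is at most \<open>1 / \<delta>\<close> times the integral of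
  \<open>\<bar>u r (x m) - c\<bar>\<close> over the fixed interval \<open>{0<..t + 2 * \<delta>}\<close>, which tends to zero by dominated
  convergence.
\<close>

lemma avg_boundary:
  assumes s: "\<And>m. s m \<in> {0..t}" and \<delta>: "0 < \<delta>" and lim: "\<And>r. 0 < r \<Longrightarrow> (\<lambda>m. u r (x m)) \<longlonglongrightarrow> c"
  shows "(\<lambda>m. avg \<delta> (s m) (x m)) \<longlonglongrightarrow> c"
proof -
  define f where "f m r = indicator {0<..t + 2 * \<delta>} r * \<bar>u r (x m) - c\<bar>" for m r
  have fm: "f m \<in> borel_measurable borel" for m
  proof -
    have cont: "continuous_on {0<..} (\<lambda>r. \<bar>u r (x m) - c\<bar>)"
      by (intro continuous_intros continuous_at_imp_continuous_on) (auto intro: DERIV_isCont u_t)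
    have "(\<lambda>r. indicator {0<..} r *\<^sub>R \<bar>u r (x m) - c\<bar>) \<in> borel_measurable borel"
      by (intro borel_measurable_continuous_on_indicator cont) auto
    then have "(\<lambda>r. indicator {0<..t + 2 * \<delta>} r * (indicator {0<..} r *\<^sub>R \<bar>u r (x m) - c\<bar>)) \<in> borel_measurable borel" by measurable
    moreover have "f m = (\<lambda>r. indicator {0<..t + 2 * \<delta>} r * (indicator {0<..} r *\<^sub>R \<bar>u r (x m) - c\<bar>))"
      by (auto simp: f_def fun_eq_iff indicator_def)
    ultimately show ?thesis by simp
  qed
  have fb: "\<bar>f m r\<bar> \<le> (K + \<bar>c\<bar>) * indicator {0<..t + 2 * \<delta>} r" for m r
    using u_bound[of r "x m"] by (auto simp: f_def indicator_def)
  have wi: "integrable lborel (\<lambda>r. (K + \<bar>c\<bar>) * indicator {0<..t + 2 * \<delta>} r)"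
    using s[of 0] \<delta> by (intro integrable_mult_right integrable_real_indicator) auto
  have fi: "integrable lborel (f m)" for m
    using fb fm by (intro Bochner_Integration.integrable_bound[OF wi]) (auto intro!: AE_I2 order_trans[OF fb])
  have f0: "(\<lambda>m. LINT r|lborel. f m r) \<longlonglongrightarrow> integral\<^sup>L lborel (\<lambda>r :: real. 0 :: real)"
  proof (rule integral_dominated_convergence[OF _ _ wi])
    show "AE r in lborel. (\<lambda>m. f m r) \<longlonglongrightarrow> 0"
    proof (rule AE_I2)
      fix r show "(\<lambda>m. f m r) \<longlonglongrightarrow> 0"
      proof (cases "0 < r")
        case True
        have "(\<lambda>m. indicator {0<..t + 2 * \<delta>} r * \<bar>u r (x m) - c\<bar>) \<longlonglongrightarrow> indicator {0<..t + 2 * \<delta>} r * \<bar>c - c\<bar>"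
          by (intro tendsto_intros lim True)
        then show ?thesis by (simp add: f_def)
      qed (simp add: f_def)
    qed
  qed (use fm fb in auto)
  have close: "\<bar>avg \<delta> (s m) (x m) - c\<bar> \<le> (LINT r|lborel. f m r) / \<delta>" for m
  proof -
    have s0: "0 \<le> s m" "s m \<le> t" using s[of m] by auto
    have i1: "set_integrable lborel {0..1} (\<lambda>z. u (s m + \<delta> * (1 + max 0 z)) (x m) - c)"
      by (intro set_integral_diff(1) avg_integrable[OF s0(1) \<delta>]) (auto intro: borel_integrable_atLeastAtMost')
    have "avg \<delta> (s m) (x m) - c = (LINT z:{0..1}|lborel. u (s m + \<delta> * (1 + max 0 z)) (x m) - c)"
      unfolding avg_def using avg_integrable[OF s0(1) \<delta>, of "x m"]
      by (subst set_integral_diff(2)) (auto intro: borel_integrable_atLeastAtMost' simp: set_lebesgue_integral_def)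
    also have "\<bar>\<dots>\<bar> \<le> (LINT z:{0..1}|lborel. \<bar>u (s m + \<delta> * (1 + max 0 z)) (x m) - c\<bar>)"
      using set_integral_norm_bound[OF i1] by simp
    also have "\<dots> \<le> (LINT z|lborel. f m ((s m + \<delta>) + \<delta> * z))"
      unfolding set_lebesgue_integral_def
    proof (rule integral_mono)
      show "integrable lborel (\<lambda>z. indicator {0..1} z *\<^sub>R \<bar>u (s m + \<delta> * (1 + max 0 z)) (x m) - c\<bar>)"
        using set_integrable_abs[OF i1] by (simp add: set_integrable_def)
      show "integrable lborel (\<lambda>z. f m ((s m + \<delta>) + \<delta> * z))" using \<delta> by (intro lborel_integrable_real_affine fi) auto
      fix z :: real
      show "indicator {0..1} z *\<^sub>R \<bar>u (s m + \<delta> * (1 + max 0 z)) (x m) - c\<bar> \<le> f m ((s m + \<delta>) + \<delta> * z)"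
      proof (cases "z \<in> {0..1}")
        case True
        then have "\<delta> * z \<le> \<delta> * 1" "0 \<le> \<delta> * z" using \<delta> by (auto intro: mult_left_mono)
        then have "0 < (s m + \<delta>) + \<delta> * z" "(s m + \<delta>) + \<delta> * z \<le> t + 2 * \<delta>" using s0 \<delta> by linarith+
        then have "(s m + \<delta>) + \<delta> * z \<in> {0<..t + 2 * \<delta>}" by simp
        moreover have eq: "s m + \<delta> * (1 + max 0 z) = (s m + \<delta>) + \<delta> * z" using True by (simp add: algebra_simps)
        ultimately show ?thesis unfolding f_def eq using True by simp
      qed (simp add: f_def)
    qed
    also have "\<dots> = (LINT r|lborel. f m r) / \<delta>"
      using lborel_integral_real_affine[of \<delta> "f m" "s m + \<delta>"] \<delta> by simp
    finally show ?thesis .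
  qed
  have "(\<lambda>m. (LINT r|lborel. f m r) / \<delta>) \<longlonglongrightarrow> 0 / \<delta>" using f0 \<delta> by (intro tendsto_intros) auto
  then have "(\<lambda>m. (LINT r|lborel. f m r) / \<delta>) \<longlonglongrightarrow> 0" by simp
  then have "(\<lambda>m. avg \<delta> (s m) (x m) - c) \<longlonglongrightarrow> 0"
    by (rule Lim_null_comparison[rotated]) (simp add: close)
  then show ?thesis by (simp add: LIM_zero_iff)
qed

text \<open>
  At late exit times the path has modulus \<open>m\<close> and the sign of its limit.
\<close>

lemma exit_values:
  assumes \<omega>: "\<omega> \<in> space M" "good \<omega>" and t: "0 \<le> t" and \<tau>: "\<tau> \<omega> \<le> ereal t"
  shows "filterlim (\<lambda>s. X s \<omega>) at_top (at_left (real_of_ereal (\<tau> \<omega>))) \<Longrightarrow> \<forall>\<^sub>F m in sequentially. X (exit_time t (real m) \<omega>) \<omega> = real m"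
    and "filterlim (\<lambda>s. X s \<omega>) at_bot (at_left (real_of_ereal (\<tau> \<omega>))) \<Longrightarrow> \<forall>\<^sub>F m in sequentially. X (exit_time t (real m) \<omega>) \<omega> = - real m"
proof -
  obtain T where T: "\<tau> \<omega> = ereal T" using \<tau> \<tau>_pos[OF \<omega>(1)] by (cases "\<tau> \<omega>") auto
  then have T0: "0 < T" "T \<le> t" using \<tau>_pos[OF \<omega>(1)] \<tau> by auto
  have late: "\<forall>\<^sub>F m in sequentially. s0 < exit_time t (real m) \<omega> \<and> exit_time t (real m) \<omega> < T \<and> \<bar>X (exit_time t (real m) \<omega>) \<omega>\<bar> = real m"
    if s0: "s0 < T" for s0
  proof -
    obtain s1 where s1: "max 0 s0 < s1" "s1 < T" using dense[of "max 0 s0" T] s0 T0 by auto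
    have "\<forall>\<^sub>F m in sequentially. s1 \<le> exit_time t (real m) \<omega>"
      using s1 T0 T by (intro eventually_exit_time_ge[OF \<omega>]) auto
    moreover have "\<forall>\<^sub>F m in sequentially. \<bar>\<xi>\<bar> \<le> real m" by (rule eventually_ge_at_top[THEN filterlim_real_sequentially[unfolded filterlim_iff, rule_format]])
    ultimately show ?thesis
    proof eventually_elim
      case (elim m)
      have "exit_time t (real m) \<omega> < T" using exit_time_basic(3)[OF t \<omega>(1), of "real m"] T by simp
      then show ?case using elim s1 exit_time_explosion[OF \<omega> elim(2) t \<tau>] by auto
    qed
  qed
  { assume "filterlim (\<lambda>s. X s \<omega>) at_top (at_left (real_of_ereal (\<tau> \<omega>)))"
    then have "\<forall>\<^sub>F s in at_left T. 0 < X s \<omega>" using T by (simp add: filterlim_at_top_dense)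
    then obtain s0 where s0: "s0 < T" "\<And>s. s0 < s \<Longrightarrow> s < T \<Longrightarrow> 0 < X s \<omega>" unfolding eventually_at_left_field by blast
    show "\<forall>\<^sub>F m in sequentially. X (exit_time t (real m) \<omega>) \<omega> = real m"
      using late[OF s0(1)] by eventually_elim (use s0(2) in force) }
  { assume "filterlim (\<lambda>s. X s \<omega>) at_bot (at_left (real_of_ereal (\<tau> \<omega>)))"
    then have "\<forall>\<^sub>F s in at_left T. X s \<omega> < 0" using T by (simp add: filterlim_at_bot_dense)
    then obtain s0 where s0: "s0 < T" "\<And>s. s0 < s \<Longrightarrow> s < T \<Longrightarrow> X s \<omega> < 0" unfolding eventually_at_left_field by blast
    show "\<forall>\<^sub>F m in sequentially. X (exit_time t (real m) \<omega>) \<omega> = - real m"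
      using late[OF s0(1)] by eventually_elim (use s0(2) in force) }
qed

text \<open>
  The direction of the explosion is read off from the exit values, countably many random
  variables, which makes the event measurable at once. A path without a limit at \<open>\<tau>\<close> is assigned
  to one of the two directions arbitrarily.
\<close>

definition explodes_up :: "real \<Rightarrow> 'a set" where
  "explodes_up t = {\<omega>\<in>space M. \<tau> \<omega> \<le> ereal t \<and> (\<forall>\<^sub>F m in sequentially. 0 < X (exit_time t (real m) \<omega>) \<omega>)}"

definition explodes_down :: "real \<Rightarrow> 'a set" where
  "explodes_down t = {\<omega>\<in>space M. \<tau> \<omega> \<le> ereal t} - explodes_up t"

lemma explosion_events:
  assumes t: "0 \<le> t"
  shows "{\<omega>\<in>space M. \<tau> \<omega> \<le> ereal t} \<in> events" "explodes_up t \<in> events" "explodes_down t \<in> events"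
proof -
  have [measurable]: "Measurable.pred M (\<lambda>\<omega>. \<tau> \<omega> \<le> ereal t)" using \<tau>_stopping[OF t] by (rule measurable_F_M)
  have [measurable]: "(\<lambda>\<omega>. X (exit_time t (real m) \<omega>) \<omega>) \<in> borel_measurable M" for m by (rule exit_value_measurable[OF t])
  show "{\<omega>\<in>space M. \<tau> \<omega> \<le> ereal t} \<in> events" by measurable
  moreover show "explodes_up t \<in> events" unfolding explodes_up_def eventually_sequentially by measurable
  ultimately show "explodes_down t \<in> events" unfolding explodes_down_def by auto
qed

lemma AE_explosion_direction:
  assumes t: "0 \<le> t"
  shows "AE \<omega> in M. \<tau> \<omega> \<le> ereal t \<longrightarrow>
    (if \<omega> \<in> explodes_up t then filterlim (\<lambda>s. X s \<omega>) at_top (at_left (real_of_ereal (\<tau> \<omega>))) \<and> (\<forall>\<^sub>F m in sequentially. X (exit_time t (real m) \<omega>) \<omega> = real m)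
     else filterlim (\<lambda>s. X s \<omega>) at_bot (at_left (real_of_ereal (\<tau> \<omega>))) \<and> (\<forall>\<^sub>F m in sequentially. X (exit_time t (real m) \<omega>) \<omega> = - real m))"
  using AE_explosion_limit AE_good AE_space
proof eventually_elim
  case (elim \<omega>)
  show ?case
  proof
    assume \<tau>: "\<tau> \<omega> \<le> ereal t"
    then have fin: "\<tau> \<omega> < \<infinity>" by auto
    note ev = exit_values[OF elim(3,2) t \<tau>]
    from elim(1) fin consider "filterlim (\<lambda>s. X s \<omega>) at_top (at_left (real_of_ereal (\<tau> \<omega>)))" | "filterlim (\<lambda>s. X s \<omega>) at_bot (at_left (real_of_ereal (\<tau> \<omega>)))" by blast
    then show "if \<omega> \<in> explodes_up t then filterlim (\<lambda>s. X s \<omega>) at_top (at_left (real_of_ereal (\<tau> \<omega>))) \<and> (\<forall>\<^sub>F m in sequentially. X (exit_time t (real m) \<omega>) \<omega> = real m)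
     else filterlim (\<lambda>s. X s \<omega>) at_bot (at_left (real_of_ereal (\<tau> \<omega>))) \<and> (\<forall>\<^sub>F m in sequentially. X (exit_time t (real m) \<omega>) \<omega> = - real m)"
    proof cases
      case 1
      have "\<forall>\<^sub>F m in sequentially. 0 < X (exit_time t (real m) \<omega>) \<omega>"
        using ev(1)[OF 1] eventually_gt_at_top[of 0] by eventually_elim simp
      then show ?thesis using 1 ev(1)[OF 1] \<tau> elim(3) by (simp add: explodes_up_def)
    next
      case 2
      have "\<omega> \<notin> explodes_up t"
      proof
        assume "\<omega> \<in> explodes_up t"
        then have "\<forall>\<^sub>F m in sequentially. 0 < X (exit_time t (real m) \<omega>) \<omega>" by (simp add: explodes_up_def)
        then have "\<forall>\<^sub>F m :: nat in sequentially. False" using ev(2)[OF 2] by eventually_elim simp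
        then show False by simp
      qed
      then show ?thesis using 2 ev(2)[OF 2] by simp
    qed
  qed
qed

text \<open>
  Let \<open>m\<close> tend to infinity in \<open>avg_along_exit\<close>. Paths that explode until \<open>t\<close> contribute the
  boundary value at \<open>\<infinity>\<close> or \<open>-\<infinity>\<close>. On all other paths the exit time is eventually \<open>t\<close>, and they
  contribute an average of \<open>u\<close> over times of order \<open>\<delta>\<close>, which vanishes with \<open>\<delta>\<close> by the initial
  condition.
\<close>

lemma probabilistic_representation:
  assumes bv: "boundary_values u p q" and t: "0 < t"
  shows "u t \<xi> = p * prob (explodes_up t) + q * prob (explodes_down t)"
proof -
  have t0: "0 \<le> t" using t by simp
  have lim: "(\<lambda>m. u r (real m)) \<longlonglongrightarrow> p" "(\<lambda>m. u r (- real m)) \<longlonglongrightarrow> q" if "0 < r" for r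
    using bv that unfolding boundary_values_def
    by (auto intro: filterlim_compose[OF _ filterlim_real_sequentially]
        filterlim_compose[OF _ filterlim_compose[OF filterlim_uminus_at_bot_at_top filterlim_real_sequentially]])
  define x where "x m \<omega> = X (exit_time t (real m) \<omega>) \<omega>" for m \<omega>
  (* The value at time t matters on paths that have not exploded, and is replaced by 0 on the
     others to obtain a random variable. *)
  define Xt where "Xt \<omega> = (if ereal t < \<tau> \<omega> then X t \<omega> else 0)" for \<omega>
  have Xtm [measurable]: "Xt \<in> borel_measurable M" unfolding Xt_def[abs_def] using X_adapted[OF t0] by (rule measurable_F_M)
  note ev [measurable] = explosion_events[OF t0]
  define l where "l \<delta> \<omega> = (if \<omega> \<in> explodes_up t then p else if \<omega> \<in> explodes_down t then q else avg \<delta> 0 (Xt \<omega>))" for \<delta> \<omega>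
  have avgm: "(\<lambda>\<omega>. avg \<delta> 0 (Xt \<omega>)) \<in> borel_measurable M" if "0 < \<delta>" for \<delta>
    using avg_expectation(1)[of "\<lambda>_. 0" Xt \<delta>] that by (intro borel_measurable_integrable) auto
  have lm: "l \<delta> \<in> borel_measurable M" if "0 < \<delta>" for \<delta>
    unfolding l_def using avgm[OF that] by measurable
  have K: "0 \<le> K" using u_bound[of 0 0] by linarith
  have step: "avg \<delta> t \<xi> = expectation (l \<delta>)" if \<delta>: "0 < \<delta>" for \<delta>
  proof -
    have "(\<lambda>m. expectation (\<lambda>\<omega>. avg \<delta> (t - exit_time t (real m) \<omega>) (x m \<omega>))) \<longlonglongrightarrow> expectation (l \<delta>)"
    proof (rule integral_dominated_convergence[where w="\<lambda>_. K"])
      show "l \<delta> \<in> borel_measurable M" by (rule lm[OF \<delta>])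
      have avg_m: "(\<lambda>\<omega>. avg \<delta> (t - exit_time t (real m) \<omega>) (x m \<omega>)) \<in> borel_measurable M" for m
      proof -
        have [measurable]: "exit_time t (real m) \<in> borel_measurable M" using exit_time_basic(4)[OF t0] by (rule stopping_time_measurable)
        have [measurable]: "x m \<in> borel_measurable M" unfolding x_def[abs_def] by (rule exit_value_measurable[OF t0])
        show ?thesis by (rule borel_measurable_integrable[OF avg_expectation(1)]) (use exit_time_basic(2)[OF t0] \<delta> in auto)
      qed
      show "(\<lambda>\<omega>. avg \<delta> (t - exit_time t (real m) \<omega>) (x m \<omega>)) \<in> borel_measurable M" for m by (rule avg_m)
      show "AE \<omega> in M. norm (avg \<delta> (t - exit_time t (real m) \<omega>) (x m \<omega>)) \<le> K" for m
        using avg_bound[OF _ \<delta>] exit_time_basic(2)[OF t0] by auto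
      show "AE \<omega> in M. (\<lambda>m. avg \<delta> (t - exit_time t (real m) \<omega>) (x m \<omega>)) \<longlonglongrightarrow> l \<delta> \<omega>"
        using AE_explosion_direction[OF t0] AE_good AE_space
      proof eventually_elim
        case (elim \<omega>)
        have s: "t - exit_time t (real m) \<omega> \<in> {0..t}" for m using exit_time_basic(1,2)[OF t0] by auto
        consider "\<omega> \<in> explodes_up t" | "\<omega> \<in> explodes_down t" "\<omega> \<notin> explodes_up t" | "ereal t < \<tau> \<omega>"
        proof (cases "\<tau> \<omega> \<le> ereal t")
          case True
          then show ?thesis using that(1,2) elim(3) by (cases "\<omega> \<in> explodes_up t") (simp_all add: explodes_down_def)
        qed (use that(3) in simp)
        then show ?case
        proof cases
          case 1
          then have e: "\<forall>\<^sub>F m in sequentially. x m \<omega> = real m" using elim(1) by (auto simp: explodes_up_def x_def)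
          have "(\<lambda>m. avg \<delta> (t - exit_time t (real m) \<omega>) (real m)) \<longlonglongrightarrow> p" by (rule avg_boundary[OF s \<delta> lim(1)])
          then have "(\<lambda>m. avg \<delta> (t - exit_time t (real m) \<omega>) (x m \<omega>)) \<longlonglongrightarrow> p"
            by (rule Lim_transform_eventually) (use e in eventually_elim, simp)
          then show ?thesis using 1 by (simp add: l_def)
        next
          case 2
          then have e: "\<forall>\<^sub>F m in sequentially. x m \<omega> = - real m" using elim(1) by (auto simp: explodes_down_def x_def)
          have "(\<lambda>m. avg \<delta> (t - exit_time t (real m) \<omega>) (- real m)) \<longlonglongrightarrow> q" by (rule avg_boundary[OF s \<delta> lim(2)])
          then have "(\<lambda>m. avg \<delta> (t - exit_time t (real m) \<omega>) (x m \<omega>)) \<longlonglongrightarrow> q"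
            by (rule Lim_transform_eventually) (use e in eventually_elim, simp)
          then show ?thesis using 2 by (simp add: l_def)
        next
          case 3
          have "\<forall>\<^sub>F m in sequentially. t \<le> exit_time t (real m) \<omega>"
            using 3(1) t0 by (intro eventually_exit_time_ge[OF elim(3,2)]) auto
          then have "\<forall>\<^sub>F m in sequentially. avg \<delta> 0 (Xt \<omega>) = avg \<delta> (t - exit_time t (real m) \<omega>) (x m \<omega>)"
          proof eventually_elim
            case (elim m)
            then have "exit_time t (real m) \<omega> = t" using exit_time_basic(2)[OF t0, of "real m" \<omega>] by simp
            then show ?case using 3(1) by (simp add: x_def Xt_def)
          qed
          then have "(\<lambda>m. avg \<delta> (t - exit_time t (real m) \<omega>) (x m \<omega>)) \<longlonglongrightarrow> avg \<delta> 0 (Xt \<omega>)"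
            by (rule Lim_transform_eventually[OF tendsto_const])
          moreover have "\<omega> \<notin> explodes_up t" "\<omega> \<notin> explodes_down t" using 3 by (auto simp: explodes_up_def explodes_down_def)
          ultimately show ?thesis by (simp add: l_def)
        qed
      qed
    qed simp
    moreover have "\<forall>\<^sub>F m in sequentially. expectation (\<lambda>\<omega>. avg \<delta> (t - exit_time t (real m) \<omega>) (x m \<omega>)) = avg \<delta> t \<xi>"
    proof -
      have "\<forall>\<^sub>F m in sequentially. \<bar>\<xi>\<bar> \<le> real m" by (rule eventually_ge_at_top[THEN filterlim_real_sequentially[unfolded filterlim_iff, rule_format]])
      then show ?thesis by eventually_elim (unfold x_def, rule avg_along_exit[OF t0 \<delta>])
    qed
    ultimately have "(\<lambda>m :: nat. avg \<delta> t \<xi>) \<longlonglongrightarrow> expectation (l \<delta>)" by (rule Lim_transform_eventually)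
    then show ?thesis by (simp add: LIMSEQ_const_iff)
  qed
  define d where "d j = 1 / real (Suc j)" for j
  have d: "0 < d j" for j by (simp add: d_def)
  define l0 where "l0 \<omega> = p * indicator (explodes_up t) \<omega> + q * indicator (explodes_down t) \<omega>" for \<omega>
  have disj: "\<omega> \<in> explodes_down t \<Longrightarrow> \<omega> \<notin> explodes_up t" for \<omega> by (simp add: explodes_down_def)
  have "(\<lambda>j. expectation (l (d j))) \<longlonglongrightarrow> expectation l0"
  proof (rule integral_dominated_convergence[where w="\<lambda>_. \<bar>p\<bar> + \<bar>q\<bar> + K"])
    show "l0 \<in> borel_measurable M" unfolding l0_def by measurable
    show "AE \<omega> in M. norm (l (d j) \<omega>) \<le> \<bar>p\<bar> + \<bar>q\<bar> + K" for j
    proof (rule AE_I2)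
      fix \<omega>
      show "norm (l (d j) \<omega>) \<le> \<bar>p\<bar> + \<bar>q\<bar> + K"
        using avg_bound[OF order_refl d[of j], of "Xt \<omega>"] K abs_ge_zero[of p] abs_ge_zero[of q]
        unfolding l_def real_norm_def
        by (cases "\<omega> \<in> explodes_up t"; cases "\<omega> \<in> explodes_down t"; simp only: if_True if_False; linarith)
    qed
    show "AE \<omega> in M. (\<lambda>j. l (d j) \<omega>) \<longlonglongrightarrow> l0 \<omega>"
    proof (rule AE_I2)
      fix \<omega>
      have "(\<lambda>j. avg (d j) 0 (Xt \<omega>)) \<longlonglongrightarrow> 0" using avg_shrinking[of 0 "Xt \<omega>"] by (simp add: d_def u_0)
      then show "(\<lambda>j. l (d j) \<omega>) \<longlonglongrightarrow> l0 \<omega>" 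
        using disj[of \<omega>] by (cases "\<omega> \<in> explodes_up t"; cases "\<omega> \<in> explodes_down t") (simp_all add: l_def l0_def)
    qed
  qed (use lm d in auto)
  moreover have "(\<lambda>j. expectation (l (d j))) \<longlonglongrightarrow> u t \<xi>"
    using avg_shrinking[OF t0, of \<xi>] step[OF d] by (simp add: d_def)
  ultimately have "u t \<xi> = expectation l0" using LIMSEQ_unique by blast
  also have "\<dots> = p * prob (explodes_up t) + q * prob (explodes_down t)"
    unfolding l0_def using ev by (simp add: emeasure_eq_measure)
  finally show ?thesis .
qed

lemma extended_process_infinite:
  assumes "\<bar>y\<bar> = \<infinity>"
  shows "extended_process X \<tau> t \<omega> = y \<longleftrightarrow> \<tau> \<omega> \<le> ereal t \<and> Lim (at_left (real_of_ereal (\<tau> \<omega>))) (\<lambda>s. ereal (X s \<omega>)) = y"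
  using assms by (auto simp: extended_process_def not_less)

text \<open>
  From the explosion on, the extended process is constant, so it is infinite with sign \<open>y\<close> either
  from \<open>\<tau>\<close> on or never.
\<close>

lemma Inf_infinite_times:
  assumes \<omega>: "\<omega> \<in> space M" and y: "\<bar>y\<bar> = \<infinity>"
  shows "Inf {ereal t |t. 0 < t \<and> extended_process X \<tau> t \<omega> = y} \<le> ereal t \<longleftrightarrow>
    \<tau> \<omega> \<le> ereal t \<and> Lim (at_left (real_of_ereal (\<tau> \<omega>))) (\<lambda>s. ereal (X s \<omega>)) = y"
proof (cases "Lim (at_left (real_of_ereal (\<tau> \<omega>))) (\<lambda>s. ereal (X s \<omega>)) = y")
  case True
  have "{ereal t |t. 0 < t \<and> extended_process X \<tau> t \<omega> = y} = {ereal t |t. \<tau> \<omega> \<le> ereal t}"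
    using True \<tau>_pos[OF \<omega>] extended_process_infinite[OF y] by (auto simp: zero_ereal_def dest: less_le_trans)
  moreover have "Inf {ereal t |t. \<tau> \<omega> \<le> ereal t} = \<tau> \<omega>"
  proof (cases "\<tau> \<omega>")
    case (real r)
    then show ?thesis by (intro cInf_eq_minimum) auto
  next
    case PInf
    then show ?thesis by (simp add: top_ereal_def)
  qed (use \<tau>_pos[OF \<omega>] in auto)
  ultimately show ?thesis using True by simp
next
  case False
  then show ?thesis using extended_process_infinite[OF y] by (simp add: top_ereal_def)
qed

text \<open>
  The events agree up to a null set, and by completeness the left-hand sides are measurable as
  well.
\<close>

lemma explosion_time_events:
  assumes t: "0 \<le> t"
  shows "prob {\<omega> \<in> space M. explosion_time_pos X \<tau> \<omega> \<le> ereal t} = prob (explodes_up t)"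
    and "prob {\<omega> \<in> space M. explosion_time_neg X \<tau> \<omega> \<le> ereal t} = prob (explodes_down t)"
proof -
  interpret C: complete_measure M by (rule complete)
  have ae: "AE \<omega> in M. (\<omega> \<in> explodes_up t \<longleftrightarrow> \<omega> \<in> {\<omega> \<in> space M. explosion_time_pos X \<tau> \<omega> \<le> ereal t}) \<and>
    (\<omega> \<in> explodes_down t \<longleftrightarrow> \<omega> \<in> {\<omega> \<in> space M. explosion_time_neg X \<tau> \<omega> \<le> ereal t})"
    using AE_explosion_direction[OF t] AE_space
  proof eventually_elim
    case (elim \<omega>)
    define L where "L = Lim (at_left (real_of_ereal (\<tau> \<omega>))) (\<lambda>s. ereal (X s \<omega>))"
    have pos: "explosion_time_pos X \<tau> \<omega> \<le> ereal t \<longleftrightarrow> \<tau> \<omega> \<le> ereal t \<and> L = \<infinity>"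
      and neg: "explosion_time_neg X \<tau> \<omega> \<le> ereal t \<longleftrightarrow> \<tau> \<omega> \<le> ereal t \<and> L = -\<infinity>"
      unfolding explosion_time_pos_def explosion_time_neg_def L_def by (rule Inf_infinite_times[OF elim(2)], simp)+
    show ?case
    proof (cases "\<tau> \<omega> \<le> ereal t")
      case False
      then show ?thesis using pos neg by (auto simp: explodes_up_def explodes_down_def)
    next
      case True
      show ?thesis
      proof (cases "\<omega> \<in> explodes_up t")
        case up: True
        have "((\<lambda>s. ereal (X s \<omega>)) \<longlongrightarrow> \<infinity>) (at_left (real_of_ereal (\<tau> \<omega>)))"
          using elim(1) True up by (simp add: tendsto_PInfty_eq_at_top)
        then have "L = \<infinity>" unfolding L_def by (intro tendsto_Lim) auto
        then show ?thesis using up pos neg True elim(2) by (auto simp: explodes_down_def)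
      next
        case down: False
        have "((\<lambda>s. ereal (X s \<omega>)) \<longlongrightarrow> -\<infinity>) (at_left (real_of_ereal (\<tau> \<omega>)))"
          using elim(1) True down by (simp add: tendsto_MInfty filterlim_at_bot_dense)
        then have "L = -\<infinity>" unfolding L_def by (intro tendsto_Lim) auto
        then show ?thesis using down pos neg True elim(2) by (auto simp: explodes_down_def)
      qed
    qed
  qed
  have eq: "prob B = prob A" if "AE \<omega> in M. \<omega> \<in> A \<longleftrightarrow> \<omega> \<in> B" "A \<in> events" "B \<subseteq> space M" for A B
    using C.in_sets_AE[OF that] that(1,2) by (intro measure_eq_AE) (auto elim: eventually_mono)
  show "prob {\<omega> \<in> space M. explosion_time_pos X \<tau> \<omega> \<le> ereal t} = prob (explodes_up t)"
    by (rule eq) (use ae explosion_events[OF t] in auto)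
  show "prob {\<omega> \<in> space M. explosion_time_neg X \<tau> \<omega> \<le> ereal t} = prob (explodes_down t)"
    by (rule eq) (use ae explosion_events[OF t] in auto)
qed

lemma explosion_time_split:
  assumes t: "0 \<le> t"
  shows "prob {\<omega> \<in> space M. \<tau> \<omega> \<le> ereal t} = prob (explodes_up t) + prob (explodes_down t)"
proof -
  have "explodes_up t \<subseteq> {\<omega> \<in> space M. \<tau> \<omega> \<le> ereal t}" by (auto simp: explodes_up_def)
  then show ?thesis
    unfolding explodes_down_def using explosion_events(1,2)[OF t] by (simp add: finite_measure_Diff)
qed

lemma explosion_probabilities:
  assumes bv: "boundary_values u p q" and t: "0 \<le> t"
  shows "u t \<xi> = p * prob (explodes_up t) + q * prob (explodes_down t)"
proof (cases "t = 0")
  case True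
  have "\<not> \<tau> \<omega> \<le> ereal 0" if "\<omega> \<in> space M" for \<omega> using \<tau>_pos[OF that] by (simp add: zero_ereal_def not_le)
  then have "explodes_up t = {}" "explodes_down t = {}" using True by (auto simp: explodes_up_def explodes_down_def)
  then show ?thesis using True by (simp add: u_0)
qed (use probabilistic_representation[OF bv] t in simp)

end

theorem theorem19:
  fixes M :: "'a measure" and F :: "real \<Rightarrow> 'a measure"
    and W X :: "real \<Rightarrow> 'a \<Rightarrow> real" and \<tau> :: "'a \<Rightarrow> ereal"
    and b \<sigma> :: "real \<Rightarrow> real" and \<xi> :: real
    and u :: "real \<Rightarrow> real \<Rightarrow> real"
  assumes "prob_space M" and "complete_measure M"
    and "complete_filtration M F"
    and "brownian_motion M F W"
    and "b C1_differentiable_on UNIV" and "\<sigma> C1_differentiable_on UNIV"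
    and "sde_solution_up_to_explosion M F W b \<sigma> \<xi> X \<tau>"
    and "bounded ((\<lambda>(t, x). u t x) ` ({0..} \<times> UNIV))"
    and "kolmogorov_solution b \<sigma> u"
  shows "(boundary_values u 1 1 \<longrightarrow>
           (\<forall>t\<ge>0. measure M {\<omega> \<in> space M. \<tau> \<omega> \<le> ereal t} = u t \<xi>)) \<and>
         (boundary_values u 1 0 \<longrightarrow>
           (\<forall>t\<ge>0. measure M {\<omega> \<in> space M. explosion_time_pos X \<tau> \<omega> \<le> ereal t} = u t \<xi>)) \<and>
         (boundary_values u 0 1 \<longrightarrow>
           (\<forall>t\<ge>0. measure M {\<omega> \<in> space M. explosion_time_neg X \<tau> \<omega> \<le> ereal t} = u t \<xi>))"
proof -
  interpret prob_space M by fact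
  obtain K where "\<forall>p\<in>(\<lambda>(t, x). u t x) ` ({0..} \<times> UNIV). \<bar>p\<bar> \<le> K"
    using assms(8) unfolding bounded_iff by auto
  then have K: "\<bar>u t x\<bar> \<le> K" if "0 \<le> t" for t x
    by (rule bspec[where x="u t x"]) (use that in \<open>intro image_eqI[of _ _ "(t, x)"], auto\<close>)
  interpret kolmogorov_setting M F W b \<sigma> \<xi> X \<tau> u K
  proof unfold_locales
    show "B \<in> sets M" if "B \<subseteq> A" "A \<in> null_sets M" for A B
      using complete_measure.complete[OF assms(2)] that by blast
    show "\<bar>u t x\<bar> \<le> K" if "0 \<le> t" for t x by (rule K[OF that])
    show "continuous_on UNIV b" "continuous_on UNIV \<sigma>"
      using assms(5,6) by (auto intro: C1_differentiable_imp_continuous_on)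
  qed (fact assms)+
  show ?thesis
    using explosion_probabilities explosion_time_events explosion_time_split by simp
qed

end
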